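(* Let $\mathcal{C}$ be a triangulated category and let $\mathcal{P}=((\mathcal{S},\mathcal{T}),(\mathcal{U},\mathcal{V}))$ be a concentric twin cotorsion pair on $\mathcal{C}$ satisfying conditions (I) and (II) (stated in the context). Then the class $\mathfrak{M}_{\mathcal{P}}$ of mutable cotorsion pairs on $\mathcal{C}$ with respect to $\mathcal{P}$ satisfies $$\mathfrak{M}_{\mathcal{P}}=\{(\mathcal{A},\mathcal{B})\in\mathfrak{CP}(\mathcal{C})\mid\mathcal{A}=\mathcal{U}\cap(\mathcal{S}[-1]\ast\mathcal{A}),\ \mathcal{B}=\mathcal{T}\cap(\mathcal{B}\ast\mathcal{V}[1])\}.$$
   Context: $\mathcal{C}$ is a triangulated category with shift $[1]$; $\mathrm{Ext}^1(X,Y)=\mathcal{C}(X,Y[1])$. For full subcategories $\mathcal{X},\mathcal{Y}\subseteq\mathcal{C}$, $\mathcal{X}\ast\mathcal{Y}$ is the full subcategory of objects $C$ admitting a distinguished triangle $X\to C\to Y\to X[1]$ with $X\in\mathcal{X},Y\in\mathcal{Y}$. A cotorsion pair on $\mathcal{C}$ is a pair $(\mathcal{U},\mathcal{V})$ of full additive subcategories closed under isomorphisms and direct summands with $\mathcal{C}=\mathcal{U}\ast\mathcal{V}[1]$ and $\mathrm{Ext}^1(\mathcal{U},\mathcal{V})=0$; $\mathfrak{CP}(\mathcal{C})$ is the class of cotorsion pairs on $\mathcal{C}$. A twin cotorsion pair (TCP) is a pair $((\mathcal{S},\mathcal{T}),(\mathcal{U},\mathcal{V}))$ of cotorsion pairs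 with $\mathrm{Ext}^1(\mathcal{S},\mathcal{V})=0$ (equivalently $\mathcal{S}\subseteq\mathcal{U}$, equivalently $\mathcal{V}\subseteq\mathcal{T}$). It is concentric if $\mathcal{S}\cap\mathcal{T}=\mathcal{U}\cap\mathcal{V}=:\mathcal{I}$. Put $\mathcal{Z}=\mathcal{T}\cap\mathcal{U}$, $\mathcal{N}^i=\mathcal{S}\ast\mathcal{V}[1]$, $\mathcal{N}^f=\mathcal{S}[-1]\ast\mathcal{V}$. For $\mathcal{I}\subseteq\mathcal{X}\subseteq\mathcal{C}$, $\mathcal{X}/\mathcal{I}$ is the ideal quotient (same objects; morphisms modulo those factoring through an object of $\mathcal{I}$); $\underline{f}$ is the class of $f$. Adjoints. $\mathcal{U}/\mathcal{I}\hookrightarrow\mathcal{C}/\mathcal{I}$ has a right adjoint $\omega_{\mathcal{U}}$ with counit $\varepsilon_{\mathcal{U}}$: for a triangle $U\overset{u}{\to}C\to V[1]\to U[1]$ with $U\in\mathcal{U},V\in\mathcal{V}$, $\omega_{\mathcal{U}}(C)=U$ and $(\varepsilon_{\mathcal{U}})_C=\underline{u}$. $\mathcal{T}/\mathcal{I}\hookrightarrow\mathcal{C}/\mathcal{I}$ has a left adjoint $\sigma_{\mathcal{T}}$ with unit $\eta_{\mathcal{T}}$: for a triangle $S[-1]\to C\overset{t}{\to}T\to S$ with $S\in\mathcal{S},T\in\mathcal{T}$, $\sigma_{\mathcal{T}}(C)=T$ and $(\eta_{\mathcal{T}})_C=\underline{t}$. These restrict to a right adjoint $\omega\colon\mathcal{T}/\mathcal{I}\to\mathcal{Z}/\mathcal{I}$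 (counit $\varepsilon$) and a left adjoint $\sigma\colon\mathcal{U}/\mathcal{I}\to\mathcal{Z}/\mathcal{I}$ (unit $\eta$) of the inclusions. There is a unique natural transformation $\mu\colon\sigma\circ\omega_{\mathcal{U}}\Rightarrow\omega\circ\sigma_{\mathcal{T}}$ of functors $\mathcal{C}/\mathcal{I}\to\mathcal{Z}/\mathcal{I}$ with $\varepsilon_{\sigma_{\mathcal{T}}(X)}\circ\mu_X\circ\eta_{\omega_{\mathcal{U}}(X)}=(\eta_{\mathcal{T}})_X\circ(\varepsilon_{\mathcal{U}})_X$ in $\mathcal{C}/\mathcal{I}$ for all $X\in\mathcal{C}$. Condition (I): for every $X\in\mathcal{T}\ast\mathcal{U}$, $\mu_X\colon\sigma(\omega_{\mathcal{U}}(X))\to\omega(\sigma_{\mathcal{T}}(X))$ is an isomorphism in $\mathcal{Z}/\mathcal{I}$. Condition (II): $\mathcal{U}\cap\mathcal{N}^f=\mathcal{S}$ and $\mathcal{T}\cap\mathcal{N}^i=\mathcal{V}$. Shift on $\mathcal{Z}/\mathcal{I}$. For $Z\in\mathcal{Z}$ choose a triangle $Z\to I\to U\to Z[1]$ with $I\in\mathcal{I}$, $U\in\mathcal{U}$, and put $Z\langle1\rangle=U$; a morphism $\underline{z}$ is sent to $\underline{u}$, where $(z,i,u)$ is a morphism between the chosen triangles. This is a functor $\langle1\rangle\colon\mathcal{Z}/\mathcal{I}\to\mathcal{U}/\mathcal{I}$. Put $\Sigma=\sigma\circ\langle1\rangle$ and $\mathrm{Ext}^1_{\mathcal{Z}/\mathcal{I}}(X,Y)=(\mathcal{Z}/\mathcal{I})(X,\Sigma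 Y)$. By definition, $$\mathfrak{M}_{\mathcal{P}}=\{(\mathcal{A},\mathcal{B})\in\mathfrak{CP}(\mathcal{C})\mid \mathcal{S}\subseteq\mathcal{A}\subseteq\mathcal{U},\ \mathcal{V}\subseteq\mathcal{B}\subseteq\mathcal{T},\ \mathrm{Ext}^1_{\mathcal{Z}/\mathcal{I}}(\sigma(\mathcal{A}/\mathcal{I}),\omega(\mathcal{B}/\mathcal{I}))=0\}.$$ *)

theory Defs
  imports "HOL-Algebra.Coset"
begin

section \<open>Categories\<close>

record ('o, 'a) cat =
  Obj :: "'o set"
  Arr :: "'a set"
  dm :: "'a \<Rightarrow> 'o"
  cd :: "'a \<Rightarrow> 'o"
  ident :: "'o \<Rightarrow> 'a"
  cmp :: "'a \<Rightarrow> 'a \<Rightarrow> 'a"  (infixl "\<cdot>\<index>" 70)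

definition homs :: "('o, 'a, 'm) cat_scheme \<Rightarrow> 'o \<Rightarrow> 'o \<Rightarrow> 'a set" where
  "homs C X Y = {f \<in> Arr C. dm C f = X \<and> cd C f = Y}"

text \<open>\<open>g \<cdot> f\<close> is \<open>g\<close> after \<open>f\<close>.\<close>

locale category =
  fixes C (structure)
  assumes arr_ends: "f \<in> Arr C \<Longrightarrow> dm C f \<in> Obj C \<and> cd C f \<in> Obj C"
    and ident_hom: "X \<in> Obj C \<Longrightarrow> ident C X \<in> homs C X X"
    and cmp_hom: "\<lbrakk>f \<in> homs C X Y; g \<in> homs C Y Z\<rbrakk> \<Longrightarrow> g \<cdot> f \<in> homs C X Z"
    and cmp_ident_left: "f \<in> homs C X Y \<Longrightarrow> ident C Y \<cdot> f = f"
    and cmp_ident_right: "f \<in> homs C X Y \<Longrightarrow> f \<cdot> ident C X = f"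
    and cmp_assoc: "\<lbrakk>f \<in> homs C X Y; g \<in> homs C Y Z; h \<in> homs C Z W\<rbrakk>
          \<Longrightarrow> (h \<cdot> g) \<cdot> f = h \<cdot> (g \<cdot> f)"

definition is_iso :: "('o, 'a, 'm) cat_scheme \<Rightarrow> 'a \<Rightarrow> bool" where
  "is_iso C f \<longleftrightarrow> f \<in> Arr C \<and>
     (\<exists>g \<in> homs C (cd C f) (dm C f).
        g \<cdot>\<^bsub>C\<^esub> f = ident C (dm C f) \<and> f \<cdot>\<^bsub>C\<^esub> g = ident C (cd C f))"

definition isomorphic :: "('o, 'a, 'm) cat_scheme \<Rightarrow> 'o \<Rightarrow> 'o \<Rightarrow> bool" where
  "isomorphic C X Y \<longleftrightarrow> (\<exists>f \<in> homs C X Y. is_iso C f)"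

record ('o, 'a, 'p, 'b) ftor =
  fob :: "'o \<Rightarrow> 'p"
  far :: "'a \<Rightarrow> 'b"

definition ftor_comp ::
    "('p, 'b, 'q, 'c) ftor \<Rightarrow> ('o, 'a, 'p, 'b) ftor \<Rightarrow> ('o, 'a, 'q, 'c) ftor" where
  "ftor_comp G F = \<lparr>fob = fob G \<circ> fob F, far = far G \<circ> far F\<rparr>"

definition nat_trans ::
    "('o, 'a, 'm) cat_scheme \<Rightarrow> ('p, 'b, 'n) cat_scheme \<Rightarrow> ('o, 'a, 'p, 'b) ftor
      \<Rightarrow> ('o, 'a, 'p, 'b) ftor \<Rightarrow> ('o \<Rightarrow> 'b) \<Rightarrow> bool" where
  "nat_trans A B F G \<tau> \<longleftrightarrow>
     (\<forall>X \<in> Obj A. \<tau> X \<in> homs B (fob F X) (fob G X)) \<and>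
     (\<forall>f \<in> Arr A. \<tau> (cd A f) \<cdot>\<^bsub>B\<^esub> far F f = far G f \<cdot>\<^bsub>B\<^esub> \<tau> (dm A f))"


section \<open>Additive categories\<close>

record ('o, 'a) acat = "('o, 'a) cat" +
  addm :: "'a \<Rightarrow> 'a \<Rightarrow> 'a"
  zerom :: "'o \<Rightarrow> 'o \<Rightarrow> 'a"

definition homgrp :: "('o, 'a, 'm) acat_scheme \<Rightarrow> 'o \<Rightarrow> 'o \<Rightarrow> 'a monoid" where
  "homgrp C X Y = \<lparr>carrier = homs C X Y, mult = addm C, one = zerom C X Y\<rparr>"

definition neg :: "('o, 'a, 'm) acat_scheme \<Rightarrow> 'a \<Rightarrow> 'a" where
  "neg C f = m_inv (homgrp C (dm C f) (cd C f)) f"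

definition zero_obj :: "('o, 'a, 'm) acat_scheme \<Rightarrow> 'o \<Rightarrow> bool" where
  "zero_obj C X \<longleftrightarrow> X \<in> Obj C \<and> ident C X = zerom C X X"

definition biproduct :: "('o, 'a, 'm) acat_scheme \<Rightarrow> 'o \<Rightarrow> 'o \<Rightarrow> 'o \<Rightarrow> bool" where
  "biproduct C X Y W \<longleftrightarrow>
     (\<exists>i \<in> homs C X W. \<exists>j \<in> homs C Y W. \<exists>p \<in> homs C W X. \<exists>q \<in> homs C W Y.
        p \<cdot>\<^bsub>C\<^esub> i = ident C X \<and> q \<cdot>\<^bsub>C\<^esub> j = ident C Y \<and>
        q \<cdot>\<^bsub>C\<^esub> i = zerom C X Y \<and> p \<cdot>\<^bsub>C\<^esub> j = zerom C Y X \<and>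
        addm C (i \<cdot>\<^bsub>C\<^esub> p) (j \<cdot>\<^bsub>C\<^esub> q) = ident C W)"

locale preadditive = category +
  assumes hom_comm_group: "\<lbrakk>X \<in> Obj C; Y \<in> Obj C\<rbrakk> \<Longrightarrow> comm_group (homgrp C X Y)"
    and cmp_add_right: "\<lbrakk>f \<in> homs C X Y; f' \<in> homs C X Y; g \<in> homs C Y Z\<rbrakk>
          \<Longrightarrow> g \<cdot> addm C f f' = addm C (g \<cdot> f) (g \<cdot> f')"
    and cmp_add_left: "\<lbrakk>f \<in> homs C X Y; g \<in> homs C Y Z; g' \<in> homs C Y Z\<rbrakk>
          \<Longrightarrow> addm C g g' \<cdot> f = addm C (g \<cdot> f) (g' \<cdot> f)"

locale additive = preadditive +
  assumes ex_zero_obj: "\<exists>X. zero_obj C X"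
    and ex_biproduct: "\<lbrakk>X \<in> Obj C; Y \<in> Obj C\<rbrakk> \<Longrightarrow> \<exists>W. biproduct C X Y W"

text \<open>Full subcategories are represented by their sets of objects.\<close>

definition additive_subcat :: "('o, 'a, 'm) acat_scheme \<Rightarrow> 'o set \<Rightarrow> bool" where
  "additive_subcat C \<X> \<longleftrightarrow> \<X> \<subseteq> Obj C \<and> (\<exists>X \<in> \<X>. zero_obj C X) \<and>
     (\<forall>X \<in> \<X>. \<forall>Y \<in> \<X>. \<exists>W \<in> \<X>. biproduct C X Y W)"

definition closed_iso :: "('o, 'a, 'm) cat_scheme \<Rightarrow> 'o set \<Rightarrow> bool" where
  "closed_iso C \<X> \<longleftrightarrow> (\<forall>X \<in> \<X>. \<forall>Y \<in> Obj C. isomorphic C X Y \<longrightarrow> Y \<in> \<X>)"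

definition closed_summands :: "('o, 'a, 'm) acat_scheme \<Rightarrow> 'o set \<Rightarrow> bool" where
  "closed_summands C \<X> \<longleftrightarrow>
     (\<forall>W \<in> \<X>. \<forall>X \<in> Obj C. \<forall>Y \<in> Obj C. biproduct C X Y W \<longrightarrow> X \<in> \<X> \<and> Y \<in> \<X>)"


section \<open>Ideal quotients\<close>

definition factor_ideal :: "('o, 'a, 'm) acat_scheme \<Rightarrow> 'o set \<Rightarrow> 'o \<Rightarrow> 'o \<Rightarrow> 'a set" where
  "factor_ideal C \<I> X Y =
     {b \<cdot>\<^bsub>C\<^esub> a | a b W. W \<in> \<I> \<and> a \<in> homs C X W \<and> b \<in> homs C W Y}"

definition qcls :: "('o, 'a, 'm) acat_scheme \<Rightarrow> 'o set \<Rightarrow> 'a \<Rightarrow> 'a set" where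
  "qcls C \<I> f = factor_ideal C \<I> (dm C f) (cd C f) #>\<^bsub>homgrp C (dm C f) (cd C f)\<^esub> f"

text \<open>
  \<open>quot C \<X> \<I>\<close> is the category \<open>\<X>/\<I>\<close>. The class of a morphism is its coset modulo the
  morphisms factoring through an object of \<open>\<I>\<close>, so it does not depend on \<open>\<X>\<close>.
\<close>

definition quot ::
    "('o, 'a, 'm) acat_scheme \<Rightarrow> 'o set \<Rightarrow> 'o set \<Rightarrow> ('o, 'a set) acat" where
  "quot C \<X> \<I> =
     \<lparr>Obj = \<X>,
      Arr = qcls C \<I> ` {f \<in> Arr C. dm C f \<in> \<X> \<and> cd C f \<in> \<X>},
      dm = (\<lambda>F. the_elem (dm C ` F)),
      cd = (\<lambda>F. the_elem (cd C ` F)),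
      ident = (\<lambda>X. qcls C \<I> (ident C X)),
      cmp = (\<lambda>G F. the_elem {qcls C \<I> (g \<cdot>\<^bsub>C\<^esub> f) | f g. f \<in> F \<and> g \<in> G}),
      addm = (\<lambda>F G. the_elem {qcls C \<I> (addm C f g) | f g. f \<in> F \<and> g \<in> G}),
      zerom = (\<lambda>X Y. qcls C \<I> (zerom C X Y))\<rparr>"


section \<open>Triangulated categories\<close>

text \<open>
  A candidate triangle \<open>X \<rightarrow> Y \<rightarrow> Z \<rightarrow> X[1]\<close> is given by its three morphisms; its objects are
  recovered as their domains and codomains.
\<close>

record ('o, 'a) tcat = "('o, 'a) acat" +
  sho :: "'o \<Rightarrow> 'o"
  sha :: "'a \<Rightarrow> 'a"
  dist :: "('a \<times> 'a \<times> 'a) set"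

definition triangle_on ::
    "('o, 'a, 'm) tcat_scheme \<Rightarrow> 'o \<Rightarrow> 'o \<Rightarrow> 'o \<Rightarrow> 'a \<Rightarrow> 'a \<Rightarrow> 'a \<Rightarrow> bool" where
  "triangle_on C X Y Z f g h \<longleftrightarrow>
     f \<in> homs C X Y \<and> g \<in> homs C Y Z \<and> h \<in> homs C Z (sho C X) \<and> (f, g, h) \<in> dist C"

text \<open>
  The shift is only required to be an additive autoequivalence, which includes the case of an
  automorphism.
\<close>

locale triangulated = additive +
  assumes sho_obj: "X \<in> Obj C \<Longrightarrow> sho C X \<in> Obj C"
    and sha_ident: "X \<in> Obj C \<Longrightarrow> sha C (ident C X) = ident C (sho C X)"
    and sha_cmp: "\<lbrakk>f \<in> homs C X Y; g \<in> homs C Y Z\<rbrakk> \<Longrightarrow> sha C (g \<cdot> f) = sha C g \<cdot> sha C f"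
    and sha_add: "\<lbrakk>f \<in> homs C X Y; f' \<in> homs C X Y\<rbrakk>
          \<Longrightarrow> sha C (addm C f f') = addm C (sha C f) (sha C f')"
    and sha_bij: "\<lbrakk>X \<in> Obj C; Y \<in> Obj C\<rbrakk>
          \<Longrightarrow> bij_betw (sha C) (homs C X Y) (homs C (sho C X) (sho C Y))"
    and sho_ess_surj: "Y \<in> Obj C \<Longrightarrow> \<exists>X \<in> Obj C. isomorphic C (sho C X) Y"
    and dist_triangle: "(f, g, h) \<in> dist C \<Longrightarrow> \<exists>X Y Z. triangle_on C X Y Z f g h"
    and dist_iso:
      "\<lbrakk>triangle_on C X Y Z f g h;
        x \<in> homs C X X'; y \<in> homs C Y Y'; z \<in> homs C Z Z';
        is_iso C x; is_iso C y; is_iso C z;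
        f' \<in> homs C X' Y'; g' \<in> homs C Y' Z'; h' \<in> homs C Z' (sho C X');
        y \<cdot> f = f' \<cdot> x; z \<cdot> g = g' \<cdot> y; sha C x \<cdot> h = h' \<cdot> z\<rbrakk>
       \<Longrightarrow> (f', g', h') \<in> dist C"
    and dist_ident:
      "\<lbrakk>X \<in> Obj C; zero_obj C N\<rbrakk>
       \<Longrightarrow> (ident C X, zerom C X N, zerom C N (sho C X)) \<in> dist C"
    and dist_extend: "f \<in> Arr C \<Longrightarrow> \<exists>g h. (f, g, h) \<in> dist C"
    and dist_rotate:
      "\<lbrakk>f \<in> homs C X Y; g \<in> homs C Y Z; h \<in> homs C Z (sho C X)\<rbrakk>
       \<Longrightarrow> (f, g, h) \<in> dist C \<longleftrightarrow> (g, h, neg C (sha C f)) \<in> dist C"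
    and dist_morphism:
      "\<lbrakk>triangle_on C X Y Z f g h; triangle_on C X' Y' Z' f' g' h';
        x \<in> homs C X X'; y \<in> homs C Y Y'; y \<cdot> f = f' \<cdot> x\<rbrakk>
       \<Longrightarrow> \<exists>z \<in> homs C Z Z'. z \<cdot> g = g' \<cdot> y \<and> sha C x \<cdot> h = h' \<cdot> z"
    and octahedron:
      "\<lbrakk>triangle_on C X Y Z' f f' f''; triangle_on C Y Z X' g g' g'';
        triangle_on C X Z Y' (g \<cdot> f) h' h''\<rbrakk>
       \<Longrightarrow> \<exists>u \<in> homs C Z' Y'. \<exists>v \<in> homs C Y' X'.
             (u, v, sha C f' \<cdot> g'') \<in> dist C \<and>
             u \<cdot> f' = h' \<cdot> g \<and> h'' \<cdot> u = f'' \<and> v \<cdot> h' = g' \<and> g'' \<cdot> v = sha C f \<cdot> h''"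

text \<open>
  \<open>shift_up\<close> and \<open>shift_down\<close> are \<open>\<X>[1]\<close> and \<open>\<X>[-1]\<close> as isomorphism-closed subcategories. For
  \<open>\<X>\<close> closed under isomorphisms, \<open>\<X>[-1]\<close> consists of the objects whose shift lies in \<open>\<X>\<close>,
  so no quasi-inverse of the shift has to be chosen.
\<close>

definition shift_up :: "('o, 'a, 'm) tcat_scheme \<Rightarrow> 'o set \<Rightarrow> 'o set" where
  "shift_up C \<X> = {Y \<in> Obj C. \<exists>X \<in> \<X>. isomorphic C (sho C X) Y}"

definition shift_down :: "('o, 'a, 'm) tcat_scheme \<Rightarrow> 'o set \<Rightarrow> 'o set" where
  "shift_down C \<X> = {Y \<in> Obj C. \<exists>X \<in> \<X>. isomorphic C (sho C Y) X}"

definition star :: "('o, 'a, 'm) tcat_scheme \<Rightarrow> 'o set \<Rightarrow> 'o set \<Rightarrow> 'o set" where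
  "star C \<X> \<Y> = {W \<in> Obj C. \<exists>X \<in> \<X>. \<exists>Y \<in> \<Y>. \<exists>f g h. triangle_on C X W Y f g h}"

definition ext1_vanishes :: "('o, 'a, 'm) tcat_scheme \<Rightarrow> 'o set \<Rightarrow> 'o set \<Rightarrow> bool" where
  "ext1_vanishes C \<X> \<Y> \<longleftrightarrow> (\<forall>X \<in> \<X>. \<forall>Y \<in> \<Y>. homs C X (sho C Y) = {zerom C X (sho C Y)})"


section \<open>Concentric twin cotorsion pairs\<close>

definition cotorsion_pairs :: "('o, 'a, 'm) tcat_scheme \<Rightarrow> ('o set \<times> 'o set) set" where
  "cotorsion_pairs C = {(\<U>, \<V>).
     additive_subcat C \<U> \<and> closed_iso C \<U> \<and> closed_summands C \<U> \<and>
     additive_subcat C \<V> \<and> closed_iso C \<V> \<and> closed_summands C \<V> \<and>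
     Obj C = star C \<U> (shift_up C \<V>) \<and> ext1_vanishes C \<U> \<V>}"

definition twin_cotorsion_pair ::
    "('o, 'a, 'm) tcat_scheme \<Rightarrow> 'o set \<Rightarrow> 'o set \<Rightarrow> 'o set \<Rightarrow> 'o set \<Rightarrow> bool" where
  "twin_cotorsion_pair C \<S> \<T> \<U> \<V> \<longleftrightarrow>
     (\<S>, \<T>) \<in> cotorsion_pairs C \<and> (\<U>, \<V>) \<in> cotorsion_pairs C \<and> ext1_vanishes C \<S> \<V>"

definition concentric :: "'o set \<Rightarrow> 'o set \<Rightarrow> 'o set \<Rightarrow> 'o set \<Rightarrow> bool" where
  "concentric \<S> \<T> \<U> \<V> \<longleftrightarrow> \<S> \<inter> \<T> = \<U> \<inter> \<V>"

text \<open>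
  In what follows \<open>\<I>\<close> is \<open>\<S> \<inter> \<T>\<close> and \<open>\<Z>\<close> is \<open>\<T> \<inter> \<U>\<close>.

  \<open>coreflection\<close> chooses for \<open>X\<close> an object \<open>U\<close> and the morphism \<open>u\<close> of a triangle
  \<open>U \<rightarrow> X \<rightarrow> V[1] \<rightarrow> U[1]\<close>, and \<open>reflection\<close> an object \<open>T\<close> and the morphism \<open>t\<close> of a triangle
  \<open>S[-1] \<rightarrow> X \<rightarrow> T \<rightarrow> S\<close>; the latter is read as \<open>S' \<rightarrow> X \<rightarrow> T \<rightarrow> S'[1]\<close> with \<open>S'\<close> in
  \<open>\<S>[-1]\<close>. The action of the adjoint functors on morphisms is the one determined by naturality
  of the counit and of the unit.
\<close>

definition coreflection ::
    "('o, 'a, 'm) tcat_scheme \<Rightarrow> 'o set \<Rightarrow> 'o set \<Rightarrow> 'o \<Rightarrow> 'o \<times> 'a" where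
  "coreflection C \<U> \<V> X =
     (SOME (U, u). U \<in> \<U> \<and> (\<exists>W \<in> shift_up C \<V>. \<exists>g h. triangle_on C U X W u g h))"

definition reflection ::
    "('o, 'a, 'm) tcat_scheme \<Rightarrow> 'o set \<Rightarrow> 'o set \<Rightarrow> 'o \<Rightarrow> 'o \<times> 'a" where
  "reflection C \<S> \<T> X =
     (SOME (T, t). T \<in> \<T> \<and> (\<exists>W \<in> shift_down C \<S>. \<exists>f h. triangle_on C W X T f t h))"

definition counit ::
    "('o, 'a, 'm) tcat_scheme \<Rightarrow> 'o set \<Rightarrow> 'o set \<Rightarrow> 'o set \<Rightarrow> 'o \<Rightarrow> 'a set" where
  "counit C \<I> \<U> \<V> X = qcls C \<I> (snd (coreflection C \<U> \<V> X))"

definition unit ::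
    "('o, 'a, 'm) tcat_scheme \<Rightarrow> 'o set \<Rightarrow> 'o set \<Rightarrow> 'o set \<Rightarrow> 'o \<Rightarrow> 'a set" where
  "unit C \<I> \<S> \<T> X = qcls C \<I> (snd (reflection C \<S> \<T> X))"

definition omega ::
    "('o, 'a, 'm) tcat_scheme \<Rightarrow> 'o set \<Rightarrow> 'o set \<Rightarrow> 'o set \<Rightarrow> ('o, 'a set, 'o, 'a set) ftor" where
  "omega C \<I> \<U> \<V> = (let Q = quot C (Obj C) \<I>; om = (\<lambda>X. fst (coreflection C \<U> \<V> X)) in
     \<lparr>fob = om,
      far = (\<lambda>F. THE G. G \<in> homs (quot C \<U> \<I>) (om (dm Q F)) (om (cd Q F)) \<and>
        counit C \<I> \<U> \<V> (cd Q F) \<cdot>\<^bsub>Q\<^esub> G = F \<cdot>\<^bsub>Q\<^esub> counit C \<I> \<U> \<V> (dm Q F))\<rparr>)"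

definition sigma ::
    "('o, 'a, 'm) tcat_scheme \<Rightarrow> 'o set \<Rightarrow> 'o set \<Rightarrow> 'o set \<Rightarrow> ('o, 'a set, 'o, 'a set) ftor" where
  "sigma C \<I> \<S> \<T> = (let Q = quot C (Obj C) \<I>; si = (\<lambda>X. fst (reflection C \<S> \<T> X)) in
     \<lparr>fob = si,
      far = (\<lambda>F. THE G. G \<in> homs (quot C \<T> \<I>) (si (dm Q F)) (si (cd Q F)) \<and>
        G \<cdot>\<^bsub>Q\<^esub> unit C \<I> \<S> \<T> (dm Q F) = unit C \<I> \<S> \<T> (cd Q F) \<cdot>\<^bsub>Q\<^esub> F)\<rparr>)"

text \<open>
  \<open>omega\<close> and \<open>sigma\<close> are the adjoints on \<open>\<C>/\<I>\<close>. Their restrictions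
  \<open>\<T>/\<I> \<rightarrow> \<Z>/\<I>\<close> and \<open>\<U>/\<I> \<rightarrow> \<Z>/\<I>\<close>, and the unit and counit of these, are given by
  the same functions. The family \<open>mu\<close> is indexed by a type, hence the normalisation outside
  \<open>Obj C\<close> that makes it unique.
\<close>

definition mu ::
    "('o, 'a, 'm) tcat_scheme \<Rightarrow> 'o set \<Rightarrow> 'o set \<Rightarrow> 'o set \<Rightarrow> 'o set \<Rightarrow> 'o \<Rightarrow> 'a set" where
  "mu C \<S> \<T> \<U> \<V> = (let \<I> = \<S> \<inter> \<T>; Q = quot C (Obj C) \<I>;
       om = omega C \<I> \<U> \<V>; si = sigma C \<I> \<S> \<T> in
     THE \<mu>. \<mu> \<in> extensional (Obj C) \<and>
       nat_trans Q (quot C (\<T> \<inter> \<U>) \<I>) (ftor_comp si om) (ftor_comp om si) \<mu> \<and>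
       (\<forall>X \<in> Obj C.
          counit C \<I> \<U> \<V> (fob si X) \<cdot>\<^bsub>Q\<^esub> \<mu> X \<cdot>\<^bsub>Q\<^esub> unit C \<I> \<S> \<T> (fob om X) =
          unit C \<I> \<S> \<T> X \<cdot>\<^bsub>Q\<^esub> counit C \<I> \<U> \<V> X))"

definition condition_I ::
    "('o, 'a, 'm) tcat_scheme \<Rightarrow> 'o set \<Rightarrow> 'o set \<Rightarrow> 'o set \<Rightarrow> 'o set \<Rightarrow> bool" where
  "condition_I C \<S> \<T> \<U> \<V> \<longleftrightarrow>
     (\<forall>X \<in> star C \<T> \<U>. is_iso (quot C (\<T> \<inter> \<U>) (\<S> \<inter> \<T>)) (mu C \<S> \<T> \<U> \<V> X))"

definition condition_II ::
    "('o, 'a, 'm) tcat_scheme \<Rightarrow> 'o set \<Rightarrow> 'o set \<Rightarrow> 'o set \<Rightarrow> 'o set \<Rightarrow> bool" where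
  "condition_II C \<S> \<T> \<U> \<V> \<longleftrightarrow>
     \<U> \<inter> star C (shift_down C \<S>) \<V> = \<S> \<and> \<T> \<inter> star C \<S> (shift_up C \<V>) = \<V>"


section \<open>Mutable cotorsion pairs\<close>

text \<open>
  Only the values of \<open>\<langle>1\<rangle>\<close> and of \<open>\<Sigma>\<close> on objects enter the extension groups of \<open>\<Z>/\<I>\<close>,
  so these are defined on objects only.
\<close>

definition shift1 ::
    "('o, 'a, 'm) tcat_scheme \<Rightarrow> 'o set \<Rightarrow> 'o set \<Rightarrow> 'o \<Rightarrow> 'o" where
  "shift1 C \<I> \<U> Z = (SOME U. U \<in> \<U> \<and> (\<exists>I \<in> \<I>. \<exists>f g h. triangle_on C Z I U f g h))"

definition Sigma_obj ::
    "('o, 'a, 'm) tcat_scheme \<Rightarrow> 'o set \<Rightarrow> 'o set \<Rightarrow> 'o set \<Rightarrow> 'o \<Rightarrow> 'o" where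
  "Sigma_obj C \<S> \<T> \<U> Z = fob (sigma C (\<S> \<inter> \<T>) \<S> \<T>) (shift1 C (\<S> \<inter> \<T>) \<U> Z)"

definition ext1_quot ::
    "('o, 'a, 'm) tcat_scheme \<Rightarrow> 'o set \<Rightarrow> 'o set \<Rightarrow> 'o set \<Rightarrow> 'o \<Rightarrow> 'o \<Rightarrow> 'a set monoid" where
  "ext1_quot C \<S> \<T> \<U> X Y =
     homgrp (quot C (\<T> \<inter> \<U>) (\<S> \<inter> \<T>)) X (Sigma_obj C \<S> \<T> \<U> Y)"

definition mutable_cotorsion_pairs ::
    "('o, 'a, 'm) tcat_scheme \<Rightarrow> 'o set \<Rightarrow> 'o set \<Rightarrow> 'o set \<Rightarrow> 'o set
      \<Rightarrow> ('o set \<times> 'o set) set" where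
  "mutable_cotorsion_pairs C \<S> \<T> \<U> \<V> = {(\<A>, \<B>) \<in> cotorsion_pairs C.
     \<S> \<subseteq> \<A> \<and> \<A> \<subseteq> \<U> \<and> \<V> \<subseteq> \<B> \<and> \<B> \<subseteq> \<T> \<and>
     (\<forall>X \<in> fob (sigma C (\<S> \<inter> \<T>) \<S> \<T>) ` \<A>. \<forall>Y \<in> fob (omega C (\<S> \<inter> \<T>) \<U> \<V>) ` \<B>.
        carrier (ext1_quot C \<S> \<T> \<U> X Y) = {\<one>\<^bsub>ext1_quot C \<S> \<T> \<U> X Y\<^esub>})}"

end

theory Submission
  imports Defs
begin

text \<open>
  Write \<open>f \<equiv> 0\<close> for a morphism that factors through an object of \<open>\<I>\<close>. A triangle \<open>X \<rightarrow> T \<rightarrow> S \<rightarrow> X[1]\<close>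
  with \<open>T \<in> \<T>\<close>, \<open>S \<in> \<S>\<close> is called a reflection of \<open>X\<close> and computes \<open>\<sigma>\<close>; a triangle
  \<open>V \<rightarrow> U \<rightarrow> X \<rightarrow> V[1]\<close> with \<open>U \<in> \<U>\<close>, \<open>V \<in> \<V>\<close> is called a coreflection and computes \<open>\<omega>\<close>. Both are
  read without inverse shifts, and both are unique modulo \<open>\<I>\<close>.

  Let \<open>(\<A>, \<B>)\<close> be a cotorsion pair with \<open>\<S> \<subseteq> \<A> \<subseteq> \<U>\<close> and \<open>\<V> \<subseteq> \<B> \<subseteq> \<T>\<close>. The inclusions
  \<open>\<A> \<subseteq> \<U> \<inter> (\<S>[-1] * \<A>)\<close> and \<open>\<B> \<subseteq> \<T> \<inter> (\<B> * \<V>[1])\<close> come from the approximation triangles. What has to be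
  shown is that the reverse inclusions amount to the vanishing of all morphisms \<open>\<sigma>A \<rightarrow> \<Sigma>(\<omega>B)\<close> in \<open>\<Z>/\<I>\<close>.

  The two conditions are used together on an extension \<open>T \<rightarrow> E \<rightarrow> U \<rightarrow> T[1]\<close> with \<open>T \<in> \<T>\<close>, \<open>U \<in> \<U>\<close>. Condition (I)
  identifies \<open>\<sigma>\<omega>E\<close> with \<open>\<omega>\<sigma>E\<close> in \<open>\<Z>/\<I>\<close>, so if one vanishes, so does the other; condition (II) says that
  \<open>\<S>\<close> consists of the objects of \<open>\<U>\<close> killed by \<open>\<sigma>\<close>, and \<open>\<V>\<close> of the objects of \<open>\<T>\<close> killed by \<open>\<omega>\<close>.
  Hence, if a coreflection of \<open>E\<close> lies in \<open>\<I>\<close>, some reflection of \<open>E\<close> lies in \<open>\<V>\<close> (\<open>refl_in_V\<close>), and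
  if a reflection of \<open>E\<close> lies in \<open>\<I>\<close>, some coreflection lies in \<open>\<S>\<close> (\<open>corefl_in_S\<close>).

  From vanishing to the reverse inclusions (\<open>orth_if_quotient_vanishes\<close>): by orthogonality it is enough that
  \<open>Ext\<^sup>1(X, Y) = 0\<close> whenever \<open>X \<in> \<U>\<close>, \<open>Y \<in> \<T>\<close> and all morphisms \<open>\<sigma>X \<rightarrow> \<Sigma>(\<omega>Y)\<close> are \<open>\<equiv> 0\<close>. With \<open>U\<^sub>0 = (\<omega>Y)\<langle>1\<rangle>\<close>,
  \<open>refl_in_V\<close> produces a coreflection \<open>P\<close> of \<open>Y[1]\<close> together with a morphism \<open>U\<^sub>0 \<rightarrow> P\<close> whose cone lies
  in \<open>\<S>\<close> (\<open>shifted_coreflection\<close>), so that \<open>\<sigma>P = \<Sigma>(\<omega>Y)\<close> in \<open>\<Z>/\<I>\<close>. A morphism \<open>X \<rightarrow> Y[1]\<close> lifts to \<open>X \<rightarrow> P\<close>, and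
  \<open>X \<rightarrow> P \<rightarrow> \<sigma>P\<close> is \<open>\<equiv> 0\<close> because it factors through \<open>\<sigma>X\<close>. By \<open>corefl_in_S\<close> a morphism that dies in
  this way factors through \<open>\<S>\<close> (\<open>null_after_refl\<close>), and \<open>Ext\<^sup>1(\<S>, Y) = 0\<close>.

  From the inclusion for \<open>\<A>\<close> to vanishing (\<open>quotient_vanishes\<close>): let \<open>g: X \<rightarrow> \<sigma>U\<close> with \<open>X \<in> \<A> \<inter> \<T>\<close>,
  \<open>Y \<in> \<B>\<close> and \<open>U = Y\<langle>1\<rangle>\<close>. Up to an object of \<open>\<I>\<close> added to \<open>X\<close>, the pullback \<open>F\<close> of \<open>g\<close> and \<open>U \<rightarrow> \<sigma>U\<close> lies in
  \<open>\<T> * \<U>\<close> and has reflection \<open>X\<close>. By condition (I), \<open>\<sigma>\<omega>F\<close> is a retract of \<open>X\<close> in the quotient,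
  so it lies in \<open>\<A>\<close>, and then \<open>\<omega>F \<in> \<U> \<inter> (\<S>[-1] * \<A>) = \<A>\<close>. Therefore \<open>\<omega>F \<rightarrow> U \<rightarrow> Y[1]\<close> vanishes and \<open>\<omega>F \<rightarrow> U\<close>
  is \<open>\<equiv> 0\<close>. Since \<open>\<omega>F \<rightarrow> F \<rightarrow> X\<close> is, again by condition (I), a reflection modulo \<open>\<I>\<close>, this forces \<open>g \<equiv> 0\<close>.
\<close>

section \<open>Arithmetic of morphisms\<close>

context category
begin

lemma homs_arr: "f \<in> homs C X Y \<Longrightarrow> f \<in> Arr C \<and> dm C f = X \<and> cd C f = Y"
  by (simp add: homs_def)

lemma homs_obj: "f \<in> homs C X Y \<Longrightarrow> X \<in> Obj C \<and> Y \<in> Obj C"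
  using arr_ends by (auto simp: homs_def)

lemma cmp_arr [simp]:
  assumes "f \<in> Arr C" "g \<in> Arr C" "dm C g = cd C f"
  shows "g \<cdot> f \<in> Arr C" "dm C (g \<cdot> f) = dm C f" "cd C (g \<cdot> f) = cd C g"
  using cmp_hom[of f "dm C f" "cd C f" g "cd C g"] assms by (auto simp: homs_def)

lemma cmp_assoc_arr [simp]:
  assumes "f \<in> Arr C" "g \<in> Arr C" "h \<in> Arr C" "dm C g = cd C f" "dm C h = cd C g"
  shows "(h \<cdot> g) \<cdot> f = h \<cdot> (g \<cdot> f)"
  using cmp_assoc[of f "dm C f" "cd C f" g "cd C g" h "cd C h"] assms by (auto simp: homs_def)

lemma ident_arr [simp]:
  assumes "X \<in> Obj C"
  shows "ident C X \<in> Arr C" "dm C (ident C X) = X" "cd C (ident C X) = X"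
  using ident_hom[OF assms] by (auto simp: homs_def)

lemma ident_left_arr [simp]: "f \<in> Arr C \<Longrightarrow> cd C f = Y \<Longrightarrow> ident C Y \<cdot> f = f"
  using cmp_ident_left[of f "dm C f" Y] by (auto simp: homs_def)

lemma ident_right_arr [simp]: "f \<in> Arr C \<Longrightarrow> dm C f = X \<Longrightarrow> f \<cdot> ident C X = f"
  using cmp_ident_right[of f X "cd C f"] by (auto simp: homs_def)

lemma is_isoE:
  assumes "is_iso C f" "f \<in> homs C X Y"
  obtains g where "g \<in> homs C Y X" "g \<cdot> f = ident C X" "f \<cdot> g = ident C Y"
  using assms unfolding is_iso_def by (auto simp: homs_def)

lemma is_isoI:
  assumes "f \<in> homs C X Y" "g \<in> homs C Y X" "g \<cdot> f = ident C X" "f \<cdot> g = ident C Y"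
  shows "is_iso C f"
  using assms unfolding is_iso_def by (auto simp: homs_def)

lemma is_iso_ident: "X \<in> Obj C \<Longrightarrow> is_iso C (ident C X)"
  by (rule is_isoI[of _ X X "ident C X"]) (auto simp: homs_def)

lemma isomorphic_refl: "X \<in> Obj C \<Longrightarrow> isomorphic C X X"
  unfolding isomorphic_def using is_iso_ident ident_hom by blast

lemma isomorphic_sym:
  assumes "isomorphic C X Y" shows "isomorphic C Y X"
proof -
  obtain f where f: "f \<in> homs C X Y" "is_iso C f" using assms isomorphic_def by metis
  then obtain g where "g \<in> homs C Y X" "g \<cdot> f = ident C X" "f \<cdot> g = ident C Y"
    using is_isoE by metis
  then show ?thesis using f is_isoI[of g Y X f] by (auto simp: isomorphic_def)
qed

end

context preadditive
begin

abbreviation add_arr (infixl "\<oplus>" 65) where "f \<oplus> g \<equiv> addm C f g"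
abbreviation sub_arr (infixl "\<ominus>" 65) where "f \<ominus> g \<equiv> addm C f (neg C g)"

lemma add_hom: "f \<in> homs C X Y \<Longrightarrow> g \<in> homs C X Y \<Longrightarrow> f \<oplus> g \<in> homs C X Y"
  using comm_groupE(1)[OF hom_comm_group, of X Y f g] homs_obj[of f X Y] by (auto simp: homgrp_def)

lemma zero_hom: "X \<in> Obj C \<Longrightarrow> Y \<in> Obj C \<Longrightarrow> zerom C X Y \<in> homs C X Y"
  using comm_groupE(2)[OF hom_comm_group, of X Y] by (auto simp: homgrp_def)

lemma neg_hom: "f \<in> homs C X Y \<Longrightarrow> neg C f \<in> homs C X Y"
  using group.inv_closed[OF comm_group.axioms(2)[OF hom_comm_group], of X Y f]
    homs_obj[of f X Y] homs_arr[of f X Y] by (auto simp: homgrp_def neg_def)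

lemma add_arr_arr [simp]:
  assumes "f \<in> Arr C" "g \<in> Arr C" "dm C g = dm C f" "cd C g = cd C f"
  shows "f \<oplus> g \<in> Arr C" "dm C (f \<oplus> g) = dm C f" "cd C (f \<oplus> g) = cd C f"
  using add_hom[of f "dm C f" "cd C f" g] assms by (auto simp: homs_def)

lemma zero_arr [simp]:
  assumes "X \<in> Obj C" "Y \<in> Obj C"
  shows "zerom C X Y \<in> Arr C" "dm C (zerom C X Y) = X" "cd C (zerom C X Y) = Y"
  using zero_hom assms by (auto simp: homs_def)

lemma neg_arr [simp]:
  assumes "f \<in> Arr C"
  shows "neg C f \<in> Arr C" "dm C (neg C f) = dm C f" "cd C (neg C f) = cd C f"
  using neg_hom[of f "dm C f" "cd C f"] assms by (auto simp: homs_def)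

lemma add_assoc_arr [simp]:
  assumes "f \<in> Arr C" "g \<in> Arr C" "h \<in> Arr C" "dm C g = dm C f" "cd C g = cd C f"
    "dm C h = dm C f" "cd C h = cd C f"
  shows "(f \<oplus> g) \<oplus> h = f \<oplus> (g \<oplus> h)"
  using comm_groupE(3)[OF hom_comm_group, of "dm C f" "cd C f" f g h] assms arr_ends
  by (auto simp: homgrp_def homs_def)

lemma add_comm_arr:
  assumes "f \<in> Arr C" "g \<in> Arr C" "dm C g = dm C f" "cd C g = cd C f"
  shows "f \<oplus> g = g \<oplus> f"
  using comm_groupE(4)[OF hom_comm_group, of "dm C f" "cd C f" f g] assms arr_ends
  by (auto simp: homgrp_def homs_def)

lemma add_lcomm_arr:
  assumes "f \<in> Arr C" "g \<in> Arr C" "h \<in> Arr C" "dm C g = dm C f" "cd C g = cd C f"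
    "dm C h = dm C f" "cd C h = cd C f"
  shows "f \<oplus> (g \<oplus> h) = g \<oplus> (f \<oplus> h)"
proof -
  have "f \<oplus> (g \<oplus> h) = (f \<oplus> g) \<oplus> h" using assms by simp
  also have "\<dots> = (g \<oplus> f) \<oplus> h" using assms add_comm_arr[of f g] by simp
  also have "\<dots> = g \<oplus> (f \<oplus> h)" using assms by simp
  finally show ?thesis .
qed

lemma zero_add_arr [simp]:
  "f \<in> Arr C \<Longrightarrow> dm C f = X \<Longrightarrow> cd C f = Y \<Longrightarrow> zerom C X Y \<oplus> f = f"
  using comm_groupE(5)[OF hom_comm_group, of X Y f] arr_ends[of f]
  by (auto simp: homgrp_def homs_def)

lemma add_zero_arr [simp]:
  "f \<in> Arr C \<Longrightarrow> dm C f = X \<Longrightarrow> cd C f = Y \<Longrightarrow> f \<oplus> zerom C X Y = f"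
  using add_comm_arr[of f "zerom C X Y"] zero_add_arr[of f X Y] arr_ends[of f] by auto

lemma add_neg_arr [simp]:
  assumes "f \<in> Arr C" shows "f \<ominus> f = zerom C (dm C f) (cd C f)"
proof -
  interpret G: comm_group "homgrp C (dm C f) (cd C f)"
    using hom_comm_group arr_ends assms by blast
  show ?thesis using G.r_inv[of f] assms by (auto simp: homgrp_def homs_def neg_def)
qed

lemma neg_add_arr [simp]:
  assumes "f \<in> Arr C" shows "neg C f \<oplus> f = zerom C (dm C f) (cd C f)"
  using add_neg_arr[OF assms] add_comm_arr[of f "neg C f"] assms by simp

lemma neg_unique:
  assumes "f \<in> homs C X Y" "g \<in> homs C X Y" "f \<oplus> g = zerom C X Y"
  shows "neg C f = g"
proof -
  have "neg C f = neg C f \<oplus> (f \<oplus> g)" using assms homs_obj by (simp add: homs_def)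
  also have "\<dots> = (neg C f \<oplus> f) \<oplus> g" using assms(1,2) by (simp add: homs_def del: neg_add_arr)
  also have "\<dots> = g" using assms by (simp add: homs_def del: add_assoc_arr)
  finally show ?thesis .
qed

lemma neg_neg_arr [simp]: "f \<in> Arr C \<Longrightarrow> neg C (neg C f) = f"
  by (rule neg_unique[of _ "dm C f" "cd C f"]) (auto simp: homs_def)

lemma neg_cancel [simp]:
  assumes "f \<in> Arr C" "g \<in> Arr C" "dm C g = dm C f" "cd C g = cd C f"
  shows "f \<oplus> (neg C f \<oplus> g) = g" "neg C f \<oplus> (f \<oplus> g) = g"
proof -
  have "f \<oplus> (neg C f \<oplus> g) = (f \<ominus> f) \<oplus> g" using assms by (simp del: add_neg_arr)
  then show "f \<oplus> (neg C f \<oplus> g) = g" using assms by (simp del: add_assoc_arr)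
  have "neg C f \<oplus> (f \<oplus> g) = (neg C f \<oplus> f) \<oplus> g" using assms by (simp del: neg_add_arr)
  then show "neg C f \<oplus> (f \<oplus> g) = g" using assms by (simp del: add_assoc_arr)
qed

lemma cmp_add_right_arr [simp]:
  assumes "f \<in> Arr C" "f' \<in> Arr C" "dm C f' = dm C f" "cd C f' = cd C f" "g \<in> Arr C" "dm C g = cd C f"
  shows "g \<cdot> (f \<oplus> f') = g \<cdot> f \<oplus> g \<cdot> f'"
  using cmp_add_right[of f "dm C f" "cd C f" f' g "cd C g"] assms by (auto simp: homs_def)

lemma cmp_add_left_arr [simp]:
  assumes "g \<in> Arr C" "g' \<in> Arr C" "dm C g' = dm C g" "cd C g' = cd C g" "f \<in> Arr C" "dm C g = cd C f"
  shows "(g \<oplus> g') \<cdot> f = g \<cdot> f \<oplus> g' \<cdot> f"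
  using cmp_add_left[of f "dm C f" "cd C f" g "cd C g" g'] assms by (auto simp: homs_def)

lemma add_self_zero:
  assumes "f \<in> homs C X Y" "f \<oplus> f = f" shows "f = zerom C X Y"
proof -
  have "f = neg C f \<oplus> (f \<oplus> f)" using assms(1) by (simp add: homs_def)
  also have "\<dots> = zerom C X Y" unfolding assms(2) using assms(1) by (simp add: homs_def)
  finally show ?thesis .
qed

lemma cmp_zero_arr [simp]:
  assumes "g \<in> Arr C" "dm C g = Y" "X \<in> Obj C"
  shows "g \<cdot> zerom C X Y = zerom C X (cd C g)"
proof (rule add_self_zero)
  have Y: "Y \<in> Obj C" using assms arr_ends by auto
  show "g \<cdot> zerom C X Y \<in> homs C X (cd C g)" using assms Y by (simp add: homs_def)
  show "g \<cdot> zerom C X Y \<oplus> g \<cdot> zerom C X Y = g \<cdot> zerom C X Y"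
    using cmp_add_right_arr[of "zerom C X Y" "zerom C X Y" g] assms Y by simp
qed

lemma zero_cmp_arr [simp]:
  assumes "f \<in> Arr C" "cd C f = Y" "Z \<in> Obj C"
  shows "zerom C Y Z \<cdot> f = zerom C (dm C f) Z"
proof (rule add_self_zero)
  have Y: "Y \<in> Obj C" using assms arr_ends by auto
  show "zerom C Y Z \<cdot> f \<in> homs C (dm C f) Z" using assms Y by (simp add: homs_def)
  show "zerom C Y Z \<cdot> f \<oplus> zerom C Y Z \<cdot> f = zerom C Y Z \<cdot> f"
    using cmp_add_left_arr[of "zerom C Y Z" "zerom C Y Z" f] assms Y by simp
qed

lemma cmp_neg_arr [simp]:
  assumes "f \<in> Arr C" "g \<in> Arr C" "dm C g = cd C f"
  shows "g \<cdot> neg C f = neg C (g \<cdot> f)"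
proof (rule sym, rule neg_unique)
  show "g \<cdot> f \<in> homs C (dm C f) (cd C g)" "g \<cdot> neg C f \<in> homs C (dm C f) (cd C g)"
    using assms by (auto simp: homs_def)
  show "g \<cdot> f \<oplus> g \<cdot> neg C f = zerom C (dm C f) (cd C g)"
    using cmp_add_right_arr[of f "neg C f" g] assms arr_ends by simp
qed

lemma neg_cmp_arr [simp]:
  assumes "f \<in> Arr C" "g \<in> Arr C" "dm C g = cd C f"
  shows "neg C g \<cdot> f = neg C (g \<cdot> f)"
proof (rule sym, rule neg_unique)
  show "g \<cdot> f \<in> homs C (dm C f) (cd C g)" "neg C g \<cdot> f \<in> homs C (dm C f) (cd C g)"
    using assms by (auto simp: homs_def)
  show "g \<cdot> f \<oplus> neg C g \<cdot> f = zerom C (dm C f) (cd C g)"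
    using cmp_add_left_arr[of g "neg C g" f] assms arr_ends by simp
qed

lemma neg_zero_arr [simp]: "X \<in> Obj C \<Longrightarrow> Y \<in> Obj C \<Longrightarrow> neg C (zerom C X Y) = zerom C X Y"
  by (rule neg_unique[of _ X Y]) (auto simp: homs_def)

lemma neg_add_distrib [simp]:
  assumes "f \<in> Arr C" "g \<in> Arr C" "dm C g = dm C f" "cd C g = cd C f"
  shows "neg C (f \<oplus> g) = neg C f \<oplus> neg C g"
proof (rule neg_unique[of _ "dm C f" "cd C f"])
  have "f \<oplus> g \<oplus> (neg C f \<oplus> neg C g) = f \<oplus> (neg C f \<oplus> (g \<ominus> g))"
    using assms by (simp add: add_lcomm_arr[of g "neg C f" "neg C g"] del: add_neg_arr neg_cancel)
  then show "f \<oplus> g \<oplus> (neg C f \<oplus> neg C g) = zerom C (dm C f) (cd C f)"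
    using assms arr_ends by simp
qed (use assms in \<open>auto simp: homs_def\<close>)

lemma neg_zeroD:
  assumes "f \<in> homs C X Y" "neg C f = zerom C X Y" shows "f = zerom C X Y"
  using neg_neg_arr[of f] assms homs_obj[of f X Y] homs_arr[of f X Y] neg_zero_arr by metis

lemma zero_obj_from: assumes "zero_obj C N" "f \<in> homs C N X" shows "f = zerom C N X"
proof -
  have "f = f \<cdot> ident C N" using assms by (simp add: homs_def)
  also have "\<dots> = zerom C N X" using assms homs_obj[of f N X] by (simp add: zero_obj_def homs_def)
  finally show ?thesis .
qed

lemma zero_obj_to: assumes "zero_obj C N" "f \<in> homs C X N" shows "f = zerom C X N"
proof -
  have "f = ident C N \<cdot> f" using assms by (simp add: homs_def)
  also have "\<dots> = zerom C X N" using assms homs_obj[of f X N] by (simp add: zero_obj_def homs_def)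
  finally show ?thesis .
qed

end

section \<open>Exactness of triangles\<close>

context triangulated
begin

lemma sha_hom: "f \<in> homs C X Y \<Longrightarrow> sha C f \<in> homs C (sho C X) (sho C Y)"
  using sha_bij[of X Y] homs_obj[of f X Y] by (auto simp: bij_betw_def)

lemma sha_arr [simp]:
  assumes "f \<in> Arr C"
  shows "sha C f \<in> Arr C" "dm C (sha C f) = sho C (dm C f)" "cd C (sha C f) = sho C (cd C f)"
  using sha_hom[of f "dm C f" "cd C f"] assms by (auto simp: homs_def)

declare sho_obj [simp] sha_ident [simp]

lemma sha_cmp_arr [simp]:
  "f \<in> Arr C \<Longrightarrow> g \<in> Arr C \<Longrightarrow> dm C g = cd C f \<Longrightarrow> sha C (g \<cdot> f) = sha C g \<cdot> sha C f"
  using sha_cmp[of f "dm C f" "cd C f" g "cd C g"] by (auto simp: homs_def)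

lemma sha_add_arr [simp]:
  "\<lbrakk>f \<in> Arr C; g \<in> Arr C; dm C g = dm C f; cd C g = cd C f\<rbrakk> \<Longrightarrow> sha C (f \<oplus> g) = sha C f \<oplus> sha C g"
  using sha_add[of f "dm C f" "cd C f" g] by (auto simp: homs_def)

lemma sha_zero [simp]:
  assumes "X \<in> Obj C" "Y \<in> Obj C"
  shows "sha C (zerom C X Y) = zerom C (sho C X) (sho C Y)"
proof (rule add_self_zero)
  show "sha C (zerom C X Y) \<in> homs C (sho C X) (sho C Y)" using assms by (simp add: homs_def)
  show "sha C (zerom C X Y) \<oplus> sha C (zerom C X Y) = sha C (zerom C X Y)"
    using sha_add_arr[of "zerom C X Y" "zerom C X Y"] assms by simp
qed

lemma sha_neg [simp]:
  assumes "f \<in> Arr C" shows "sha C (neg C f) = neg C (sha C f)"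
proof (rule sym, rule neg_unique[of _ "sho C (dm C f)" "sho C (cd C f)"])
  show "sha C f \<oplus> sha C (neg C f) = zerom C (sho C (dm C f)) (sho C (cd C f))"
    using sha_add_arr[of f "neg C f"] assms arr_ends by simp
qed (use assms in \<open>auto simp: homs_def\<close>)

lemma sha_inj: "f \<in> homs C X Y \<Longrightarrow> g \<in> homs C X Y \<Longrightarrow> sha C f = sha C g \<Longrightarrow> f = g"
  using sha_bij[of X Y] homs_obj[of f X Y] by (auto simp: bij_betw_def inj_on_def)

lemma sha_surj:
  assumes "f \<in> homs C (sho C X) (sho C Y)" "X \<in> Obj C" "Y \<in> Obj C"
  obtains g where "g \<in> homs C X Y" "f = sha C g"
  using sha_bij[of X Y] assms by (auto simp: bij_betw_def)

lemma zero_obj_sho: "zero_obj C N \<Longrightarrow> zero_obj C (sho C N)"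
  unfolding zero_obj_def by (metis sha_ident sha_zero sho_obj)

lemma triangleE:
  assumes "triangle_on C X Y Z f g h"
  shows "f \<in> homs C X Y" "g \<in> homs C Y Z" "h \<in> homs C Z (sho C X)" "(f, g, h) \<in> dist C"
    "X \<in> Obj C" "Y \<in> Obj C" "Z \<in> Obj C"
  using assms homs_obj unfolding triangle_on_def by auto

lemma triangle_rotate:
  assumes "triangle_on C X Y Z f g h"
  shows "triangle_on C Y Z (sho C X) g h (neg C (sha C f))"
proof -
  note t = triangleE[OF assms]
  have "neg C (sha C f) \<in> homs C (sho C X) (sho C Y)" using t(1) sha_hom neg_hom by blast
  then show ?thesis using t dist_rotate[of f X Y g Z h] by (auto simp: triangle_on_def)
qed

lemma triangle_unrotate:
  assumes "triangle_on C Y Z (sho C X) g h k" "X \<in> Obj C"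
  obtains f where "triangle_on C X Y Z f g h" "k = neg C (sha C f)"
proof -
  note t = triangleE[OF assms(1)]
  have "neg C k \<in> homs C (sho C X) (sho C Y)" using t(3) neg_hom by blast
  then obtain f where f: "f \<in> homs C X Y" "neg C k = sha C f" using sha_surj t assms(2) by metis
  have k: "k = neg C (sha C f)" using f(2) t(3) neg_neg_arr[of k] by (auto simp: homs_def)
  then have "triangle_on C X Y Z f g h" using t f dist_rotate[of f X Y g Z h]
    by (auto simp: triangle_on_def)
  then show ?thesis using k that by blast
qed

lemma triangle_rotate2:
  assumes "triangle_on C X Y Z f g h"
  shows "triangle_on C Z (sho C X) (sho C Y) h (neg C (sha C f)) (neg C (sha C g))"
  using triangle_rotate triangle_rotate assms by blast

lemma triangle_unrotate2:
  assumes "triangle_on C Z (sho C X) (sho C Y) h k l" "X \<in> Obj C" "Y \<in> Obj C"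
  obtains f g where "triangle_on C X Y Z f g h" "k = neg C (sha C f)" "l = neg C (sha C g)"
proof -
  obtain g where g: "triangle_on C Y Z (sho C X) g h k" "l = neg C (sha C g)"
    using triangle_unrotate[OF assms(1,3)] .
  then obtain f where "triangle_on C X Y Z f g h" "k = neg C (sha C f)"
    using triangle_unrotate[OF g(1) assms(2)] by blast
  then show ?thesis using g that by blast
qed

lemma ident_triangle:
  assumes "X \<in> Obj C" "zero_obj C N"
  shows "triangle_on C X X N (ident C X) (zerom C X N) (zerom C N (sho C X))"
proof -
  have "N \<in> Obj C" using assms(2) zero_obj_def by metis
  then show ?thesis using dist_ident[OF assms] assms(1) ident_hom zero_hom
    by (auto simp: triangle_on_def)
qed

text \<open>
  The next lemmas are the exactness of \<open>Hom(-, W)\<close> and \<open>Hom(W, -)\<close> on a triangle. The position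
  exact at \<open>X[1]\<close> or \<open>X\<close> is formulated with \<open>sha\<close>, so that no inverse shift occurs. The proof of this one compares the triangle with
  \<open>0 \<rightarrow> W \<rightarrow> W \<rightarrow> 0[1]\<close>.
\<close>

lemma factor_out:
  assumes "triangle_on C X Y Z f g h" "w \<in> homs C Y W" "w \<cdot> f = zerom C X W"
  obtains v where "v \<in> homs C Z W" "v \<cdot> g = w"
proof -
  note t = triangleE[OF assms(1)]
  obtain N where N: "zero_obj C N" using ex_zero_obj by blast
  have NO: "N \<in> Obj C" using N zero_obj_def by metis
  have W: "W \<in> Obj C" using assms(2) homs_obj by blast
  have "triangle_on C N W W (zerom C N W) (ident C W) (zerom C W (sho C N))"
  proof -
    have "triangle_on C W W (sho C N) (ident C W) (zerom C W (sho C N)) (zerom C (sho C N) (sho C W))"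
      using ident_triangle[OF W zero_obj_sho[OF N]] .
    then obtain k where k: "triangle_on C N W W k (ident C W) (zerom C W (sho C N))"
      using triangle_unrotate NO by metis
    then show ?thesis using zero_obj_from[OF N] triangleE(1)[OF k] by metis
  qed
  moreover have "w \<cdot> f = zerom C N W \<cdot> zerom C X N" using assms(3) NO t W by simp
  ultimately obtain v where "v \<in> homs C Z W" "v \<cdot> g = ident C W \<cdot> w"
    using dist_morphism[OF assms(1), of N W W "zerom C N W" "ident C W" "zerom C W (sho C N)" "zerom C X N" w]
      zero_hom[OF t(5) NO] assms(2) by blast
  then show ?thesis using that assms(2) by (auto simp: homs_def)
qed

lemma factor_in:
  assumes "triangle_on C X Y Z f g h" "w \<in> homs C W Y" "g \<cdot> w = zerom C W Z"
  obtains v where "v \<in> homs C W X" "f \<cdot> v = w"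
proof -
  note t = triangleE[OF assms(1)]
  obtain N where N: "zero_obj C N" using ex_zero_obj by blast
  have NO: "N \<in> Obj C" using N zero_obj_def by metis
  have W: "W \<in> Obj C" using assms(2) homs_obj by blast
  have tr: "triangle_on C W N (sho C W) (zerom C W N) (zerom C N (sho C W)) (neg C (sha C (ident C W)))"
    using triangle_rotate[OF ident_triangle[OF W N]] .
  have "zerom C N Z \<cdot> zerom C W N = g \<cdot> w" using assms(3) NO t W by simp
  then obtain z where z: "z \<in> homs C (sho C W) (sho C X)"
      "sha C w \<cdot> neg C (sha C (ident C W)) = neg C (sha C f) \<cdot> z"
    using dist_morphism[OF tr triangle_rotate[OF assms(1)] assms(2), of "zerom C N Z"]
      zero_hom[OF NO t(7)] by blast
  obtain v where v: "v \<in> homs C W X" "z = sha C v" using sha_surj z(1) W t(5) by metis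
  have "neg C (sha C w) = neg C (sha C (f \<cdot> v))"
    using z(2) v t W assms(2) by (simp add: homs_def)
  then have "sha C w = sha C (f \<cdot> v)" using assms(2) v t neg_neg_arr
    by (metis cmp_hom homs_arr sha_arr(1))
  then have "f \<cdot> v = w" using sha_inj[of w W Y "f \<cdot> v"] assms(2) v t cmp_hom by metis
  then show ?thesis using that v by blast
qed

lemma triangle_zero1:
  assumes "triangle_on C X Y Z f g h" shows "g \<cdot> f = zerom C X Z"
proof -
  note t = triangleE[OF assms]
  obtain N where N: "zero_obj C N" using ex_zero_obj by blast
  have NO: "N \<in> Obj C" using N zero_obj_def by metis
  have "f \<cdot> ident C X = f \<cdot> ident C X" ..
  then obtain z where "z \<in> homs C N Z" "z \<cdot> zerom C X N = g \<cdot> f"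
    using dist_morphism[OF ident_triangle[OF t(5) N] assms ident_hom[OF t(5)] t(1)] by blast
  then show ?thesis using NO t by (simp add: homs_def)
qed

lemma triangle_zero3:
  assumes "triangle_on C X Y Z f g h" shows "sha C f \<cdot> h = zerom C Z (sho C Y)"
proof -
  note t = triangleE[OF assms]
  have "neg C (sha C f \<cdot> h) = zerom C Z (sho C Y)"
    using triangle_zero1[OF triangle_rotate2[OF assms]] t by (simp add: homs_def)
  moreover have "sha C f \<cdot> h \<in> homs C Z (sho C Y)" using t by (simp add: homs_def)
  ultimately show ?thesis using neg_zeroD by blast
qed

lemma factor_in2:
  assumes "triangle_on C X Y Z f g h" "w \<in> homs C W Z" "h \<cdot> w = zerom C W (sho C X)"
  obtains v where "v \<in> homs C W Y" "g \<cdot> v = w"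
  using factor_in[OF triangle_rotate[OF assms(1)] assms(2,3)] .

lemma factor_in3:
  assumes "triangle_on C X Y Z f g h" "w \<in> homs C W (sho C X)" "sha C f \<cdot> w = zerom C W (sho C Y)"
  obtains v where "v \<in> homs C W Z" "h \<cdot> v = w"
proof -
  have "neg C (sha C f) \<cdot> w = zerom C W (sho C Y)"
    using triangleE[OF assms(1)] assms(2,3) homs_obj[OF assms(2)] by (simp add: homs_def)
  then show ?thesis using factor_in[OF triangle_rotate2[OF assms(1)] assms(2)] that by blast
qed

lemma factor_out0:
  assumes "triangle_on C X Y Z f g h" "w \<in> homs C X W" "sha C w \<cdot> h = zerom C Z (sho C W)"
  obtains v where "v \<in> homs C Y W" "v \<cdot> f = w"
proof -
  note t = triangleE[OF assms(1)]
  have W: "W \<in> Obj C" using assms(2) homs_obj by blast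
  obtain k where k: "k \<in> homs C (sho C Y) (sho C W)" "k \<cdot> neg C (sha C f) = sha C w"
    using factor_out[OF triangle_rotate2[OF assms(1)] sha_hom[OF assms(2)] assms(3)] .
  obtain v where v: "v \<in> homs C Y W" "k = sha C v" using sha_surj k(1) t W by metis
  have "sha C (neg C v \<cdot> f) = sha C w" using k v t by (simp add: homs_def)
  then have "neg C v \<cdot> f = w" using sha_inj[of "neg C v \<cdot> f" X W w] assms(2) v t cmp_hom neg_hom by metis
  then show ?thesis using that v neg_hom by blast
qed

lemma triangle_iso3:
  assumes "triangle_on C X Y Z f g h" "isomorphic C Z Z'"
  obtains g' h' where "triangle_on C X Y Z' f g' h'"
proof -
  note t = triangleE[OF assms(1)]
  obtain z where z: "z \<in> homs C Z Z'" "is_iso C z" using assms(2) isomorphic_def by metis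
  then obtain z' where z': "z' \<in> homs C Z' Z" "z' \<cdot> z = ident C Z" "z \<cdot> z' = ident C Z'"
    using is_isoE by metis
  have e: "h \<cdot> (z' \<cdot> z) = h" unfolding z'(2) using t by (simp add: homs_def)
  have "(f, z \<cdot> g, h \<cdot> z') \<in> dist C"
    by (rule dist_iso[OF assms(1) ident_hom[OF t(5)] ident_hom[OF t(6)] z(1)
          is_iso_ident[OF t(5)] is_iso_ident[OF t(6)] z(2)])
      (use t z z' e in \<open>auto simp: homs_def\<close>)
  then have "triangle_on C X Y Z' f (z \<cdot> g) (h \<cdot> z')"
    using t z z' by (auto simp: triangle_on_def homs_def)
  then show ?thesis using that by blast
qed

lemma ex_cone:
  assumes "f \<in> homs C X Y" obtains Z g h where "triangle_on C X Y Z f g h"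
proof -
  obtain g h where "(f, g, h) \<in> dist C" using dist_extend assms homs_arr by blast
  then obtain X' Y' Z where "triangle_on C X' Y' Z f g h" using dist_triangle by blast
  then have "triangle_on C X Y Z f g h" using assms by (auto simp: triangle_on_def homs_def)
  then show ?thesis using that by blast
qed

lemma ex_fibre:
  assumes "f \<in> homs C Y Z" obtains X g h where "triangle_on C X Y Z g f h"
proof -
  obtain K g h where t: "triangle_on C Y Z K f g h" using ex_cone[OF assms] .
  obtain X where X: "X \<in> Obj C" "isomorphic C (sho C X) K"
    using sho_ess_surj triangleE(7)[OF t] by blast
  obtain g' h' where t': "triangle_on C Y Z (sho C X) f g' h'"
    using triangle_iso3[OF t isomorphic_sym[OF X(2)]] .
  show ?thesis by (rule triangle_unrotate[OF t' X(1)]) (rule that)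
qed

lemma ex_extension:
  assumes "d \<in> homs C U (sho C D)" "D \<in> Obj C" obtains F a b where "triangle_on C D F U a b d"
proof -
  obtain F g h where t: "triangle_on C F U (sho C D) g d h" using ex_fibre[OF assms(1)] .
  show ?thesis by (rule triangle_unrotate[OF t assms(2)]) (rule that)
qed

text \<open>
  The extension \<open>D \<rightarrow> F \<rightarrow> U\<close> is the base change of \<open>D \<rightarrow> M \<rightarrow> Z\<close> along \<open>z\<close>. The square formed by \<open>F\<close>, \<open>M\<close>,
  \<open>U\<close> and \<open>Z\<close> is homotopy cartesian up to sign, so \<open>F \<rightarrow> M\<close> and \<open>z\<close> have the same cone: this is the
  octahedral axiom for the composite \<open>l \<cdot> z\<close>, with all three triangles rotated so that the shift only occurs
  positively. The objects of \<open>\<T> * \<U>\<close> constructed below are all analysed with it.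
\<close>

lemma base_change:
  assumes M: "triangle_on C D M Z m q l" and z: "triangle_on C U Z S z s r"
    and F: "triangle_on C D F U a k (l \<cdot> z)"
  obtains t u where "triangle_on C F M S t (s \<cdot> q) u" "q \<cdot> t = neg C (z \<cdot> k)"
proof -
  note tM = triangleE[OF M] and tz = triangleE[OF z] and tF = triangleE[OF F]
  obtain u v where uv: "u \<in> homs C S (sho C F)" "v \<in> homs C (sho C F) (sho C M)"
      "(u, v, sha C s \<cdot> neg C (sha C q)) \<in> dist C" "neg C (sha C q) \<cdot> v = sha C z \<cdot> neg C (sha C k)"
    using octahedron[OF z triangle_rotate2[OF M] triangle_rotate2[OF F]] by blast
  have "neg C v \<in> homs C (sho C F) (sho C M)" using uv neg_hom by blast
  then obtain t where t: "t \<in> homs C F M" "neg C v = sha C t" using sha_surj tF tM by metis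
  have v: "v = neg C (sha C t)" using t(2) uv(2) neg_neg_arr[of v] by (auto simp: homs_def)
  have "sha C s \<cdot> neg C (sha C q) = neg C (sha C (s \<cdot> q))" using tM tz by (simp add: homs_def)
  then have "triangle_on C S (sho C F) (sho C M) u (neg C (sha C t)) (neg C (sha C (s \<cdot> q)))"
    using uv v tM tz t by (auto simp: triangle_on_def homs_def)
  then obtain f g where fg: "triangle_on C F M S f g u" "neg C (sha C t) = neg C (sha C f)"
      "neg C (sha C (s \<cdot> q)) = neg C (sha C g)"
    using triangle_unrotate2 tF(6) tM(6) by metis
  note tf = triangleE[OF fg(1)]
  have "sha C t = sha C f" using fg(2) t tf neg_neg_arr by (metis homs_arr sha_arr(1))
  then have f: "f = t" using sha_inj t tf by metis
  have sq: "s \<cdot> q \<in> homs C M S" using tz tM by (simp add: homs_def)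
  have "sha C (s \<cdot> q) = sha C g" using fg(3) sq tf neg_neg_arr by (metis homs_arr sha_arr(1))
  then have g: "g = s \<cdot> q" using sha_inj sq tf by metis
  have "sha C (q \<cdot> t) = sha C (neg C (z \<cdot> k))"
    using uv(4) v t tM tz tF by (simp add: homs_def)
  then have "q \<cdot> t = neg C (z \<cdot> k)"
    using sha_inj[of "q \<cdot> t" F Z "neg C (z \<cdot> k)"] t tM tz tF cmp_hom neg_hom by metis
  then show ?thesis using that fg f g by blast
qed

end

section \<open>Cotorsion pairs\<close>

context triangulated
begin

definition orth :: "'a \<Rightarrow> 'a \<Rightarrow> bool" where
  "orth X Y \<longleftrightarrow> homs C X (sho C Y) = {zerom C X (sho C Y)}"

lemma orthD: "orth X Y \<Longrightarrow> f \<in> homs C X (sho C Y) \<Longrightarrow> f = zerom C X (sho C Y)"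
  by (auto simp: orth_def)

lemma orthI:
  assumes "X \<in> Obj C" "Y \<in> Obj C" "\<And>f. f \<in> homs C X (sho C Y) \<Longrightarrow> f = zerom C X (sho C Y)"
  shows "orth X Y"
  using assms(3) zero_hom[OF assms(1) sho_obj[OF assms(2)]] unfolding orth_def by blast

lemma ext1_orth: "ext1_vanishes C \<X> \<Y> \<longleftrightarrow> (\<forall>X \<in> \<X>. \<forall>Y \<in> \<Y>. orth X Y)"
  by (simp add: ext1_vanishes_def orth_def)

lemma orth_ext_left:
  assumes "triangle_on C X Y Z u v h" "orth X W" "orth Z W" "W \<in> Obj C" shows "orth Y W"
proof (rule orthI)
  note t = triangleE[OF assms(1)]
  show "Y \<in> Obj C" "W \<in> Obj C" using t assms by auto
  fix f assume f: "f \<in> homs C Y (sho C W)"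
  have "f \<cdot> u = zerom C X (sho C W)" using orthD[OF assms(2)] f t cmp_hom by metis
  then obtain g where g: "g \<in> homs C Z (sho C W)" "g \<cdot> v = f" using factor_out[OF assms(1) f] by metis
  then have "g = zerom C Z (sho C W)" using orthD[OF assms(3)] by blast
  then show "f = zerom C Y (sho C W)" using g t assms by (auto simp: homs_def)
qed

lemma orth_ext_right:
  assumes "triangle_on C X Y Z u v h" "orth W X" "orth W Z" "W \<in> Obj C" shows "orth W Y"
proof (rule orthI)
  note t = triangleE[OF assms(1)]
  show "Y \<in> Obj C" "W \<in> Obj C" using t assms by auto
  fix f assume f: "f \<in> homs C W (sho C Y)"
  have "sha C v \<cdot> f \<in> homs C W (sho C Z)" using f t by (simp add: homs_def)
  then have "sha C v \<cdot> f = zerom C W (sho C Z)" using orthD[OF assms(3)] by blast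
  then have "neg C (sha C v) \<cdot> f = zerom C W (sho C Z)" using f t assms by (simp add: homs_def)
  then obtain g where g: "g \<in> homs C W (sho C X)" "neg C (sha C u) \<cdot> g = f"
    using factor_in[OF triangle_rotate[OF triangle_rotate2[OF assms(1)]] f] by metis
  then have "g = zerom C W (sho C X)" using orthD[OF assms(2)] by blast
  then show "f = zerom C W (sho C Y)" using g t assms by (auto simp: homs_def)
qed

text \<open>
  A retract splits off in a triangulated category: the cone of the section is a complement.
\<close>

lemma retract_mem:
  assumes "closed_summands C \<X>" "X \<in> \<X>" and s: "s \<in> homs C Y X" and r: "r \<in> homs C X Y"
    and rs: "r \<cdot> s = ident C Y"
  shows "Y \<in> \<X>"
proof -
  obtain K q h where t0: "triangle_on C Y X K s q h" using ex_cone[OF s] .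
  note t = triangleE[OF t0]
  have "sha C r \<cdot> (sha C s \<cdot> h) = h"
  proof -
    have "sha C r \<cdot> (sha C s \<cdot> h) = sha C (r \<cdot> s) \<cdot> h" using r t by (simp add: homs_def)
    then show ?thesis using rs t by (simp add: homs_def)
  qed
  then have h0: "h = zerom C K (sho C Y)" using triangle_zero3[OF t0] r t by (simp add: homs_def)
  have "h \<cdot> ident C K = zerom C K (sho C Y)" using h0 t by (simp add: homs_def)
  then obtain j where j: "j \<in> homs C K X" "q \<cdot> j = ident C K"
    using factor_in2[OF t0 ident_hom[OF t(7)]] by blast
  define j' where "j' = j \<ominus> s \<cdot> (r \<cdot> j)"
  have j': "j' \<in> homs C K X" using j r s unfolding j'_def by (simp add: homs_def)
  have qs: "q \<cdot> s = zerom C Y K" using triangle_zero1[OF t0] .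
  have qsr: "q \<cdot> (s \<cdot> (r \<cdot> j)) = zerom C K K"
  proof -
    have "q \<cdot> (s \<cdot> (r \<cdot> j)) = (q \<cdot> s) \<cdot> (r \<cdot> j)" using r t j by (simp add: homs_def)
    then show ?thesis unfolding qs using r t j by (simp add: homs_def)
  qed
  have qj': "q \<cdot> j' = ident C K"
    unfolding j'_def using j r t qsr by (simp add: homs_def)
  have rsx: "r \<cdot> (s \<cdot> x) = x" if "x \<in> homs C W Y" for x W
  proof -
    have "r \<cdot> (s \<cdot> x) = (r \<cdot> s) \<cdot> x" using r t that by (simp add: homs_def)
    then show ?thesis using rs that by (simp add: homs_def)
  qed
  have rj: "r \<cdot> j \<in> homs C K Y" using r j by (simp add: homs_def)
  have rj': "r \<cdot> j' = zerom C K Y"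
    unfolding j'_def using j r t rsx[OF rj] by (simp add: homs_def)
  define d where "d = ident C X \<ominus> s \<cdot> r"
  have d: "d \<in> homs C X X" unfolding d_def using r t by (simp add: homs_def)
  have srs: "s \<cdot> (r \<cdot> s) = s" unfolding rs using t by (simp add: homs_def)
  have "d \<cdot> s = zerom C Y X"
    unfolding d_def using r t srs by (simp add: homs_def)
  then obtain m where m: "m \<in> homs C K X" "m \<cdot> q = d" using factor_out[OF t0 d] by metis
  have "m = m \<cdot> (q \<cdot> j')" unfolding qj' using m by (simp add: homs_def)
  also have "\<dots> = d \<cdot> j'" using m t j' by (auto simp: homs_def)
  also have "\<dots> = j'" unfolding d_def using r t j' rj' by (simp add: homs_def)
  finally have jq: "j' \<cdot> q = d" using m by simp
  have "s \<cdot> r \<oplus> d = ident C X" unfolding d_def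
    using r t by (simp add: homs_def add_lcomm_arr[of "s \<cdot> r"])
  then have "biproduct C Y K X"
    unfolding biproduct_def
    using s r j' t rs qj' qs rj' jq by blast
  then show ?thesis using assms(1,2) t unfolding closed_summands_def by blast
qed

text \<open>
  Membership in \<open>\<A> * \<B>[1]\<close> and in \<open>\<S>[-1] * \<A>\<close> is restated by rotated triangles with end terms in \<open>\<B>\<close> and \<open>\<S>\<close>
  themselves. The morphism \<open>a\<close> is kept, since it is the one recorded by \<open>coreflection\<close> and \<open>reflection\<close>.
\<close>

lemma shift_up_triangle_iff:
  assumes "\<B> \<subseteq> Obj C"
  shows "(\<exists>W \<in> shift_up C \<B>. \<exists>g h. triangle_on C A X W a g h) \<longleftrightarrow>
    (\<exists>B \<in> \<B>. \<exists>f h. triangle_on C B A X f a h)"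
proof
  assume "\<exists>W \<in> shift_up C \<B>. \<exists>g h. triangle_on C A X W a g h"
  then obtain W B g h where *: "triangle_on C A X W a g h" "B \<in> \<B>" "isomorphic C (sho C B) W"
    by (auto simp: shift_up_def)
  then obtain g' h' where "triangle_on C A X (sho C B) a g' h'"
    using triangle_iso3 isomorphic_sym by metis
  then obtain k where "triangle_on C B A X k a g'" using triangle_unrotate * assms by blast
  then show "\<exists>B \<in> \<B>. \<exists>f h. triangle_on C B A X f a h" using * by blast
next
  assume "\<exists>B \<in> \<B>. \<exists>f h. triangle_on C B A X f a h"
  then obtain B f h where *: "B \<in> \<B>" "triangle_on C B A X f a h" by blast
  have "sho C B \<in> shift_up C \<B>"
    using * triangleE[OF *(2)] isomorphic_refl[of "sho C B"] by (auto simp: shift_up_def)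
  then show "\<exists>W \<in> shift_up C \<B>. \<exists>g h. triangle_on C A X W a g h"
    using triangle_rotate[OF *(2)] by blast
qed

lemma shift_down_triangle_iff:
  assumes "\<S> \<subseteq> Obj C"
  shows "(\<exists>W \<in> shift_down C \<S>. \<exists>f h. triangle_on C W X A f a h) \<longleftrightarrow>
    (\<exists>S \<in> \<S>. \<exists>g h. triangle_on C X A S a g h)"
proof
  assume "\<exists>W \<in> shift_down C \<S>. \<exists>f h. triangle_on C W X A f a h"
  then obtain W S f h where *: "triangle_on C W X A f a h" "S \<in> \<S>" "isomorphic C (sho C W) S"
    by (auto simp: shift_down_def)
  obtain g' h' where "triangle_on C X A S a g' h'"
    using triangle_iso3[OF triangle_rotate[OF *(1)] *(3)] .
  then show "\<exists>S \<in> \<S>. \<exists>g h. triangle_on C X A S a g h" using * by blast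
next
  assume "\<exists>S \<in> \<S>. \<exists>g h. triangle_on C X A S a g h"
  then obtain S g h where *: "S \<in> \<S>" "triangle_on C X A S a g h" by blast
  obtain W where W: "W \<in> Obj C" "isomorphic C (sho C W) S"
    using sho_ess_surj triangleE(7)[OF *(2)] by blast
  obtain g' h' where "triangle_on C X A (sho C W) a g' h'"
    using triangle_iso3[OF *(2) isomorphic_sym[OF W(2)]] .
  then obtain k where "triangle_on C W X A k a g'" using triangle_unrotate W by blast
  moreover have "W \<in> shift_down C \<S>" using W * by (auto simp: shift_down_def)
  ultimately show "\<exists>W \<in> shift_down C \<S>. \<exists>f h. triangle_on C W X A f a h" by blast
qed

lemma star_up_iff:
  assumes "\<B> \<subseteq> Obj C"
  shows "X \<in> star C \<A> (shift_up C \<B>) \<longleftrightarrow> (\<exists>B \<in> \<B>. \<exists>A \<in> \<A>. \<exists>f g h. triangle_on C B A X f g h)"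
proof -
  have "X \<in> star C \<A> (shift_up C \<B>) \<longleftrightarrow>
      (\<exists>A \<in> \<A>. \<exists>a. \<exists>W \<in> shift_up C \<B>. \<exists>g h. triangle_on C A X W a g h)"
    unfolding star_def using triangleE(6) by blast
  then show ?thesis unfolding shift_up_triangle_iff[OF assms] by blast
qed

lemma star_down_iff:
  assumes "\<S> \<subseteq> Obj C"
  shows "X \<in> star C (shift_down C \<S>) \<A> \<longleftrightarrow> (\<exists>A \<in> \<A>. \<exists>S \<in> \<S>. \<exists>f g h. triangle_on C X A S f g h)"
proof -
  have "X \<in> star C (shift_down C \<S>) \<A> \<longleftrightarrow>
      (\<exists>A \<in> \<A>. \<exists>a. \<exists>W \<in> shift_down C \<S>. \<exists>f h. triangle_on C W X A f a h)"
    unfolding star_def using triangleE(6) by blast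
  then show ?thesis unfolding shift_down_triangle_iff[OF assms] by blast
qed

lemma cotorsion_pairD:
  assumes "(\<A>, \<B>) \<in> cotorsion_pairs C"
  shows "\<A> \<subseteq> Obj C" "\<B> \<subseteq> Obj C" "closed_summands C \<A>" "closed_summands C \<B>"
    "closed_iso C \<A>" "closed_iso C \<B>"
    "\<And>A B. A \<in> \<A> \<Longrightarrow> B \<in> \<B> \<Longrightarrow> orth A B" "additive_subcat C \<A>" "additive_subcat C \<B>"
  using assms by (auto simp: cotorsion_pairs_def additive_subcat_def ext1_orth)

lemma left_approximation:
  assumes "(\<A>, \<B>) \<in> cotorsion_pairs C" "X \<in> Obj C"
  obtains A B f g h where "A \<in> \<A>" "B \<in> \<B>" "triangle_on C B A X f g h"
proof -
  have "X \<in> star C \<A> (shift_up C \<B>)" using assms by (auto simp: cotorsion_pairs_def)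
  then show ?thesis using star_up_iff[OF cotorsion_pairD(2)[OF assms(1)]] that by blast
qed

lemma right_approximation:
  assumes "(\<A>, \<B>) \<in> cotorsion_pairs C" "X \<in> Obj C"
  obtains A B f g h where "A \<in> \<A>" "B \<in> \<B>" "triangle_on C X B A f g h"
proof -
  obtain A B f g h where *: "A \<in> \<A>" "B \<in> \<B>" "triangle_on C B A (sho C X) f g h"
    using left_approximation assms sho_obj by metis
  have B: "B \<in> Obj C" using triangleE[OF *(3)] by blast
  obtain f' g' where "triangle_on C X B A f' g' g"
    by (rule triangle_unrotate2[OF triangle_rotate[OF *(3)] assms(2) B])
  then show ?thesis using * that by blast
qed

text \<open>
  The two halves of a cotorsion pair determine each other by orthogonality: an approximation triangle of an
  orthogonal object splits, and the halves are closed under retracts.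
\<close>

lemma left_mem_iff:
  assumes "(\<A>, \<B>) \<in> cotorsion_pairs C"
  shows "X \<in> \<A> \<longleftrightarrow> X \<in> Obj C \<and> (\<forall>B \<in> \<B>. orth X B)"
proof
  note c = cotorsion_pairD[OF assms]
  assume "X \<in> \<A>" then show "X \<in> Obj C \<and> (\<forall>B \<in> \<B>. orth X B)" using c by blast
next
  note c = cotorsion_pairD[OF assms]
  assume X: "X \<in> Obj C \<and> (\<forall>B \<in> \<B>. orth X B)"
  then obtain A B f g h where *: "A \<in> \<A>" "B \<in> \<B>" "triangle_on C B A X f g h"
    using left_approximation[OF assms] by blast
  note t = triangleE[OF *(3)]
  have "h = zerom C X (sho C B)" using orthD X * t by blast
  then have "h \<cdot> ident C X = zerom C X (sho C B)" using X t by (simp add: homs_def)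
  then obtain s where "s \<in> homs C X A" "g \<cdot> s = ident C X"
    using factor_in2[OF *(3) ident_hom] X by blast
  then show "X \<in> \<A>" using retract_mem[OF c(3) *(1)] t by blast
qed

lemma right_mem_iff:
  assumes "(\<A>, \<B>) \<in> cotorsion_pairs C"
  shows "Y \<in> \<B> \<longleftrightarrow> Y \<in> Obj C \<and> (\<forall>A \<in> \<A>. orth A Y)"
proof
  note c = cotorsion_pairD[OF assms]
  assume "Y \<in> \<B>" then show "Y \<in> Obj C \<and> (\<forall>A \<in> \<A>. orth A Y)" using c by blast
next
  note c = cotorsion_pairD[OF assms]
  assume Y: "Y \<in> Obj C \<and> (\<forall>A \<in> \<A>. orth A Y)"
  then obtain A B f g h where *: "A \<in> \<A>" "B \<in> \<B>" "triangle_on C Y B A f g h"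
    using right_approximation[OF assms] by blast
  note t = triangleE[OF *(3)]
  have "h = zerom C A (sho C Y)" using orthD Y * t by blast
  then have "sha C (ident C Y) \<cdot> h = zerom C A (sho C Y)" using Y t by (simp add: homs_def)
  then obtain r where "r \<in> homs C B Y" "r \<cdot> f = ident C Y"
    using factor_out0[OF *(3) ident_hom] Y by blast
  then show "Y \<in> \<B>" using retract_mem[OF c(4) *(2)] t by blast
qed

lemma left_extension:
  assumes "(\<A>, \<B>) \<in> cotorsion_pairs C" "triangle_on C X Y Z f g h" "X \<in> \<A>" "Z \<in> \<A>"
  shows "Y \<in> \<A>"
  using assms left_mem_iff[OF assms(1)] orth_ext_left[OF assms(2)] triangleE[OF assms(2)]
    cotorsion_pairD(2)[OF assms(1)] by blast

lemma right_extension: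
  assumes "(\<A>, \<B>) \<in> cotorsion_pairs C" "triangle_on C X Y Z f g h" "X \<in> \<B>" "Z \<in> \<B>"
  shows "Y \<in> \<B>"
  using assms right_mem_iff[OF assms(1)] orth_ext_right[OF assms(2)] triangleE[OF assms(2)]
    cotorsion_pairD(1)[OF assms(1)] by blast

lemma orth_biproduct_right:
  assumes "biproduct C X Y W" "orth Z X" "orth Z Y" "Z \<in> Obj C" shows "orth Z W"
proof -
  obtain i j p q where b: "i \<in> homs C X W" "j \<in> homs C Y W" "p \<in> homs C W X" "q \<in> homs C W Y"
    "(i \<cdot> p) \<oplus> (j \<cdot> q) = ident C W"
    using assms(1) unfolding biproduct_def by blast
  have O: "X \<in> Obj C" "Y \<in> Obj C" "W \<in> Obj C" using b homs_obj by blast+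
  show ?thesis
  proof (rule orthI)
    fix f assume f: "f \<in> homs C Z (sho C W)"
    have "sha C p \<cdot> f \<in> homs C Z (sho C X)" "sha C q \<cdot> f \<in> homs C Z (sho C Y)"
      using b f by (simp_all add: homs_def)
    then have z: "sha C p \<cdot> f = zerom C Z (sho C X)" "sha C q \<cdot> f = zerom C Z (sho C Y)"
      using orthD[OF assms(2)] orthD[OF assms(3)] by blast+
    have "f = sha C (ident C W) \<cdot> f" using O f by (simp add: homs_def)
    also have "\<dots> = sha C i \<cdot> (sha C p \<cdot> f) \<oplus> sha C j \<cdot> (sha C q \<cdot> f)"
      unfolding b(5)[symmetric] using b(1-4) f by (simp add: homs_def)
    also have "\<dots> = zerom C Z (sho C W)" unfolding z using b(1-4) f O assms by (simp add: homs_def)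
    finally show "f = zerom C Z (sho C W)" .
  qed (use O assms in auto)
qed

end

section \<open>Morphisms modulo the core of a concentric twin cotorsion pair\<close>

locale concentric_tcp = triangulated +
  fixes \<S> \<T> \<U> \<V>
  assumes twin: "twin_cotorsion_pair C \<S> \<T> \<U> \<V>"
    and conc: "concentric \<S> \<T> \<U> \<V>"
begin

abbreviation core ("\<I>") where "\<I> \<equiv> \<S> \<inter> \<T>"

lemma ST: "(\<S>, \<T>) \<in> cotorsion_pairs C" and UV: "(\<U>, \<V>) \<in> cotorsion_pairs C"
  and S_V: "X \<in> \<S> \<Longrightarrow> Y \<in> \<V> \<Longrightarrow> orth X Y"
  using twin by (auto simp: twin_cotorsion_pair_def ext1_orth)

lemmas S_obj = cotorsion_pairD(1)[OF ST] and T_obj = cotorsion_pairD(2)[OF ST]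
  and U_obj = cotorsion_pairD(1)[OF UV] and V_obj = cotorsion_pairD(2)[OF UV]
  and S_T = cotorsion_pairD(7)[OF ST] and U_V = cotorsion_pairD(7)[OF UV]

lemma S_sub_U: "\<S> \<subseteq> \<U>"
  using left_mem_iff[OF UV] S_V S_obj by blast

lemma V_sub_T: "\<V> \<subseteq> \<T>"
  using right_mem_iff[OF ST] S_V V_obj by blast

lemma core_UV: "\<I> = \<U> \<inter> \<V>"
  using conc by (simp add: concentric_def)

lemma core_mem: "J \<in> \<I> \<Longrightarrow> J \<in> Obj C \<and> J \<in> \<S> \<and> J \<in> \<T> \<and> J \<in> \<U> \<and> J \<in> \<V>"
  using core_UV S_obj by blast

lemma core_biproduct:
  assumes "X \<in> \<I>" "Y \<in> \<I>" obtains W where "W \<in> \<I>" "biproduct C X Y W"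
proof -
  obtain W where W: "W \<in> \<S>" "biproduct C X Y W"
    using assms cotorsion_pairD(8)[OF ST] unfolding additive_subcat_def by blast
  have "W \<in> \<T>"
    using right_mem_iff[OF ST] W S_obj S_T assms orth_biproduct_right[OF W(2)] by blast
  then show ?thesis using that W by blast
qed

text \<open>
  \<open>null f\<close> says that \<open>f\<close> becomes zero in the ideal quotient by \<open>\<I>\<close>, and \<open>f \<simeq> g\<close> that \<open>f\<close> and \<open>g\<close> become equal there.
  Arguing with representatives avoids computing with cosets.
\<close>

definition null :: "'b \<Rightarrow> bool" where
  "null f \<longleftrightarrow> f \<in> factor_ideal C \<I> (dm C f) (cd C f)"

definition eqv :: "'b \<Rightarrow> 'b \<Rightarrow> bool"  (infix "\<simeq>" 50) where
  "f \<simeq> g \<longleftrightarrow> f \<in> Arr C \<and> g \<in> Arr C \<and> dm C f = dm C g \<and> cd C f = cd C g \<and> null (f \<ominus> g)"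

lemma nullI: "W \<in> \<I> \<Longrightarrow> a \<in> homs C X W \<Longrightarrow> b \<in> homs C W Y \<Longrightarrow> null (b \<cdot> a)"
  unfolding null_def factor_ideal_def by (auto simp: homs_def)

lemma nullE:
  assumes "null f" "f \<in> homs C X Y"
  obtains W a b where "W \<in> \<I>" "a \<in> homs C X W" "b \<in> homs C W Y" "f = b \<cdot> a"
  using assms unfolding null_def factor_ideal_def by (auto simp: homs_def)

lemma null_cmp_left:
  assumes "null f" "f \<in> homs C X Y" "g \<in> homs C Y Z" shows "null (g \<cdot> f)"
proof -
  obtain W a b where *: "W \<in> \<I>" "a \<in> homs C X W" "b \<in> homs C W Y" "f = b \<cdot> a"
    using nullE assms by metis
  have "g \<cdot> f = (g \<cdot> b) \<cdot> a" using * assms by (simp add: homs_def)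
  then show ?thesis using nullI[of W a X "g \<cdot> b" Z] * assms by (simp add: homs_def)
qed

lemma null_cmp_right:
  assumes "null g" "f \<in> homs C X Y" "g \<in> homs C Y Z" shows "null (g \<cdot> f)"
proof -
  obtain W a b where *: "W \<in> \<I>" "a \<in> homs C Y W" "b \<in> homs C W Z" "g = b \<cdot> a"
    using nullE assms by metis
  have "g \<cdot> f = b \<cdot> (a \<cdot> f)" using * assms by (simp add: homs_def)
  then show ?thesis using nullI[of W "a \<cdot> f" X b Z] * assms by (simp add: homs_def)
qed

lemma null_zero:
  assumes "X \<in> Obj C" "Y \<in> Obj C" shows "null (zerom C X Y)"
proof -
  obtain N where N: "N \<in> \<S>" "zero_obj C N"
    using cotorsion_pairD(8)[OF ST] unfolding additive_subcat_def by blast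
  have O: "N \<in> Obj C" using N S_obj by blast
  have "N \<in> \<T>" unfolding right_mem_iff[OF ST]
    using O S_obj orthI zero_obj_to[OF zero_obj_sho[OF N(2)]] by blast
  then show ?thesis
    using nullI[of N "zerom C X N" X "zerom C N Y" Y] N O assms by (simp add: homs_def)
qed

lemma null_neg:
  assumes "null f" "f \<in> homs C X Y" shows "null (neg C f)"
proof -
  obtain W a b where *: "W \<in> \<I>" "a \<in> homs C X W" "b \<in> homs C W Y" "f = b \<cdot> a"
    using nullE assms by metis
  have "neg C f = neg C b \<cdot> a" using * by (simp add: homs_def)
  then show ?thesis using nullI[of W a X "neg C b" Y] * by (simp add: homs_def)
qed

text \<open>
  Morphisms through \<open>W\<close> and through \<open>W'\<close> add up to a morphism through their biproduct.
\<close>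

lemma null_add:
  assumes "null f" "null g" "f \<in> homs C X Y" "g \<in> homs C X Y" shows "null (f \<oplus> g)"
proof -
  obtain W a b where *: "W \<in> \<I>" "a \<in> homs C X W" "b \<in> homs C W Y" "f = b \<cdot> a"
    using nullE assms by metis
  obtain W' a' b' where **: "W' \<in> \<I>" "a' \<in> homs C X W'" "b' \<in> homs C W' Y" "g = b' \<cdot> a'"
    using nullE assms by metis
  obtain P where P: "P \<in> \<I>" "biproduct C W W' P" using core_biproduct * ** by metis
  then obtain i j p q where b: "i \<in> homs C W P" "j \<in> homs C W' P" "p \<in> homs C P W" "q \<in> homs C P W'"
    "p \<cdot> i = ident C W" "q \<cdot> j = ident C W'" "q \<cdot> i = zerom C W W'" "p \<cdot> j = zerom C W' W"
    unfolding biproduct_def by blast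
  have O: "W \<in> Obj C" "W' \<in> Obj C" using core_mem[OF *(1)] core_mem[OF **(1)] by blast+
  have e: "p \<cdot> (i \<cdot> a) = a" "q \<cdot> (j \<cdot> a') = a'" "q \<cdot> (i \<cdot> a) = zerom C X W'" "p \<cdot> (j \<cdot> a') = zerom C X W"
  proof -
    have "p \<cdot> (i \<cdot> a) = (p \<cdot> i) \<cdot> a" using b(1-4) * by (simp add: homs_def)
    then show "p \<cdot> (i \<cdot> a) = a" unfolding b using * by (simp add: homs_def)
    have "q \<cdot> (j \<cdot> a') = (q \<cdot> j) \<cdot> a'" using b(1-4) ** by (simp add: homs_def)
    then show "q \<cdot> (j \<cdot> a') = a'" unfolding b using ** by (simp add: homs_def)
    have "q \<cdot> (i \<cdot> a) = (q \<cdot> i) \<cdot> a" using b(1-4) * by (simp add: homs_def)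
    then show "q \<cdot> (i \<cdot> a) = zerom C X W'" unfolding b using * O by (simp add: homs_def)
    have "p \<cdot> (j \<cdot> a') = (p \<cdot> j) \<cdot> a'" using b(1-4) ** by (simp add: homs_def)
    then show "p \<cdot> (j \<cdot> a') = zerom C X W" unfolding b using ** O by (simp add: homs_def)
  qed
  have XY: "X \<in> Obj C" "Y \<in> Obj C" using assms homs_obj by blast+
  have fg: "f \<oplus> g = (b \<cdot> p \<oplus> b' \<cdot> q) \<cdot> (i \<cdot> a \<oplus> j \<cdot> a')"
    using b(1-4) * ** e XY by (simp add: homs_def)
  have "b \<cdot> p \<oplus> b' \<cdot> q \<in> homs C P Y" "i \<cdot> a \<oplus> j \<cdot> a' \<in> homs C X P"
    using b(1-4) * ** by (simp_all add: homs_def)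
  then show ?thesis unfolding fg using nullI[OF P(1)] by blast
qed

lemma null_sub:
  "null f \<Longrightarrow> null g \<Longrightarrow> f \<in> homs C X Y \<Longrightarrow> g \<in> homs C X Y \<Longrightarrow> null (f \<ominus> g)"
  using null_add null_neg neg_hom by metis

lemma eqv_homs: "f \<simeq> g \<Longrightarrow> f \<in> homs C X Y \<Longrightarrow> g \<in> homs C X Y"
  by (auto simp: eqv_def homs_def)

lemma eqvI: "f \<in> homs C X Y \<Longrightarrow> g \<in> homs C X Y \<Longrightarrow> null (f \<ominus> g) \<Longrightarrow> f \<simeq> g"
  by (auto simp: eqv_def homs_def)

lemma eqvD: "f \<simeq> g \<Longrightarrow> null (f \<ominus> g)" by (simp add: eqv_def)

lemma eqv_refl: "f \<in> homs C X Y \<Longrightarrow> f \<simeq> f"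
  using null_zero[of X Y] homs_obj[of f X Y] by (auto simp: eqv_def homs_def)

lemma eqv_sym: assumes "f \<simeq> g" shows "g \<simeq> f"
proof -
  have "g \<ominus> f = neg C (f \<ominus> g)" using assms add_comm_arr[of g "neg C f"] by (auto simp: eqv_def)
  moreover have "null (neg C (f \<ominus> g))"
    by (rule null_neg[of _ "dm C f" "cd C f"]) (use assms in \<open>auto simp: eqv_def homs_def\<close>)
  ultimately show ?thesis using assms by (simp add: eqv_def)
qed

lemma eqv_trans [trans]: assumes "f \<simeq> g" "g \<simeq> h" shows "f \<simeq> h"
proof -
  have "f \<ominus> h = (f \<ominus> g) \<oplus> (g \<ominus> h)" using assms by (auto simp: eqv_def)
  moreover have "null ((f \<ominus> g) \<oplus> (g \<ominus> h))"
    by (rule null_add[of _ _ "dm C f" "cd C f"]) (use assms in \<open>auto simp: eqv_def homs_def\<close>)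
  ultimately show ?thesis using assms by (simp add: eqv_def)
qed

lemma eqv_cmp:
  assumes "f \<simeq> f'" "g \<simeq> g'" "f \<in> homs C X Y" "g \<in> homs C Y Z" shows "g \<cdot> f \<simeq> g' \<cdot> f'"
proof -
  have f': "f' \<in> homs C X Y" and g': "g' \<in> homs C Y Z" using assms eqv_homs by blast+
  have 1: "g \<cdot> f \<ominus> g \<cdot> f' = g \<cdot> (f \<ominus> f')" "g \<cdot> f' \<ominus> g' \<cdot> f' = (g \<ominus> g') \<cdot> f'"
    using assms f' g' by (simp_all add: homs_def)
  have "null (g \<cdot> (f \<ominus> f'))" "null ((g \<ominus> g') \<cdot> f')"
    using null_cmp_left[OF eqvD[OF assms(1)]] null_cmp_right[OF eqvD[OF assms(2)]]
      assms(3,4) f' g' by (simp_all add: homs_def)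
  then have "g \<cdot> f \<simeq> g \<cdot> f'" "g \<cdot> f' \<simeq> g' \<cdot> f'"
    unfolding 1[symmetric] using eqvI assms(3,4) f' g' cmp_hom by metis+
  then show ?thesis using eqv_trans by blast
qed

lemma eqv_cmp_left: "f \<simeq> f' \<Longrightarrow> f \<in> homs C X Y \<Longrightarrow> g \<in> homs C Y Z \<Longrightarrow> g \<cdot> f \<simeq> g \<cdot> f'"
  using eqv_cmp eqv_refl by blast

lemma eqv_cmp_right: "g \<simeq> g' \<Longrightarrow> f \<in> homs C X Y \<Longrightarrow> g \<in> homs C Y Z \<Longrightarrow> g \<cdot> f \<simeq> g' \<cdot> f"
  using eqv_cmp eqv_refl by blast

lemma eqv_null: assumes "f \<simeq> g" "null g" shows "null f"
proof -
  have "f = (f \<ominus> g) \<oplus> g" using assms by (auto simp: eqv_def)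
  moreover have "null ((f \<ominus> g) \<oplus> g)"
    by (rule null_add[of _ _ "dm C f" "cd C f"]) (use assms in \<open>auto simp: eqv_def homs_def\<close>)
  ultimately show ?thesis by simp
qed

text \<open>
  Orthogonality to an object of \<open>\<T>\<close> passes to retracts in the quotient: \<open>id\<^sub>X\<close> is \<open>r \<cdot> s\<close> plus a morphism
  through \<open>\<I>\<close>, and \<open>\<I> \<subseteq> \<S>\<close> is itself orthogonal to \<open>\<T>\<close>.
\<close>

lemma orth_retract:
  assumes "s \<in> homs C X Y" "r \<in> homs C Y X" "r \<cdot> s \<simeq> ident C X"
    and "orth Y B" "B \<in> \<T>"
  shows "orth X B"
proof (rule orthI)
  have O: "X \<in> Obj C" "Y \<in> Obj C" "B \<in> Obj C" using homs_obj assms T_obj by blast+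
  show "X \<in> Obj C" "B \<in> Obj C" by fact+
  fix f assume f: "f \<in> homs C X (sho C B)"
  have "ident C X \<ominus> r \<cdot> s \<in> homs C X X" using assms O by (simp add: homs_def)
  then obtain W a b where *: "W \<in> \<I>" "a \<in> homs C X W" "b \<in> homs C W X" "ident C X \<ominus> r \<cdot> s = b \<cdot> a"
    using nullE[OF eqvD[OF eqv_sym[OF assms(3)]]] by metis
  have "f \<cdot> r \<in> homs C Y (sho C B)" "f \<cdot> b \<in> homs C W (sho C B)"
    using f assms * cmp_hom by blast+
  then have z: "f \<cdot> r = zerom C Y (sho C B)" "f \<cdot> b = zerom C W (sho C B)"
    using orthD assms(4) S_T * assms(5) by blast+
  have "f = f \<cdot> ((ident C X \<ominus> r \<cdot> s) \<oplus> r \<cdot> s)" using assms f O by (simp add: homs_def)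
  also have "\<dots> = (f \<cdot> b) \<cdot> a \<oplus> (f \<cdot> r) \<cdot> s"
    unfolding *(4) using assms(1,2) f O *(2,3) by (simp add: homs_def)
  also have "\<dots> = zerom C X (sho C B)"
    unfolding z using assms(1,2) f O *(2,3) by (simp add: homs_def)
  finally show "f = zerom C X (sho C B)" .
qed

lemma core_if_null_ident:
  assumes "null (ident C X)" "X \<in> Obj C" shows "X \<in> \<I>"
proof -
  obtain W a b where "W \<in> \<I>" "a \<in> homs C X W" "b \<in> homs C W X" "ident C X = b \<cdot> a"
    using nullE[OF assms(1) ident_hom[OF assms(2)]] by metis
  then show ?thesis
    using retract_mem[OF cotorsion_pairD(3)[OF ST]] retract_mem[OF cotorsion_pairD(4)[OF ST]]
    by (metis Int_iff)
qed

section \<open>Reflections and coreflections\<close>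

text \<open>
  The triangles behind \<open>reflection\<close> and \<open>coreflection\<close>, as predicates, so that arguments do not
  depend on the chosen triangle.
\<close>

definition is_refl :: "'a \<Rightarrow> 'a \<Rightarrow> 'b \<Rightarrow> bool" where
  "is_refl X T t \<longleftrightarrow> T \<in> \<T> \<and> (\<exists>S \<in> \<S>. \<exists>s h. triangle_on C X T S t s h)"

definition is_corefl :: "'a \<Rightarrow> 'a \<Rightarrow> 'b \<Rightarrow> bool" where
  "is_corefl X U u \<longleftrightarrow> U \<in> \<U> \<and> (\<exists>V \<in> \<V>. \<exists>v h. triangle_on C V U X v u h)"

lemma refl_homs: "is_refl X T t \<Longrightarrow> t \<in> homs C X T \<and> T \<in> \<T>"
  using triangleE(1) by (auto simp: is_refl_def)

lemma corefl_homs: "is_corefl X U u \<Longrightarrow> u \<in> homs C U X \<and> U \<in> \<U>"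
  using triangleE(2) by (auto simp: is_corefl_def)

lemma ex_refl: "X \<in> Obj C \<Longrightarrow> \<exists>T t. is_refl X T t"
  using right_approximation[OF ST] unfolding is_refl_def by metis

lemma ex_corefl: "X \<in> Obj C \<Longrightarrow> \<exists>U u. is_corefl X U u"
  using left_approximation[OF UV] unfolding is_corefl_def by metis

text \<open>
  An object of \<open>\<S>\<close> embeds into its right approximation, which lies in \<open>\<S> \<inter> \<T>\<close> because \<open>\<S>\<close> is closed under
  extensions, and every morphism to \<open>\<T>\<close> extends along this embedding.
\<close>

lemma S_to_T_null:
  assumes "f \<in> homs C X Y" "X \<in> \<S>" "Y \<in> \<T>" shows "null f"
proof -
  obtain S J i s h where *: "S \<in> \<S>" "J \<in> \<T>" "triangle_on C X J S i s h"
    using right_approximation[OF ST] assms S_obj by (metis subsetD)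
  note t = triangleE[OF *(3)]
  have "J \<in> \<S>" using left_extension[OF ST *(3)] assms * by blast
  moreover have "sha C f \<cdot> h \<in> homs C S (sho C Y)" using t assms(1) by (simp add: homs_def)
  then have "sha C f \<cdot> h = zerom C S (sho C Y)" using orthD S_T * assms by blast
  then obtain g where "g \<in> homs C J Y" "g \<cdot> i = f" using factor_out0[OF *(3) assms(1)] by blast
  ultimately show ?thesis using nullI[of J i X g Y] t * by auto
qed

lemma U_to_V_null:
  assumes "f \<in> homs C X Y" "X \<in> \<U>" "Y \<in> \<V>" shows "null f"
proof -
  obtain V J v j h where *: "J \<in> \<U>" "V \<in> \<V>" "triangle_on C V J Y v j h"
    using left_approximation[OF UV] assms V_obj by (metis subsetD)
  note t = triangleE[OF *(3)]
  have "J \<in> \<V>" using right_extension[OF UV *(3)] assms * by blast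
  moreover have "h \<cdot> f \<in> homs C X (sho C V)" using t assms(1) by (simp add: homs_def)
  then have "h \<cdot> f = zerom C X (sho C V)" using orthD U_V * assms by blast
  then obtain g where "g \<in> homs C X J" "j \<cdot> g = f" using factor_in2[OF *(3) assms(1)] by blast
  ultimately show ?thesis using nullI[of J g X j Y] t * core_UV by auto
qed

lemma refl_factor:
  assumes "is_refl X T t" "f \<in> homs C X Y" "Y \<in> \<T>"
  obtains g where "g \<in> homs C T Y" "g \<cdot> t = f"
proof -
  obtain S s h where *: "S \<in> \<S>" "triangle_on C X T S t s h" using assms is_refl_def by metis
  note tr = triangleE[OF *(2)]
  have "sha C f \<cdot> h \<in> homs C S (sho C Y)" using tr assms by (simp add: homs_def)
  then have "sha C f \<cdot> h = zerom C S (sho C Y)" using orthD S_T * assms by blast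
  then show ?thesis using factor_out0[OF *(2) assms(2)] that by blast
qed

lemma corefl_factor:
  assumes "is_corefl X U u" "f \<in> homs C Y X" "Y \<in> \<U>"
  obtains g where "g \<in> homs C Y U" "u \<cdot> g = f"
proof -
  obtain V v h where *: "V \<in> \<V>" "triangle_on C V U X v u h" using assms is_corefl_def by metis
  note tr = triangleE[OF *(2)]
  have "h \<cdot> f \<in> homs C Y (sho C V)" using tr assms by (simp add: homs_def)
  then have "h \<cdot> f = zerom C Y (sho C V)" using orthD U_V * assms by blast
  then show ?thesis using factor_in2[OF *(2) assms(2)] that by blast
qed

text \<open>
  Uniqueness in the universal property of a reflection, modulo \<open>\<I>\<close>. If \<open>f \<cdot> t\<close> passes through \<open>J \<in> \<I>\<close>, the
  first leg extends along \<open>t\<close>, and the resulting correction of \<open>f\<close> kills \<open>t\<close>; it then passes through the cone,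
  which lies in \<open>\<S>\<close>.
\<close>

lemma refl_null:
  assumes "is_refl X T t" "f \<in> homs C T Y" "Y \<in> \<T>" "null (f \<cdot> t)"
  shows "null f"
proof -
  obtain S s h where *: "S \<in> \<S>" "triangle_on C X T S t s h" using assms is_refl_def by metis
  note tr = triangleE[OF *(2)]
  have "f \<cdot> t \<in> homs C X Y" using tr assms by (simp add: homs_def)
  then obtain J a b where j: "J \<in> \<I>" "a \<in> homs C X J" "b \<in> homs C J Y" "f \<cdot> t = b \<cdot> a"
    using nullE[OF assms(4)] by metis
  obtain a' where a': "a' \<in> homs C T J" "a' \<cdot> t = a" using refl_factor[OF assms(1) j(2)] j by blast
  have ba: "b \<cdot> a' \<in> homs C T Y" using j a' by (simp add: homs_def)
  have "(f \<ominus> b \<cdot> a') \<cdot> t = zerom C X Y"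
  proof -
    have "(f \<ominus> b \<cdot> a') \<cdot> t = f \<cdot> t \<ominus> b \<cdot> (a' \<cdot> t)" using tr assms(2) j(2,3) a'(1) by (simp add: homs_def)
    then show ?thesis unfolding a'(2) j(4) using j by (simp add: homs_def)
  qed
  moreover have d: "f \<ominus> b \<cdot> a' \<in> homs C T Y" using ba assms(2) by (simp add: homs_def)
  ultimately obtain k where k: "k \<in> homs C S Y" "k \<cdot> s = f \<ominus> b \<cdot> a'" using factor_out[OF *(2)] by metis
  have "null (f \<ominus> b \<cdot> a')"
    using null_cmp_right[OF S_to_T_null[OF k(1) *(1) assms(3)] tr(2) k(1)] k by simp
  then have "f \<simeq> b \<cdot> a'" using eqvI assms(2) ba by blast
  then show ?thesis using eqv_null nullI j a' by metis
qed

lemma corefl_null: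
  assumes "is_corefl X U u" "f \<in> homs C Y U" "Y \<in> \<U>" "null (u \<cdot> f)"
  shows "null f"
proof -
  obtain V v h where *: "V \<in> \<V>" "triangle_on C V U X v u h" using assms is_corefl_def by metis
  note tr = triangleE[OF *(2)]
  have "u \<cdot> f \<in> homs C Y X" using tr assms by (simp add: homs_def)
  then obtain J a b where j: "J \<in> \<I>" "a \<in> homs C Y J" "b \<in> homs C J X" "u \<cdot> f = b \<cdot> a"
    using nullE[OF assms(4)] by metis
  obtain b' where b': "b' \<in> homs C J U" "u \<cdot> b' = b"
    using corefl_factor[OF assms(1) j(3)] core_mem[OF j(1)] by blast
  have ba: "b' \<cdot> a \<in> homs C Y U" using j b' by (simp add: homs_def)
  have "u \<cdot> (f \<ominus> b' \<cdot> a) = zerom C Y X"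
  proof -
    have "u \<cdot> (f \<ominus> b' \<cdot> a) = u \<cdot> f \<ominus> (u \<cdot> b') \<cdot> a" using tr assms(2) j(2,3) b'(1) by (simp add: homs_def)
    then show ?thesis unfolding b'(2) j(4) using j by (simp add: homs_def)
  qed
  moreover have d: "f \<ominus> b' \<cdot> a \<in> homs C Y U" using ba assms(2) by (simp add: homs_def)
  ultimately obtain k where k: "k \<in> homs C Y V" "v \<cdot> k = f \<ominus> b' \<cdot> a" using factor_in[OF *(2)] by metis
  have "null (f \<ominus> b' \<cdot> a)"
    using null_cmp_left[OF U_to_V_null[OF k(1) assms(3) *(1)] k(1) tr(1)] k by simp
  then have "f \<simeq> b' \<cdot> a" using eqvI assms(2) ba by blast
  then show ?thesis using eqv_null nullI j b' by metis
qed

lemma refl_cancel: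
  assumes "is_refl X T t" "f \<in> homs C T Y" "g \<in> homs C T Y" "Y \<in> \<T>" "f \<cdot> t \<simeq> g \<cdot> t"
  shows "f \<simeq> g"
proof -
  have t: "t \<in> homs C X T" using refl_homs assms by blast
  have "f \<cdot> t \<ominus> g \<cdot> t = (f \<ominus> g) \<cdot> t" using t assms(2,3) by (simp add: homs_def)
  then have "null ((f \<ominus> g) \<cdot> t)" using eqvD[OF assms(5)] by simp
  then show ?thesis using refl_null[OF assms(1)] assms add_hom neg_hom eqvI by metis
qed

lemma corefl_cancel:
  assumes "is_corefl X U u" "f \<in> homs C Y U" "g \<in> homs C Y U" "Y \<in> \<U>" "u \<cdot> f \<simeq> u \<cdot> g"
  shows "f \<simeq> g"
proof -
  have t: "u \<in> homs C U X" using corefl_homs assms by blast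
  have "u \<cdot> f \<ominus> u \<cdot> g = u \<cdot> (f \<ominus> g)" using t assms(2,3) by (simp add: homs_def)
  then have "null (u \<cdot> (f \<ominus> g))" using eqvD[OF assms(5)] by simp
  then show ?thesis using corefl_null[OF assms(1)] assms add_hom neg_hom eqvI by metis
qed

end

section \<open>The ideal quotient\<close>

context concentric_tcp
begin

abbreviation cls :: "'b \<Rightarrow> 'b set" where "cls \<equiv> qcls C \<I>"

text \<open>
  The cosets that form the arrows of the quotient are the classes of \<open>\<simeq>\<close>; with this the operations of
  \<open>quot\<close> are those induced on representatives.
\<close>

lemma cls_eq:
  assumes "f \<in> homs C X Y" shows "cls f = {g. g \<simeq> f}"
proof -
  have d: "dm C f = X" "cd C f = Y" using assms homs_arr by blast+
  have "cls f = {b \<oplus> f | b. b \<in> factor_ideal C \<I> X Y}"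
    unfolding qcls_def r_coset_def d by (auto simp: homgrp_def)
  also have "\<dots> = {g. g \<simeq> f}"
  proof (intro equalityI subsetI)
    fix g assume "g \<in> {b \<oplus> f | b. b \<in> factor_ideal C \<I> X Y}"
    then obtain b where b: "b \<in> factor_ideal C \<I> X Y" "g = b \<oplus> f" by blast
    have h: "b \<in> homs C X Y" using b(1) cmp_hom by (auto simp: factor_ideal_def)
    then have "null b" using b(1) by (auto simp: null_def homs_def)
    moreover have "g \<ominus> f = b" using b(2) h assms homs_obj[OF assms] by (simp add: homs_def)
    ultimately show "g \<in> {g. g \<simeq> f}" using eqvI[of g X Y f] b(2) h assms add_hom by auto
  next
    fix g assume "g \<in> {g. g \<simeq> f}"
    then have e: "g \<simeq> f" by blast
    then have g: "g \<in> homs C X Y" using eqv_homs[OF eqv_sym] assms by blast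
    have "g \<ominus> f \<in> factor_ideal C \<I> X Y"
      using eqvD[OF e] g assms by (simp add: null_def homs_def)
    moreover have "g = (g \<ominus> f) \<oplus> f" using g assms by (simp add: homs_def)
    ultimately show "g \<in> {b \<oplus> f | b. b \<in> factor_ideal C \<I> X Y}" by blast
  qed
  finally show ?thesis .
qed

lemma cls_iff:
  assumes "f \<in> homs C X Y" "g \<in> homs C X Y" shows "cls f = cls g \<longleftrightarrow> f \<simeq> g"
  unfolding cls_eq[OF assms(1)] cls_eq[OF assms(2)]
  using eqv_refl[OF assms(1)] eqv_sym eqv_trans by blast

lemma quot_ends:
  assumes "f \<in> homs C X Y"
  shows "dm (quot C \<X> \<I>) (cls f) = X" "cd (quot C \<X> \<I>) (cls f) = Y"
proof -
  have f: "f \<simeq> f" using eqv_refl assms by blast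
  have "dm C ` {g. g \<simeq> f} = {X}" "cd C ` {g. g \<simeq> f} = {Y}"
    using f assms by (auto simp: eqv_def homs_def image_iff)
  then show "dm (quot C \<X> \<I>) (cls f) = X" "cd (quot C \<X> \<I>) (cls f) = Y"
    unfolding cls_eq[OF assms] by (simp_all add: quot_def)
qed

lemma quot_homs:
  assumes "X \<in> \<X>" "Y \<in> \<X>" shows "homs (quot C \<X> \<I>) X Y = cls ` homs C X Y"
proof (intro equalityI subsetI)
  fix F assume F: "F \<in> homs (quot C \<X> \<I>) X Y"
  then obtain f where f: "f \<in> Arr C" "F = cls f" by (auto simp: homs_def quot_def)
  then have "f \<in> homs C (dm C f) (cd C f)" by (simp add: homs_def)
  then have "f \<in> homs C X Y" using F f quot_ends by (auto simp: homs_def)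
  then show "F \<in> cls ` homs C X Y" using f by blast
next
  fix F assume "F \<in> cls ` homs C X Y"
  then obtain f where f: "f \<in> homs C X Y" "F = cls f" by blast
  then have "F \<in> Arr (quot C \<X> \<I>)" using assms by (auto simp: homs_def quot_def)
  then show "F \<in> homs (quot C \<X> \<I>) X Y" using f quot_ends by (auto simp: homs_def)
qed

lemma quot_cmp:
  assumes "f \<in> homs C X Y" "g \<in> homs C Y Z"
  shows "cls g \<cdot>\<^bsub>quot C \<X> \<I>\<^esub> cls f = cls (g \<cdot> f)"
proof -
  have "cls (g' \<cdot> f') = cls (g \<cdot> f)" if "f' \<simeq> f" "g' \<simeq> g" for f' g'
  proof -
    have h: "f' \<in> homs C X Y" "g' \<in> homs C Y Z" using that assms eqv_homs eqv_sym by blast+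
    then have "g' \<cdot> f' \<simeq> g \<cdot> f" using eqv_cmp that by blast
    then show ?thesis using cls_iff h assms cmp_hom by blast
  qed
  moreover have "f \<simeq> f" "g \<simeq> g" using eqv_refl assms by blast+
  ultimately have "{cls (g' \<cdot> f') | f' g'. f' \<in> cls f \<and> g' \<in> cls g} = {cls (g \<cdot> f)}"
    unfolding cls_eq[OF assms(1)] cls_eq[OF assms(2)] by blast
  then show ?thesis by (simp add: quot_def)
qed

lemma quot_isoE:
  assumes "is_iso (quot C \<X> \<I>) (cls m)" "m \<in> homs C X Y" "X \<in> \<X>" "Y \<in> \<X>"
  obtains m' where "m' \<in> homs C Y X" "m' \<cdot> m \<simeq> ident C X" "m \<cdot> m' \<simeq> ident C Y"
proof -
  have O: "X \<in> Obj C" "Y \<in> Obj C" using assms(2) homs_obj by blast+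
  obtain G where G: "G \<in> homs (quot C \<X> \<I>) Y X"
    "G \<cdot>\<^bsub>quot C \<X> \<I>\<^esub> cls m = cls (ident C X)" "cls m \<cdot>\<^bsub>quot C \<X> \<I>\<^esub> G = cls (ident C Y)"
    using assms(1) quot_ends[OF assms(2), of \<X>] unfolding is_iso_def by (auto simp: quot_def)
  obtain m' where m': "m' \<in> homs C Y X" "G = cls m'" using G quot_homs assms by blast
  have "m' \<cdot> m \<simeq> ident C X" "m \<cdot> m' \<simeq> ident C Y"
    using G(2,3) unfolding m'(2)
    using quot_cmp[OF assms(2) m'(1)] quot_cmp[OF m'(1) assms(2)]
      cls_iff[OF cmp_hom[OF assms(2) m'(1)] ident_hom[OF O(1)]]
      cls_iff[OF cmp_hom[OF m'(1) assms(2)] ident_hom[OF O(2)]] by simp_all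
  then show ?thesis using that m' by blast
qed

section \<open>The comparison transformation\<close>

abbreviation om_ob where "om_ob X \<equiv> fst (coreflection C \<U> \<V> X)"
abbreviation eps where "eps X \<equiv> snd (coreflection C \<U> \<V> X)"
abbreviation si_ob where "si_ob X \<equiv> fst (reflection C \<S> \<T> X)"
abbreviation eta where "eta X \<equiv> snd (reflection C \<S> \<T> X)"
abbreviation om where "om \<equiv> omega C \<I> \<U> \<V>"
abbreviation si where "si \<equiv> sigma C \<I> \<S> \<T>"

lemma coreflection_corefl:
  assumes "X \<in> Obj C" shows "is_corefl X (om_ob X) (eps X)"
proof -
  have "coreflection C \<U> \<V> X = (SOME p. is_corefl X (fst p) (snd p))"
    unfolding coreflection_def is_corefl_def shift_up_triangle_iff[OF V_obj]
    by (intro arg_cong[of _ _ Eps] ext) (simp add: case_prod_beta)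
  moreover have "\<exists>p. is_corefl X (fst p) (snd p)" using ex_corefl[OF assms] by auto
  ultimately show ?thesis by (metis (mono_tags, lifting) someI_ex)
qed

lemma reflection_refl:
  assumes "X \<in> Obj C" shows "is_refl X (si_ob X) (eta X)"
proof -
  have "reflection C \<S> \<T> X = (SOME p. is_refl X (fst p) (snd p))"
    unfolding reflection_def is_refl_def shift_down_triangle_iff[OF S_obj]
    by (intro arg_cong[of _ _ Eps] ext) (simp add: case_prod_beta)
  moreover have "\<exists>p. is_refl X (fst p) (snd p)" using ex_refl[OF assms] by auto
  ultimately show ?thesis by (metis (mono_tags, lifting) someI_ex)
qed

lemma eps_hom: "X \<in> Obj C \<Longrightarrow> eps X \<in> homs C (om_ob X) X"
  and om_U: "X \<in> Obj C \<Longrightarrow> om_ob X \<in> \<U>"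
  using corefl_homs[OF coreflection_corefl] by blast+

lemma eta_hom: "X \<in> Obj C \<Longrightarrow> eta X \<in> homs C X (si_ob X)"
  and si_T: "X \<in> Obj C \<Longrightarrow> si_ob X \<in> \<T>"
  using refl_homs[OF reflection_refl] by blast+

lemma om_obj: "X \<in> Obj C \<Longrightarrow> om_ob X \<in> Obj C" using om_U U_obj by blast
lemma si_obj: "X \<in> Obj C \<Longrightarrow> si_ob X \<in> Obj C" using si_T T_obj by blast

lemma refl_in_U: assumes "is_refl X T t" "X \<in> \<U>" shows "T \<in> \<U>"
  using assms left_extension[OF UV] S_sub_U unfolding is_refl_def by blast

lemma corefl_in_T: assumes "is_corefl X U u" "X \<in> \<T>" shows "U \<in> \<T>"
  using assms right_extension[OF ST] V_sub_T unfolding is_corefl_def by blast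

lemma fob_om: "fob om X = om_ob X" by (simp add: omega_def Let_def)
lemma fob_si: "fob si X = si_ob X" by (simp add: sigma_def Let_def)

text \<open>
  The action of \<open>\<omega>\<close> on a class is represented by any lift through the coreflections; such lifts exist and are
  unique modulo \<open>\<I>\<close>, which is what the definite description in \<open>omega\<close> needs.
\<close>

lemma far_om:
  assumes "f \<in> homs C X Y"
  obtains g where "g \<in> homs C (om_ob X) (om_ob Y)" "eps Y \<cdot> g \<simeq> f \<cdot> eps X" "far om (cls f) = cls g"
proof -
  have O: "X \<in> Obj C" "Y \<in> Obj C" using assms homs_obj by blast+
  note e = eps_hom[OF O(1)] eps_hom[OF O(2)]
  have fe: "f \<cdot> eps X \<in> homs C (om_ob X) Y" using e assms by (simp add: homs_def)
  obtain g where g: "g \<in> homs C (om_ob X) (om_ob Y)" "eps Y \<cdot> g = f \<cdot> eps X"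
    using corefl_factor[OF coreflection_corefl[OF O(2)] fe om_U[OF O(1)]] .
  have eg: "eps Y \<cdot> g \<simeq> f \<cdot> eps X" using g eqv_refl fe by simp
  have "far om (cls f) = (THE G. G \<in> homs (quot C \<U> \<I>) (om_ob X) (om_ob Y) \<and>
        cls (eps Y) \<cdot>\<^bsub>quot C (Obj C) \<I>\<^esub> G = cls f \<cdot>\<^bsub>quot C (Obj C) \<I>\<^esub> cls (eps X))"
    by (simp add: omega_def Let_def quot_ends[OF assms] counit_def)
  also have "\<dots> = cls g"
  proof (rule the_equality)
    show "cls g \<in> homs (quot C \<U> \<I>) (om_ob X) (om_ob Y) \<and>
        cls (eps Y) \<cdot>\<^bsub>quot C (Obj C) \<I>\<^esub> cls g = cls f \<cdot>\<^bsub>quot C (Obj C) \<I>\<^esub> cls (eps X)"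
      using quot_homs om_U O g quot_cmp[OF g(1) e(2)] quot_cmp[OF e(1) assms] by auto
    fix G assume G: "G \<in> homs (quot C \<U> \<I>) (om_ob X) (om_ob Y) \<and>
        cls (eps Y) \<cdot>\<^bsub>quot C (Obj C) \<I>\<^esub> G = cls f \<cdot>\<^bsub>quot C (Obj C) \<I>\<^esub> cls (eps X)"
    then obtain g' where g': "g' \<in> homs C (om_ob X) (om_ob Y)" "G = cls g'"
      unfolding quot_homs[OF om_U[OF O(1)] om_U[OF O(2)]] by blast
    have "cls (eps Y \<cdot> g') = cls (f \<cdot> eps X)"
      using G g' quot_cmp[OF g'(1) e(2)] quot_cmp[OF e(1) assms] by simp
    then have "eps Y \<cdot> g' \<simeq> eps Y \<cdot> g" using cls_iff[OF cmp_hom[OF g'(1) e(2)] fe] g by simp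
    then have "g' \<simeq> g" using corefl_cancel[OF coreflection_corefl[OF O(2)] g'(1) g(1)] om_U O by blast
    then show "G = cls g" using g' g cls_iff by blast
  qed
  finally show ?thesis using that g eg by blast
qed

lemma far_si:
  assumes "f \<in> homs C X Y"
  obtains g where "g \<in> homs C (si_ob X) (si_ob Y)" "g \<cdot> eta X \<simeq> eta Y \<cdot> f" "far si (cls f) = cls g"
proof -
  have O: "X \<in> Obj C" "Y \<in> Obj C" using assms homs_obj by blast+
  note e = eta_hom[OF O(1)] eta_hom[OF O(2)]
  have fe: "eta Y \<cdot> f \<in> homs C X (si_ob Y)" using e assms by (simp add: homs_def)
  obtain g where g: "g \<in> homs C (si_ob X) (si_ob Y)" "g \<cdot> eta X = eta Y \<cdot> f"
    using refl_factor[OF reflection_refl[OF O(1)] fe si_T[OF O(2)]] .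
  have eg: "g \<cdot> eta X \<simeq> eta Y \<cdot> f" using g eqv_refl fe by simp
  have "far si (cls f) = (THE G. G \<in> homs (quot C \<T> \<I>) (si_ob X) (si_ob Y) \<and>
        G \<cdot>\<^bsub>quot C (Obj C) \<I>\<^esub> cls (eta X) = cls (eta Y) \<cdot>\<^bsub>quot C (Obj C) \<I>\<^esub> cls f)"
    by (simp add: sigma_def Let_def quot_ends[OF assms] unit_def)
  also have "\<dots> = cls g"
  proof (rule the_equality)
    show "cls g \<in> homs (quot C \<T> \<I>) (si_ob X) (si_ob Y) \<and>
        cls g \<cdot>\<^bsub>quot C (Obj C) \<I>\<^esub> cls (eta X) = cls (eta Y) \<cdot>\<^bsub>quot C (Obj C) \<I>\<^esub> cls f"
      using quot_homs si_T O g quot_cmp[OF e(1) g(1)] quot_cmp[OF assms e(2)] by auto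
    fix G assume G: "G \<in> homs (quot C \<T> \<I>) (si_ob X) (si_ob Y) \<and>
        G \<cdot>\<^bsub>quot C (Obj C) \<I>\<^esub> cls (eta X) = cls (eta Y) \<cdot>\<^bsub>quot C (Obj C) \<I>\<^esub> cls f"
    then obtain g' where g': "g' \<in> homs C (si_ob X) (si_ob Y)" "G = cls g'"
      unfolding quot_homs[OF si_T[OF O(1)] si_T[OF O(2)]] by blast
    have "cls (g' \<cdot> eta X) = cls (eta Y \<cdot> f)"
      using G g' quot_cmp[OF e(1) g'(1)] quot_cmp[OF assms e(2)] by simp
    then have "g' \<cdot> eta X \<simeq> g \<cdot> eta X" using cls_iff[OF cmp_hom[OF e(1) g'(1)] fe] g by simp
    then have "g' \<simeq> g" using refl_cancel[OF reflection_refl[OF O(1)] g'(1) g(1)] si_T O by blast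
    then show "G = cls g" using g' g cls_iff by blast
  qed
  finally show ?thesis using that g eg by blast
qed

text \<open>
  Representatives of the components of \<open>mu\<close>.
\<close>

definition comparison :: "'a \<Rightarrow> 'b \<Rightarrow> bool" where
  "comparison X m \<longleftrightarrow> m \<in> homs C (si_ob (om_ob X)) (om_ob (si_ob X)) \<and>
     (eps (si_ob X) \<cdot> m) \<cdot> eta (om_ob X) \<simeq> eta X \<cdot> eps X"

lemma ex_comparison: assumes "X \<in> Obj C" shows "\<exists>m. comparison X m"
proof -
  note O = assms om_obj[OF assms] si_obj[OF assms]
  have h: "eta X \<cdot> eps X \<in> homs C (om_ob X) (si_ob X)"
    using eta_hom[OF O(1)] eps_hom[OF O(1)] cmp_hom by blast
  obtain k where k: "k \<in> homs C (si_ob (om_ob X)) (si_ob X)" "k \<cdot> eta (om_ob X) = eta X \<cdot> eps X"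
    using refl_factor[OF reflection_refl[OF O(2)] h si_T[OF O(1)]] .
  have "si_ob (om_ob X) \<in> \<U>" using refl_in_U[OF reflection_refl[OF O(2)] om_U[OF O(1)]] .
  then obtain m where "m \<in> homs C (si_ob (om_ob X)) (om_ob (si_ob X))" "eps (si_ob X) \<cdot> m = k"
    using corefl_factor[OF coreflection_corefl[OF O(3)] k(1)] by blast
  then show ?thesis unfolding comparison_def using k eqv_refl h by metis
qed

lemma comparison_cancel:
  assumes "X \<in> \<U>" "Y \<in> \<T>" "m \<in> homs C (si_ob X) (om_ob Y)" "m' \<in> homs C (si_ob X) (om_ob Y)"
    "(eps Y \<cdot> m) \<cdot> eta X \<simeq> (eps Y \<cdot> m') \<cdot> eta X"
  shows "m \<simeq> m'"
proof -
  have O: "X \<in> Obj C" "Y \<in> Obj C" using assms U_obj T_obj by blast+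
  have "eps Y \<cdot> m \<in> homs C (si_ob X) Y" "eps Y \<cdot> m' \<in> homs C (si_ob X) Y"
    using eps_hom[OF O(2)] assms cmp_hom by blast+
  then have "eps Y \<cdot> m \<simeq> eps Y \<cdot> m'"
    using refl_cancel[OF reflection_refl[OF O(1)]] assms by blast
  then show ?thesis
    using corefl_cancel[OF coreflection_corefl[OF O(2)] assms(3,4)]
      refl_in_U[OF reflection_refl[OF O(1)] assms(1)] by blast
qed

text \<open>
  By \<open>comparison_cancel\<close> it suffices to compare the two sides between the unit at \<open>om_ob X\<close> and the counit at
  \<open>si_ob Y\<close>; there both become \<open>eta Y \<cdot> f \<cdot> eps X\<close> modulo \<open>\<I>\<close>.
\<close>

lemma comparison_natural:
  assumes f: "f \<in> homs C X Y" and mX: "comparison X mX" and mY: "comparison Y mY"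
    and a: "a \<in> homs C (om_ob X) (om_ob Y)" "eps Y \<cdot> a \<simeq> f \<cdot> eps X"
    and a': "a' \<in> homs C (si_ob (om_ob X)) (si_ob (om_ob Y))"
      "a' \<cdot> eta (om_ob X) \<simeq> eta (om_ob Y) \<cdot> a"
    and b: "b \<in> homs C (si_ob X) (si_ob Y)" "b \<cdot> eta X \<simeq> eta Y \<cdot> f"
    and b': "b' \<in> homs C (om_ob (si_ob X)) (om_ob (si_ob Y))"
      "eps (si_ob Y) \<cdot> b' \<simeq> b \<cdot> eps (si_ob X)"
  shows "mY \<cdot> a' \<simeq> b' \<cdot> mX"
proof -
  have O: "X \<in> Obj C" "Y \<in> Obj C" using f homs_obj by blast+
  note h = f a(1) a'(1) b(1) b'(1) eps_hom[OF O(1)] eps_hom[OF O(2)] eta_hom[OF O(1)] eta_hom[OF O(2)]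
    eps_hom[OF si_obj[OF O(1)]] eps_hom[OF si_obj[OF O(2)]]
    eta_hom[OF om_obj[OF O(1)]] eta_hom[OF om_obj[OF O(2)]]
  have m: "mX \<in> homs C (si_ob (om_ob X)) (om_ob (si_ob X))"
      "mY \<in> homs C (si_ob (om_ob Y)) (om_ob (si_ob Y))"
    using mX mY by (auto simp: comparison_def)
  let ?eX = "eps (si_ob X)" and ?eY = "eps (si_ob Y)"
  let ?nX = "eta (om_ob X)" and ?nY = "eta (om_ob Y)"
  have "(?eY \<cdot> (mY \<cdot> a')) \<cdot> ?nX = (?eY \<cdot> mY) \<cdot> (a' \<cdot> ?nX)" using h m by (simp add: homs_def)
  also have "\<dots> \<simeq> (?eY \<cdot> mY) \<cdot> (?nY \<cdot> a)"
    using eqv_cmp_left[OF a'(2)] cmp_hom h m by metis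
  also have "(?eY \<cdot> mY) \<cdot> (?nY \<cdot> a) = ((?eY \<cdot> mY) \<cdot> ?nY) \<cdot> a" using h m by (simp add: homs_def)
  also have "\<dots> \<simeq> (eta Y \<cdot> eps Y) \<cdot> a"
    by (rule eqv_cmp_right[of _ _ _ "om_ob X" "om_ob Y" "si_ob Y"])
      (use mY h m in \<open>auto simp: comparison_def homs_def\<close>)
  also have "(eta Y \<cdot> eps Y) \<cdot> a = eta Y \<cdot> (eps Y \<cdot> a)" using h m by (simp add: homs_def)
  also have "\<dots> \<simeq> eta Y \<cdot> (f \<cdot> eps X)"
    using eqv_cmp_left[OF a(2)] cmp_hom h by metis
  also have "eta Y \<cdot> (f \<cdot> eps X) = (eta Y \<cdot> f) \<cdot> eps X" using h m by (simp add: homs_def)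
  also have "\<dots> \<simeq> (b \<cdot> eta X) \<cdot> eps X"
    using eqv_cmp_right[OF eqv_sym[OF b(2)]] cmp_hom h by metis
  also have "(b \<cdot> eta X) \<cdot> eps X = b \<cdot> (eta X \<cdot> eps X)" using h m by (simp add: homs_def)
  also have "\<dots> \<simeq> b \<cdot> ((?eX \<cdot> mX) \<cdot> ?nX)"
    by (rule eqv_cmp_left[of _ _ "om_ob X" "si_ob X" _ "si_ob Y"])
      (use mX h m in \<open>auto simp: comparison_def homs_def eqv_sym\<close>)
  also have "b \<cdot> ((?eX \<cdot> mX) \<cdot> ?nX) = (b \<cdot> ?eX) \<cdot> (mX \<cdot> ?nX)" using h m by (simp add: homs_def)
  also have "\<dots> \<simeq> (?eY \<cdot> b') \<cdot> (mX \<cdot> ?nX)"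
    using eqv_cmp_right[OF eqv_sym[OF b'(2)]] cmp_hom h m by metis
  also have "(?eY \<cdot> b') \<cdot> (mX \<cdot> ?nX) = (?eY \<cdot> (b' \<cdot> mX)) \<cdot> ?nX" using h m by (simp add: homs_def)
  finally show ?thesis
    using comparison_cancel[OF om_U[OF O(1)] si_T[OF O(2)]] cmp_hom h m by metis
qed

text \<open>
  The definite description defining \<open>mu\<close> has a value: comparison morphisms exist, form a natural
  transformation, and their classes are the only solution of the defining equation. So \<open>mu\<close> may be replaced by
  comparison morphisms from here on.
\<close>

lemma mu_comparison:
  assumes "X \<in> Obj C"
  obtains m where "comparison X m" "mu C \<S> \<T> \<U> \<V> X = cls m"
proof -
  let ?Q = "quot C (Obj C) \<I>" and ?Z = "quot C (\<T> \<inter> \<U>) \<I>"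
  define P where "P = (\<lambda>\<mu>. \<mu> \<in> extensional (Obj C) \<and>
       nat_trans ?Q ?Z (ftor_comp si om) (ftor_comp om si) \<mu> \<and>
       (\<forall>X \<in> Obj C.
          counit C \<I> \<U> \<V> (fob si X) \<cdot>\<^bsub>?Q\<^esub> \<mu> X \<cdot>\<^bsub>?Q\<^esub> unit C \<I> \<S> \<T> (fob om X) =
          unit C \<I> \<S> \<T> X \<cdot>\<^bsub>?Q\<^esub> counit C \<I> \<U> \<V> X))"
  have mu: "mu C \<S> \<T> \<U> \<V> = The P" unfolding mu_def Let_def P_def ..
  have ends: "si_ob (om_ob X) \<in> \<T> \<inter> \<U>" "om_ob (si_ob X) \<in> \<T> \<inter> \<U>" if "X \<in> Obj C" for X
    using that om_obj si_obj om_U si_T refl_in_U[OF reflection_refl] corefl_in_T[OF coreflection_corefl]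
    by blast+
  have eq: "cls (eps (si_ob X)) \<cdot>\<^bsub>?Q\<^esub> cls m \<cdot>\<^bsub>?Q\<^esub> cls (eta (om_ob X)) = cls ((eps (si_ob X) \<cdot> m) \<cdot> eta (om_ob X))"
    "cls (eta X) \<cdot>\<^bsub>?Q\<^esub> cls (eps X) = cls (eta X \<cdot> eps X)"
    "(eps (si_ob X) \<cdot> m) \<cdot> eta (om_ob X) \<in> homs C (om_ob X) (si_ob X)"
    "eta X \<cdot> eps X \<in> homs C (om_ob X) (si_ob X)"
    if X: "X \<in> Obj C" and m: "m \<in> homs C (si_ob (om_ob X)) (om_ob (si_ob X))" for X m
  proof -
    note h = eps_hom[OF X] eta_hom[OF X] eps_hom[OF si_obj[OF X]] eta_hom[OF om_obj[OF X]]
    show "cls (eps (si_ob X)) \<cdot>\<^bsub>?Q\<^esub> cls m \<cdot>\<^bsub>?Q\<^esub> cls (eta (om_ob X)) = cls ((eps (si_ob X) \<cdot> m) \<cdot> eta (om_ob X))"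
      using quot_cmp[OF m h(3)] quot_cmp[OF h(4) cmp_hom[OF m h(3)]] by simp
    show "cls (eta X) \<cdot>\<^bsub>?Q\<^esub> cls (eps X) = cls (eta X \<cdot> eps X)" using quot_cmp[OF h(1,2)] .
    show "(eps (si_ob X) \<cdot> m) \<cdot> eta (om_ob X) \<in> homs C (om_ob X) (si_ob X)"
      "eta X \<cdot> eps X \<in> homs C (om_ob X) (si_ob X)" using h m cmp_hom by blast+
  qed
  have char: "\<exists>m. comparison X m \<and> \<mu> X = cls m" if P\<mu>: "P \<mu>" "X \<in> Obj C" for \<mu> X
  proof -
    have "\<mu> X \<in> homs ?Z (si_ob (om_ob X)) (om_ob (si_ob X))"
      using that unfolding P_def nat_trans_def by (simp add: ftor_comp_def fob_om fob_si quot_def)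
    then obtain m where m: "m \<in> homs C (si_ob (om_ob X)) (om_ob (si_ob X))" "\<mu> X = cls m"
      unfolding quot_homs[OF ends[OF P\<mu>(2)]] by blast
    have "cls (eps (si_ob X)) \<cdot>\<^bsub>?Q\<^esub> cls m \<cdot>\<^bsub>?Q\<^esub> cls (eta (om_ob X)) = cls (eta X) \<cdot>\<^bsub>?Q\<^esub> cls (eps X)"
      unfolding m(2)[symmetric] using P\<mu> unfolding P_def fob_om fob_si counit_def unit_def by blast
    then have "cls ((eps (si_ob X) \<cdot> m) \<cdot> eta (om_ob X)) = cls (eta X \<cdot> eps X)"
      using eq[OF that(2) m(1)] by simp
    then have "comparison X m"
      unfolding comparison_def using eq(3,4)[OF that(2) m(1)] cls_iff m(1) by blast
    then show ?thesis using m by blast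
  qed
  define \<nu> where "\<nu> = (\<lambda>X. if X \<in> Obj C then cls (SOME m. comparison X m) else undefined)"
  have \<nu>: "\<exists>m. comparison X m \<and> \<nu> X = cls m" if "X \<in> Obj C" for X
    using someI_ex[OF ex_comparison[OF that]] that unfolding \<nu>_def by auto
  have "P \<nu>"
    unfolding P_def nat_trans_def
  proof (intro conjI ballI)
    show "\<nu> \<in> extensional (Obj C)" by (simp add: \<nu>_def extensional_def)
  next
    fix X assume "X \<in> Obj ?Q"
    then have X: "X \<in> Obj C" by (simp add: quot_def)
    obtain m where "comparison X m" "\<nu> X = cls m" using \<nu>[OF X] by blast
    then show "\<nu> X \<in> homs ?Z (fob (ftor_comp si om) X) (fob (ftor_comp om si) X)"
      using quot_homs[OF ends[OF X]] by (simp add: ftor_comp_def fob_om fob_si comparison_def)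
  next
    fix F assume "F \<in> Arr ?Q"
    then obtain f where f: "f \<in> Arr C" "F = cls f" by (auto simp: quot_def)
    define X Y where XY: "X = dm C f" "Y = cd C f"
    have f': "f \<in> homs C X Y" using f XY by (simp add: homs_def)
    have O: "X \<in> Obj C" "Y \<in> Obj C" using f' homs_obj by blast+
    obtain mX where mX: "comparison X mX" "\<nu> X = cls mX" using \<nu>[OF O(1)] by blast
    obtain mY where mY: "comparison Y mY" "\<nu> Y = cls mY" using \<nu>[OF O(2)] by blast
    obtain a where a: "a \<in> homs C (om_ob X) (om_ob Y)" "eps Y \<cdot> a \<simeq> f \<cdot> eps X" "far om (cls f) = cls a"
      using far_om[OF f'] .
    obtain a' where a': "a' \<in> homs C (si_ob (om_ob X)) (si_ob (om_ob Y))"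
        "a' \<cdot> eta (om_ob X) \<simeq> eta (om_ob Y) \<cdot> a" "far si (cls a) = cls a'"
      using far_si[OF a(1)] .
    obtain b where b: "b \<in> homs C (si_ob X) (si_ob Y)" "b \<cdot> eta X \<simeq> eta Y \<cdot> f" "far si (cls f) = cls b"
      using far_si[OF f'] .
    obtain b' where b': "b' \<in> homs C (om_ob (si_ob X)) (om_ob (si_ob Y))"
        "eps (si_ob Y) \<cdot> b' \<simeq> b \<cdot> eps (si_ob X)" "far om (cls b) = cls b'"
      using far_om[OF b(1)] .
    have m: "mX \<in> homs C (si_ob (om_ob X)) (om_ob (si_ob X))"
      "mY \<in> homs C (si_ob (om_ob Y)) (om_ob (si_ob Y))"
      using mX mY by (auto simp: comparison_def)
    have "cls (mY \<cdot> a') = cls (b' \<cdot> mX)"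
      using comparison_natural[OF f' mX(1) mY(1) a(1,2) a'(1,2) b(1,2) b'(1,2)]
        cls_iff[OF cmp_hom[OF a'(1) m(2)] cmp_hom[OF m(1) b'(1)]] by simp
    then show "\<nu> (cd ?Q F) \<cdot>\<^bsub>?Z\<^esub> far (ftor_comp si om) F = far (ftor_comp om si) F \<cdot>\<^bsub>?Z\<^esub> \<nu> (dm ?Q F)"
      using a(3) a'(3) b(3) b'(3) mX(2) mY(2) quot_cmp[OF a'(1) m(2)] quot_cmp[OF m(1) b'(1)]
      by (simp add: f(2) quot_ends[OF f'] ftor_comp_def)
  next
    fix X assume X: "X \<in> Obj C"
    obtain m where m: "comparison X m" "\<nu> X = cls m" using \<nu>[OF X] by blast
    have "cls ((eps (si_ob X) \<cdot> m) \<cdot> eta (om_ob X)) = cls (eta X \<cdot> eps X)"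
      using m(1) eq(3,4)[OF X] cls_iff unfolding comparison_def by blast
    moreover have "m \<in> homs C (si_ob (om_ob X)) (om_ob (si_ob X))" using m(1) comparison_def by blast
    ultimately show "counit C \<I> \<U> \<V> (fob si X) \<cdot>\<^bsub>?Q\<^esub> \<nu> X \<cdot>\<^bsub>?Q\<^esub> unit C \<I> \<S> \<T> (fob om X) =
          unit C \<I> \<S> \<T> X \<cdot>\<^bsub>?Q\<^esub> counit C \<I> \<U> \<V> X"
      using eq(1,2)[OF X] m(2) by (simp add: fob_om fob_si counit_def unit_def)
  qed
  moreover have "\<mu> = \<nu>" if \<mu>: "P \<mu>" for \<mu>
  proof (rule extensionalityI[of _ "Obj C"])
    show "\<mu> \<in> extensional (Obj C)" "\<nu> \<in> extensional (Obj C)" using \<mu> \<open>P \<nu>\<close> by (auto simp: P_def)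
    fix X assume X: "X \<in> Obj C"
    obtain m where m: "comparison X m" "\<mu> X = cls m" using char \<mu> X by blast
    obtain m' where m': "comparison X m'" "\<nu> X = cls m'" using \<nu>[OF X] by blast
    have h: "m \<in> homs C (si_ob (om_ob X)) (om_ob (si_ob X))" "m' \<in> homs C (si_ob (om_ob X)) (om_ob (si_ob X))"
      using m m' by (auto simp: comparison_def)
    have "(eps (si_ob X) \<cdot> m) \<cdot> eta (om_ob X) \<simeq> (eps (si_ob X) \<cdot> m') \<cdot> eta (om_ob X)"
      using m(1) m'(1) eqv_trans[OF _ eqv_sym] unfolding comparison_def by blast
    then have "m \<simeq> m'" using comparison_cancel[OF om_U[OF X] si_T[OF X] h] by blast
    then show "\<mu> X = \<nu> X" using m(2) m'(2) cls_iff[OF h] by simp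
  qed
  ultimately have "mu C \<S> \<T> \<U> \<V> = \<nu>" unfolding mu by (rule the_equality)
  then show ?thesis using \<nu>[OF assms] that by auto
qed

lemma condition_I_comparison:
  assumes "condition_I C \<S> \<T> \<U> \<V>" "triangle_on C T X U f g h" "T \<in> \<T>" "U \<in> \<U>"
  obtains m m' where "comparison X m" "m' \<in> homs C (om_ob (si_ob X)) (si_ob (om_ob X))"
    "m' \<cdot> m \<simeq> ident C (si_ob (om_ob X))" "m \<cdot> m' \<simeq> ident C (om_ob (si_ob X))"
proof -
  have X: "X \<in> Obj C" using triangleE[OF assms(2)] by blast
  then have "X \<in> star C \<T> \<U>" using assms unfolding star_def by blast
  moreover obtain m where m: "comparison X m" "mu C \<S> \<T> \<U> \<V> X = cls m" using mu_comparison[OF X] .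
  ultimately have i: "is_iso (quot C (\<T> \<inter> \<U>) \<I>) (cls m)" using assms(1) unfolding condition_I_def by metis
  have e: "si_ob (om_ob X) \<in> \<T> \<inter> \<U>" "om_ob (si_ob X) \<in> \<T> \<inter> \<U>"
    using X om_obj si_obj om_U si_T refl_in_U[OF reflection_refl] corefl_in_T[OF coreflection_corefl]
    by blast+
  have "m \<in> homs C (si_ob (om_ob X)) (om_ob (si_ob X))" using m by (simp add: comparison_def)
  then show ?thesis using quot_isoE[OF i _ e] that m by blast
qed

end

section \<open>Consequences of the two conditions\<close>

context concentric_tcp
begin

lemma core_retract:
  assumes "m \<in> homs C X Y" "m' \<in> homs C Y X" "m \<cdot> m' \<simeq> ident C Y" "X \<in> \<I>"
  shows "Y \<in> \<I>"
proof -
  have "null (m \<cdot> m')" using nullI assms by blast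
  then have "null (ident C Y)" using eqv_null eqv_sym assms(3) by blast
  then show ?thesis using core_if_null_ident homs_obj assms(1) by blast
qed

lemma refl_inverse:
  assumes "is_refl X T t" "is_refl X T' t'"
  obtains n n' where "n \<in> homs C T T'" "n' \<in> homs C T' T" "n \<cdot> t = t'" "n' \<cdot> t' = t"
    "n' \<cdot> n \<simeq> ident C T" "n \<cdot> n' \<simeq> ident C T'"
proof -
  have t: "t \<in> homs C X T" "T \<in> \<T>" "t' \<in> homs C X T'" "T' \<in> \<T>" using refl_homs assms by blast+
  have O: "T \<in> Obj C" "T' \<in> Obj C" using t homs_obj by blast+
  obtain n where n: "n \<in> homs C T T'" "n \<cdot> t = t'" using refl_factor[OF assms(1) t(3,4)] .
  obtain n' where n': "n' \<in> homs C T' T" "n' \<cdot> t' = t" using refl_factor[OF assms(2) t(1,2)] .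
  have "(n' \<cdot> n) \<cdot> t = n' \<cdot> (n \<cdot> t)" "(n \<cdot> n') \<cdot> t' = n \<cdot> (n' \<cdot> t')"
    using n(1) n'(1) t by (simp_all add: homs_def)
  then have "(n' \<cdot> n) \<cdot> t = ident C T \<cdot> t" "(n \<cdot> n') \<cdot> t' = ident C T' \<cdot> t'"
    unfolding n(2) n'(2) using t n n' O by (simp_all add: homs_def)
  moreover have "ident C T \<cdot> t \<simeq> ident C T \<cdot> t" "ident C T' \<cdot> t' \<simeq> ident C T' \<cdot> t'"
    using eqv_refl cmp_hom ident_hom O t by blast+
  ultimately have "n' \<cdot> n \<simeq> ident C T" "n \<cdot> n' \<simeq> ident C T'"
    using refl_cancel[OF assms(1) cmp_hom[OF n(1) n'(1)] ident_hom[OF O(1)] t(2)]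
      refl_cancel[OF assms(2) cmp_hom[OF n'(1) n(1)] ident_hom[OF O(2)] t(4)] by simp_all
  then show ?thesis using that n n' by blast
qed

lemma refl_core: "is_refl X T t \<Longrightarrow> is_refl X T' t' \<Longrightarrow> T \<in> \<I> \<Longrightarrow> T' \<in> \<I>"
  using refl_inverse core_retract by metis

lemma corefl_core:
  assumes "is_corefl X U u" "is_corefl X U' u'" "U \<in> \<I>" shows "U' \<in> \<I>"
proof -
  have u: "u \<in> homs C U X" "U \<in> \<U>" "u' \<in> homs C U' X" "U' \<in> \<U>" using corefl_homs assms by blast+
  have O: "U' \<in> Obj C" using u homs_obj by blast
  obtain n where n: "n \<in> homs C U U'" "u' \<cdot> n = u" using corefl_factor[OF assms(2) u(1,2)] .
  obtain n' where n': "n' \<in> homs C U' U" "u \<cdot> n' = u'" using corefl_factor[OF assms(1) u(3,4)] .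
  have "u' \<cdot> (n \<cdot> n') = (u' \<cdot> n) \<cdot> n'" using n(1) n'(1) u by (simp add: homs_def)
  then have "u' \<cdot> (n \<cdot> n') = u' \<cdot> ident C U'" unfolding n(2) n'(2) using u by (simp add: homs_def)
  moreover have "u' \<cdot> ident C U' \<simeq> u' \<cdot> ident C U'" using eqv_refl cmp_hom ident_hom O u by blast
  ultimately have "n \<cdot> n' \<simeq> ident C U'"
    using corefl_cancel[OF assms(2) cmp_hom[OF n'(1) n(1)] ident_hom[OF O] u(4)] by simp
  then show ?thesis using core_retract n n' assms(3) by blast
qed

lemma refl_of_core:
  assumes "X \<in> \<I>" "is_refl X T t" shows "T \<in> \<I>"
proof -
  have t: "t \<in> homs C X T" "T \<in> \<T>" using refl_homs assms by blast+
  have O: "X \<in> Obj C" "T \<in> Obj C" using t homs_obj by blast+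
  have "null (t \<cdot> ident C X)" using nullI[OF assms(1) ident_hom[OF O(1)] t(1)] .
  then have "null (ident C T \<cdot> t)" using t by (simp add: homs_def)
  then show ?thesis using refl_null[OF assms(2) ident_hom[OF O(2)] t(2)] core_if_null_ident O by blast
qed

lemma corefl_of_core:
  assumes "X \<in> \<I>" "is_corefl X U u" shows "U \<in> \<I>"
proof -
  have u: "u \<in> homs C U X" "U \<in> \<U>" using corefl_homs assms by blast+
  have O: "X \<in> Obj C" "U \<in> Obj C" using u homs_obj by blast+
  have "null (ident C X \<cdot> u)" using nullI[OF assms(1) u(1) ident_hom[OF O(1)]] .
  then have "null (u \<cdot> ident C U)" using u by (simp add: homs_def)
  then show ?thesis using corefl_null[OF assms(2) ident_hom[OF O(2)] u(2)] core_if_null_ident O by blast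
qed

text \<open>
  By the octahedral axiom the fibre of \<open>b \<cdot> u\<close> is an extension of two objects of \<open>\<V>\<close>. The
  extension is only available after one shift, so membership in \<open>\<V>\<close> is checked by orthogonality.
\<close>

lemma corefl_comp:
  assumes "triangle_on C V B Y v b h" "V \<in> \<V>" "is_corefl B U u"
  shows "is_corefl Y U (b \<cdot> u)"
proof -
  obtain V' v' h' where u: "V' \<in> \<V>" "triangle_on C V' U B v' u h'" "U \<in> \<U>"
    using assms(3) is_corefl_def by metis
  note t = triangleE[OF assms(1)] and tu = triangleE[OF u(2)]
  have bu: "b \<cdot> u \<in> homs C U Y" using t tu cmp_hom by blast
  obtain V'' x y where V'': "triangle_on C V'' U Y x (b \<cdot> u) y" using ex_fibre[OF bu] .
  note tV = triangleE[OF V'']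
  obtain p q where pq: "p \<in> homs C (sho C V') (sho C V'')" "q \<in> homs C (sho C V'') (sho C V)"
      "(p, q, sha C h' \<cdot> neg C (sha C v)) \<in> dist C"
    using octahedron[OF triangle_rotate[OF u(2)] triangle_rotate[OF assms(1)] triangle_rotate[OF V'']]
    by blast
  have "sha C h' \<cdot> neg C (sha C v) \<in> homs C (sho C V) (sho C (sho C V'))"
    using t tu by (simp add: homs_def)
  then have tri: "triangle_on C (sho C V') (sho C V'') (sho C V) p q (sha C h' \<cdot> neg C (sha C v))"
    using pq by (simp add: triangle_on_def)
  have "orth W V''" if W: "W \<in> \<U>" for W
  proof (rule orthI)
    show "W \<in> Obj C" "V'' \<in> Obj C" using W U_obj tV by auto
    fix f assume f: "f \<in> homs C W (sho C V'')"
    have "q \<cdot> f = zerom C W (sho C V)" using orthD U_V W assms(2) cmp_hom[OF f pq(2)] by blast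
    then obtain g where g: "g \<in> homs C W (sho C V')" "p \<cdot> g = f" using factor_in[OF tri f] by blast
    then have "g = zerom C W (sho C V')" using orthD U_V W u(1) by blast
    then show "f = zerom C W (sho C V'')" using g pq W U_obj by (auto simp: homs_def)
  qed
  then have "V'' \<in> \<V>" using right_mem_iff[OF UV] tV by blast
  then show ?thesis unfolding is_corefl_def using u(3) V'' by blast
qed

end

locale mutation_tcp = concentric_tcp +
  assumes cond_I: "condition_I C \<S> \<T> \<U> \<V>"
    and cond_II: "condition_II C \<S> \<T> \<U> \<V>"
begin

text \<open>
  If \<open>\<omega>E\<close> vanishes in the quotient, so does \<open>\<sigma>\<omega>E\<close>, hence \<open>\<omega>\<sigma>E\<close> by condition (I). Then \<open>\<sigma>E\<close> is
  an object of \<open>\<T>\<close> whose coreflection lies in \<open>\<I> \<subseteq> \<S>\<close>, so that it lies in \<open>\<T> \<inter> (\<S> * \<V>[1]) = \<V>\<close> by condition (II).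
\<close>

lemma refl_in_V:
  assumes "triangle_on C T E U a b d" "T \<in> \<T>" "U \<in> \<U>" "is_corefl E J j" "J \<in> \<I>"
  obtains W w where "is_refl E W w" "W \<in> \<V>"
proof -
  have O: "E \<in> Obj C" using triangleE[OF assms(1)] by blast
  obtain m m' where m: "comparison E m" "m' \<in> homs C (om_ob (si_ob E)) (si_ob (om_ob E))"
    "m \<cdot> m' \<simeq> ident C (om_ob (si_ob E))"
    using condition_I_comparison[OF cond_I assms(1-3)] by blast
  have "om_ob E \<in> \<I>" using corefl_core[OF assms(4) coreflection_corefl[OF O] assms(5)] .
  then have "si_ob (om_ob E) \<in> \<I>" using refl_of_core reflection_refl om_obj O by blast
  then have J: "om_ob (si_ob E) \<in> \<I>" using core_retract m unfolding comparison_def by blast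
  obtain V v h where "V \<in> \<V>" "triangle_on C V (om_ob (si_ob E)) (si_ob E) v (eps (si_ob E)) h"
    using coreflection_corefl[OF si_obj[OF O]] unfolding is_corefl_def by blast
  then have "si_ob E \<in> star C \<S> (shift_up C \<V>)" using J star_up_iff[OF V_obj] by blast
  then have "si_ob E \<in> \<V>" using cond_II si_T[OF O] unfolding condition_II_def by blast
  then show ?thesis using that reflection_refl[OF O] by blast
qed

text \<open>
  Dual to \<open>refl_in_V\<close>: here \<open>\<omega>E\<close> is an object of \<open>\<U>\<close> whose reflection lies in \<open>\<I> \<subseteq> \<V>\<close>.
\<close>

lemma corefl_in_S:
  assumes "triangle_on C T E U a b d" "T \<in> \<T>" "U \<in> \<U>" "is_refl E J j" "J \<in> \<I>"
  obtains S s where "is_corefl E S s" "S \<in> \<S>"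
proof -
  have O: "E \<in> Obj C" using triangleE[OF assms(1)] by blast
  obtain m m' where m: "comparison E m" "m' \<in> homs C (om_ob (si_ob E)) (si_ob (om_ob E))"
    "m' \<cdot> m \<simeq> ident C (si_ob (om_ob E))"
    using condition_I_comparison[OF cond_I assms(1-3)] by blast
  have "si_ob E \<in> \<I>" using refl_core[OF assms(4) reflection_refl[OF O] assms(5)] .
  then have "om_ob (si_ob E) \<in> \<I>" using corefl_of_core coreflection_corefl si_obj O by blast
  then have J: "si_ob (om_ob E) \<in> \<I>" using core_retract m unfolding comparison_def by blast
  then have J': "si_ob (om_ob E) \<in> \<V>" using core_mem by blast
  obtain S s h where "S \<in> \<S>" "triangle_on C (om_ob E) (si_ob (om_ob E)) S (eta (om_ob E)) s h"
    using reflection_refl[OF om_obj[OF O]] unfolding is_refl_def by blast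
  then have "om_ob E \<in> star C (shift_down C \<S>) \<V>" using J' star_down_iff[OF S_obj] by blast
  then have "om_ob E \<in> \<S>" using cond_II om_U[OF O] unfolding condition_II_def by blast
  then show ?thesis using that coreflection_corefl[OF O] by blast
qed

text \<open>
  The reflection \<open>\<sigma>\<close> is faithful on \<open>\<U>\<close> up to morphisms through \<open>\<S>\<close>. All morphisms \<open>f\<close> from \<open>\<U>\<close> with
  \<open>z \<cdot> f \<equiv> 0\<close> lift to one object \<open>E\<close>, the base change along \<open>z\<close> of a left approximation \<open>J \<rightarrow> Z\<close>, which absorbs every
  morphism from \<open>\<I>\<close> to \<open>Z\<close>. By \<open>base_change\<close> the object \<open>J \<in> \<I>\<close> is a reflection of \<open>E\<close>, so the coreflection of
  \<open>E\<close>, through which the lifts pass, lies in \<open>\<S>\<close>.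
\<close>

lemma null_after_refl:
  assumes "X \<in> \<U>" "Y \<in> \<U>" and z: "is_refl X Z z" and f: "f \<in> homs C Y X" and "null (z \<cdot> f)"
  obtains S a b where "S \<in> \<S>" "a \<in> homs C Y S" "b \<in> homs C S X" "f = b \<cdot> a"
proof -
  obtain S s r where t: "triangle_on C X Z S z s r" "S \<in> \<S>" "Z \<in> \<T>" using z is_refl_def by metis
  note tz = triangleE[OF t(1)]
  obtain J T1 j b c where J: "J \<in> \<S>" "T1 \<in> \<T>" "triangle_on C T1 J Z j b c"
    using left_approximation[OF ST tz(6)] .
  note tJ = triangleE[OF J(3)]
  have JT: "J \<in> \<T>" using right_extension[OF ST J(3,2) t(3)] .
  have cz: "c \<cdot> z \<in> homs C X (sho C T1)" using tJ tz cmp_hom by blast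
  obtain E a k where E: "triangle_on C T1 E X a k (c \<cdot> z)" using ex_extension[OF cz tJ(5)] .
  obtain t' u where "triangle_on C E J S t' (s \<cdot> b) u" using base_change[OF J(3) t(1) E] .
  then have "is_refl E J t'" unfolding is_refl_def using JT t(2) by blast
  then obtain S' g where g: "is_corefl E S' g" "S' \<in> \<S>"
    using corefl_in_S[OF E J(2) assms(1)] J(1) JT by blast
  have "z \<cdot> f \<in> homs C Y Z" using f tz cmp_hom by blast
  then obtain J' \<alpha> \<beta> where J': "J' \<in> \<I>" "\<alpha> \<in> homs C Y J'" "\<beta> \<in> homs C J' Z" "z \<cdot> f = \<beta> \<cdot> \<alpha>"
    using nullE[OF assms(5)] by metis
  have "c \<cdot> \<beta> \<in> homs C J' (sho C T1)" using tJ J' cmp_hom by blast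
  then have c\<beta>: "c \<cdot> \<beta> = zerom C J' (sho C T1)" using orthD S_T core_mem[OF J'(1)] J(2) by blast
  have "(c \<cdot> z) \<cdot> f = (c \<cdot> \<beta>) \<cdot> \<alpha>" using tJ tz f J' by (simp add: homs_def)
  then have "(c \<cdot> z) \<cdot> f = zerom C Y (sho C T1)" unfolding c\<beta> using J' tJ by (simp add: homs_def)
  then obtain f2 where f2: "f2 \<in> homs C Y E" "k \<cdot> f2 = f" using factor_in2[OF E f] by blast
  obtain f3 where f3: "f3 \<in> homs C Y S'" "g \<cdot> f3 = f2" using corefl_factor[OF g(1) f2(1) assms(2)] .
  note h = triangleE[OF E] corefl_homs[OF g(1)]
  have "f = (k \<cdot> g) \<cdot> f3" using f2 f3 h by (auto simp: homs_def)
  moreover have "k \<cdot> g \<in> homs C S' X" using h cmp_hom by blast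
  ultimately show ?thesis using that g(2) f3(1) by blast
qed

text \<open>
  Here \<open>Y\<^sub>0 = \<omega>Y\<close> and \<open>U\<^sub>0 = Y\<^sub>0\<langle>1\<rangle>\<close>, and \<open>P\<close> is a coreflection of \<open>Y[1]\<close>; it agrees with \<open>U\<^sub>0\<close> up to a cone in \<open>\<S>\<close>,
  and therefore has the same reflection in \<open>\<Z>/\<I>\<close>. To find \<open>P\<close>, push the extension \<open>Y\<^sub>0 \<rightarrow> J \<rightarrow> U\<^sub>0\<close> forward along \<open>e\<close>. The new
  middle term \<open>E\<close> lies in \<open>\<T> * \<U>\<close>, and \<open>J \<rightarrow> E\<close> has the same fibre \<open>V \<in> \<V>\<close> as \<open>e\<close>, so it is a
  coreflection of \<open>E\<close>. By \<open>refl_in_V\<close> some reflection \<open>E \<rightarrow> W\<close> has \<open>W \<in> \<V>\<close>, and \<open>P\<close> is the cone of \<open>Y \<rightarrow> E \<rightarrow> W\<close>.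
\<close>

lemma shifted_coreflection:
  assumes Y: "Y \<in> \<T>" "is_corefl Y Y0 e" and k: "triangle_on C Y0 J U0 i p k" "J \<in> \<I>" "U0 \<in> \<U>"
  obtains W P S w w' \<pi> a s r where "W \<in> \<V>" "triangle_on C Y W P w w' \<pi>"
    "P \<in> \<U>" "S \<in> \<S>" "triangle_on C U0 P S a s r"
proof -
  obtain V v h where V: "V \<in> \<V>" "triangle_on C V Y0 Y v e h" using Y is_corefl_def by metis
  note tV = triangleE[OF V(2)] and tk = triangleE[OF k(1)]
  have d: "neg C (sha C e) \<cdot> k \<in> homs C U0 (sho C Y)" using tV tk by (simp add: homs_def)
  obtain E a b where E: "triangle_on C Y E U0 a b (neg C (sha C e) \<cdot> k)"
    using ex_extension[OF d tV(7)] .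
  note tE = triangleE[OF E]
  obtain t u where "triangle_on C E (sho C V) (sho C J) t (neg C (sha C i) \<cdot> neg C (sha C v)) u"
    using base_change[OF triangle_rotate2[OF V(2)] triangle_rotate2[OF k(1)] E] .
  then obtain f g where "triangle_on C V J E f g t" using triangle_unrotate2 tV(5) tk(6) by metis
  then have "is_corefl E J g" unfolding is_corefl_def using V(1) core_mem[OF k(2)] by blast
  then obtain W w where W: "is_refl E W w" "W \<in> \<V>" using refl_in_V[OF E Y(1) k(3)] k(2) by blast
  then obtain S s r where S: "S \<in> \<S>" "triangle_on C E W S w s r" using is_refl_def by metis
  note tS = triangleE[OF S(2)]
  have wa: "w \<cdot> a \<in> homs C Y W" using tS tE cmp_hom by blast
  obtain P w' \<pi> where P: "triangle_on C Y W P (w \<cdot> a) w' \<pi>" using ex_cone[OF wa] .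
  obtain x y where xy: "x \<in> homs C U0 P" "y \<in> homs C P S" "(x, y, sha C b \<cdot> r) \<in> dist C"
    using octahedron[OF E S(2) P] by blast
  have "sha C b \<cdot> r \<in> homs C S (sho C U0)" using tS tE by (simp add: homs_def)
  then have x: "triangle_on C U0 P S x y (sha C b \<cdot> r)" using xy by (simp add: triangle_on_def)
  have "P \<in> \<U>" using left_extension[OF UV x k(3)] S(1) S_sub_U by blast
  then show ?thesis using that W(2) P S(1) x by blast
qed

text \<open>
  Only the weak universal property of a reflection is assumed of \<open>x0\<close>, so that composites \<open>X \<rightarrow> A \<rightarrow> \<sigma>A\<close> may
  be used as well.
\<close>

lemma orth_if_quotient_vanishes:
  assumes X: "X \<in> \<U>" and x0: "x0 \<in> homs C X X'"
    and ext: "\<And>T f. T \<in> \<T> \<Longrightarrow> f \<in> homs C X T \<Longrightarrow> \<exists>g \<in> homs C X' T. g \<cdot> x0 = f"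
    and Y: "Y \<in> \<T>" "is_corefl Y Y0 e" and k: "triangle_on C Y0 J U0 i p k" "J \<in> \<I>" "U0 \<in> \<U>"
    and z0: "is_refl U0 Z0 z0" and van: "\<And>g. g \<in> homs C X' Z0 \<Longrightarrow> null g"
  shows "orth X Y"
proof (rule orthI)
  show O: "X \<in> Obj C" "Y \<in> Obj C" using X Y U_obj T_obj by auto
  fix f assume f: "f \<in> homs C X (sho C Y)"
  obtain W P S w w' \<pi> a s r where P: "W \<in> \<V>" "triangle_on C Y W P w w' \<pi>"
    "P \<in> \<U>" "S \<in> \<S>" "triangle_on C U0 P S a s r"
    using shifted_coreflection[OF Y k] .
  note tP = triangleE[OF P(2)] and ta = triangleE[OF P(5)]
  have "sha C w \<cdot> f \<in> homs C X (sho C W)" using tP f by (simp add: homs_def)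
  then have "sha C w \<cdot> f = zerom C X (sho C W)" using orthD U_V X P(1) by blast
  then obtain f' where f': "f' \<in> homs C X P" "\<pi> \<cdot> f' = f" using factor_in3[OF P(2) f] by blast
  obtain Z1 z where z: "is_refl P Z1 z" using ex_refl tP by blast
  note hz = refl_homs[OF z] and hz0 = refl_homs[OF z0]
  have "sha C z0 \<cdot> r \<in> homs C S (sho C Z0)" using hz0 ta by (simp add: homs_def)
  then have "sha C z0 \<cdot> r = zerom C S (sho C Z0)" using orthD S_T P(4) hz0 by blast
  then obtain z0' where z0': "z0' \<in> homs C P Z0" "z0' \<cdot> a = z0" using factor_out0[OF P(5)] hz0 by blast
  obtain b where b: "b \<in> homs C Z1 Z0" "b \<cdot> z = z0'" using refl_factor[OF z z0'(1)] hz0 by blast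
  have za: "z \<cdot> a \<in> homs C U0 Z1" using hz ta cmp_hom by blast
  obtain b' where b': "b' \<in> homs C Z0 Z1" "b' \<cdot> z0 = z \<cdot> a" using refl_factor[OF z0 za] hz by blast
  have Z1: "Z1 \<in> Obj C" using hz homs_obj by blast
  \<comment> \<open>Modulo \<open>\<I>\<close>, the object \<open>Z1\<close> is a retract of the reflection \<open>Z0\<close> of \<open>U0\<close>: \<open>\<delta>\<close> vanishes on \<open>U0\<close>,
    hence passes through \<open>S\<close>.\<close>
  define \<delta> where "\<delta> = z \<ominus> b' \<cdot> (b \<cdot> z)"
  have \<delta>: "\<delta> \<in> homs C P Z1" unfolding \<delta>_def using hz b(1) b'(1) by (simp add: homs_def)
  have ba: "b' \<cdot> ((b \<cdot> z) \<cdot> a) = z \<cdot> a" unfolding b(2) z0'(2) b'(2) ..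
  have "\<delta> \<cdot> a = z \<cdot> a \<ominus> b' \<cdot> ((b \<cdot> z) \<cdot> a)" unfolding \<delta>_def using hz b(1) b'(1) ta by (simp add: homs_def)
  then have "\<delta> \<cdot> a = zerom C U0 Z1" unfolding ba using za by (simp add: homs_def)
  then obtain c where c: "c \<in> homs C S Z1" "c \<cdot> s = \<delta>" using factor_out[OF P(5) \<delta>] by blast
  have "null \<delta>" using null_cmp_right[OF S_to_T_null[OF c(1) P(4)] ta(2) c(1)] hz c by blast
  then have zb: "z \<simeq> b' \<cdot> (b \<cdot> z)" using eqvI[of z P Z1] hz b(1) b'(1) cmp_hom unfolding \<delta>_def by blast
  have zf: "z \<cdot> f' \<in> homs C X Z1" using hz f' cmp_hom by blast
  then obtain h where h: "h \<in> homs C X' Z1" "h \<cdot> x0 = z \<cdot> f'" using ext hz by blast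
  have "b \<cdot> h \<in> homs C X' Z0" using b h cmp_hom by blast
  then have n: "null ((b' \<cdot> (b \<cdot> h)) \<cdot> x0)"
    using null_cmp_right[OF null_cmp_left[OF van _ b'(1)] x0] b'(1) cmp_hom by blast
  have "(b' \<cdot> (b \<cdot> h)) \<cdot> x0 = b' \<cdot> (b \<cdot> (h \<cdot> x0))" using b b' h(1) x0 by (simp add: homs_def)
  also have "\<dots> = (b' \<cdot> (b \<cdot> z)) \<cdot> f'" unfolding h(2) using b(1) b'(1) hz f' by (simp add: homs_def)
  finally have "null ((b' \<cdot> (b \<cdot> z)) \<cdot> f')" using n by simp
  moreover have "z \<cdot> f' \<simeq> (b' \<cdot> (b \<cdot> z)) \<cdot> f'" using eqv_cmp_right[OF zb f'(1)] hz by blast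
  ultimately have "null (z \<cdot> f')" using eqv_null by blast
  then obtain S' \<alpha> \<beta> where S': "S' \<in> \<S>" "\<alpha> \<in> homs C X S'" "\<beta> \<in> homs C S' P" "f' = \<beta> \<cdot> \<alpha>"
    using null_after_refl[OF P(3) X z f'(1)] by blast
  have "\<pi> \<cdot> \<beta> \<in> homs C S' (sho C Y)" using tP S' cmp_hom by blast
  then have \<pi>\<beta>: "\<pi> \<cdot> \<beta> = zerom C S' (sho C Y)" using orthD S_T S'(1) Y(1) by blast
  have "f = (\<pi> \<cdot> \<beta>) \<cdot> \<alpha>" using f' S' tP by (auto simp: homs_def)
  then show "f = zerom C X (sho C Y)" unfolding \<pi>\<beta> using S' O by (simp add: homs_def)
qed

text \<open>
  The object \<open>F\<close> in the proof replaces a pullback of \<open>g\<close> and \<open>z\<close>; it is built in two steps. The morphism \<open>c\<close>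
  measures the failure of a morphism to \<open>Z\<close> to factor through \<open>J1 \<in> \<I>\<close>, so the extension \<open>D\<close> of \<open>X\<close> by \<open>T1\<close> along
  \<open>c \<cdot> g\<close> is the fibre of a morphism \<open>q: M \<rightarrow> Z\<close>, where \<open>M\<close> is an extension of \<open>X\<close> by \<open>J1\<close> and \<open>g\<close> factors through \<open>q\<close>. Base change of
  \<open>D \<rightarrow> M \<rightarrow> Z\<close> along \<open>z\<close> yields \<open>F\<close>, which is an extension of \<open>U \<in> \<U>\<close> by \<open>D \<in> \<T>\<close> and has \<open>M\<close> as reflection.
\<close>

lemma quotient_vanishes:
  assumes AB: "(\<A>, \<B>) \<in> cotorsion_pairs C" and sub: "\<S> \<subseteq> \<A>" "\<A> \<subseteq> \<U>" "\<B> \<subseteq> \<T>"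
    and mut: "\<U> \<inter> star C (shift_down C \<S>) \<A> \<subseteq> \<A>"
    and X: "X \<in> \<A>" "X \<in> \<T>" and Y: "Y \<in> \<B>"
    and \<kappa>: "triangle_on C Y J U i p \<kappa>" "J \<in> \<I>" "U \<in> \<U>"
    and z: "is_refl U Z z" and g: "g \<in> homs C X Z"
  shows "null g"
proof -
  obtain S s r where S: "triangle_on C U Z S z s r" "S \<in> \<S>" "Z \<in> \<T>" using z is_refl_def by metis
  note tz = triangleE[OF S(1)] and t\<kappa> = triangleE[OF \<kappa>(1)]
  obtain J1 T1 j b c where J1: "J1 \<in> \<S>" "T1 \<in> \<T>" "triangle_on C T1 J1 Z j b c"
    using left_approximation[OF ST tz(6)] .
  note tJ = triangleE[OF J1(3)]
  have cg: "c \<cdot> g \<in> homs C X (sho C T1)" using tJ g cmp_hom by blast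
  obtain D d e where D: "triangle_on C T1 D X d e (c \<cdot> g)" using ex_extension[OF cg tJ(5)] .
  note tD = triangleE[OF D]
  have DT: "D \<in> \<T>" using right_extension[OF ST D J1(2) X(2)] .
  \<comment> \<open>The sign makes \<open>l\<close> a composite of morphisms in the rotated triangles of \<open>d\<close> and \<open>c\<close>.\<close>
  define l where "l = neg C (sha C d) \<cdot> c"
  have l: "l \<in> homs C Z (sho C D)" unfolding l_def using tD tJ by (simp add: homs_def)
  obtain M m q where M: "triangle_on C D M Z m q l" using ex_extension[OF l tD(6)] .
  note tM = triangleE[OF M]
  have MT: "M \<in> \<T>" using right_extension[OF ST M DT S(3)] .
  \<comment> \<open>Base change applied to \<open>c\<close> in the role of \<open>z\<close> presents \<open>M\<close> as an extension of \<open>X\<close> by \<open>J1\<close>.\<close>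
  have "M \<in> \<A>"
  proof -
    obtain t' u' where "triangle_on C M X (sho C J1) t' (neg C (sha C j) \<cdot> (c \<cdot> g)) u'"
      by (rule base_change[OF triangle_rotate[OF D] triangle_rotate2[OF J1(3)] M[unfolded l_def]])
    then obtain f where "triangle_on C J1 M X f t' (neg C (sha C j) \<cdot> (c \<cdot> g))"
      using triangle_unrotate tJ(6) by metis
    then show ?thesis using left_extension[OF AB] J1(1) sub(1) X(1) by blast
  qed
  then have MU: "M \<in> \<U>" using sub by blast
  have "l \<cdot> g = neg C (sha C d \<cdot> (c \<cdot> g))" unfolding l_def using tD(1,5,6) tJ(3) g by (simp add: homs_def)
  also have "\<dots> = zerom C X (sho C D)" unfolding triangle_zero3[OF D] using tD by simp
  finally obtain x where x: "x \<in> homs C X M" "q \<cdot> x = g" using factor_in2[OF M g] by blast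
  have lz: "l \<cdot> z \<in> homs C U (sho C D)" using l tz cmp_hom by blast
  obtain F a k where F: "triangle_on C D F U a k (l \<cdot> z)" using ex_extension[OF lz tD(6)] .
  note tF = triangleE[OF F]
  obtain t u where t: "triangle_on C F M S t (s \<cdot> q) u" "q \<cdot> t = neg C (z \<cdot> k)"
    using base_change[OF M S(1) F] .
  have rt: "is_refl F M t" unfolding is_refl_def using MT S(2) t(1) by blast
  have tt: "t \<in> homs C F M" using triangleE[OF t(1)] by blast
  obtain \<mu> \<mu>' where \<mu>: "comparison F \<mu>" "\<mu>' \<in> homs C (om_ob (si_ob F)) (si_ob (om_ob F))"
    "\<mu>' \<cdot> \<mu> \<simeq> ident C (si_ob (om_ob F))" "\<mu> \<cdot> \<mu>' \<simeq> ident C (om_ob (si_ob F))"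
    using condition_I_comparison[OF cond_I F DT \<kappa>(3)] .
  let ?F1 = "om_ob F" and ?Z1 = "si_ob (om_ob F)" and ?F2 = "si_ob F" and ?Z2 = "om_ob (si_ob F)"
  let ?y = "eps (si_ob F)"
  have O: "F \<in> Obj C" "?F1 \<in> Obj C" "?F2 \<in> Obj C" "?Z1 \<in> Obj C" "?Z2 \<in> Obj C" "M \<in> Obj C"
    using tF tM om_obj si_obj by blast+
  have \<mu>h: "\<mu> \<in> homs C ?Z1 ?Z2" using \<mu> comparison_def by blast
  note e = eps_hom[OF O(1)] eta_hom[OF O(1)] eps_hom[OF O(3)] eta_hom[OF O(2)]
  obtain n n' where n: "n \<in> homs C M ?F2" "n' \<in> homs C ?F2 M" "n \<cdot> t = eta F" "n' \<cdot> eta F = t"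
    "n' \<cdot> n \<simeq> ident C M" "n \<cdot> n' \<simeq> ident C ?F2"
    using refl_inverse[OF rt reflection_refl[OF O(1)]] .
  obtain n0 where n0: "n0 \<in> homs C M ?Z2" "?y \<cdot> n0 = n"
    using corefl_factor[OF coreflection_corefl[OF O(3)] n(1) MU] .
  \<comment> \<open>Modulo \<open>\<I>\<close>, the object \<open>\<sigma>\<omega>F \<cong> \<omega>\<sigma>F\<close> is a retract of \<open>M\<close>, because \<open>M \<cong> \<sigma>F\<close> lies in \<open>\<U>\<close> and so
    lifts to the coreflection of \<open>\<sigma>F\<close>.\<close>
  have F1A: "?F1 \<in> \<A>"
  proof -
    let ?w = "n0 \<cdot> (n' \<cdot> ?y)"
    have w: "?w \<in> homs C ?Z2 ?Z2" using n0(1) n(2) e by (simp add: homs_def)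
    have "?y \<cdot> ?w = (?y \<cdot> n0) \<cdot> (n' \<cdot> ?y)" using n0(1) n(1,2) e by (simp add: homs_def)
    also have "\<dots> = (n \<cdot> n') \<cdot> ?y" unfolding n0(2) using n(1,2) e by (simp add: homs_def)
    also have "\<dots> \<simeq> ident C ?F2 \<cdot> ?y" using eqv_cmp_right[OF n(6) e(3)] n(1,2) cmp_hom by blast
    also have "ident C ?F2 \<cdot> ?y = ?y \<cdot> ident C ?Z2" using e O by (simp add: homs_def)
    finally have w1: "?w \<simeq> ident C ?Z2"
      using corefl_cancel[OF coreflection_corefl[OF O(3)] w ident_hom[OF O(5)] om_U[OF O(3)]] by blast
    have "(\<mu>' \<cdot> n0) \<cdot> (n' \<cdot> (?y \<cdot> \<mu>)) = \<mu>' \<cdot> (?w \<cdot> \<mu>)"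
      using \<mu>h \<mu>(2) n0(1) n(2) e by (simp add: homs_def)
    also have "\<dots> \<simeq> \<mu>' \<cdot> (ident C ?Z2 \<cdot> \<mu>)"
      using eqv_cmp_left[OF eqv_cmp_right[OF w1 \<mu>h w] cmp_hom[OF \<mu>h w] \<mu>(2)] .
    also have "\<mu>' \<cdot> (ident C ?Z2 \<cdot> \<mu>) = \<mu>' \<cdot> \<mu>" using \<mu>h by (simp add: homs_def)
    also have "\<dots> \<simeq> ident C ?Z1" by fact
    finally have ret: "(\<mu>' \<cdot> n0) \<cdot> (n' \<cdot> (?y \<cdot> \<mu>)) \<simeq> ident C ?Z1" .
    have h: "n' \<cdot> (?y \<cdot> \<mu>) \<in> homs C ?Z1 M" "\<mu>' \<cdot> n0 \<in> homs C M ?Z1"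
      using \<mu>h \<mu>(2) n0(1) n(2) e by (simp_all add: homs_def)
    have "orth ?Z1 B" if "B \<in> \<B>" for B
      using orth_retract[OF h ret] cotorsion_pairD(7)[OF AB \<open>M \<in> \<A>\<close>] that sub(3) by blast
    then have Z1: "?Z1 \<in> \<A>" using left_mem_iff[OF AB] O by blast
    obtain S' s' h' where "S' \<in> \<S>" "triangle_on C ?F1 ?Z1 S' (eta ?F1) s' h'"
      using reflection_refl[OF O(2)] unfolding is_refl_def by blast
    then have "?F1 \<in> star C (shift_down C \<S>) \<A>" using star_down_iff[OF S_obj] Z1 by blast
    then show ?thesis using mut om_U[OF O(1)] by blast
  qed
  have ke: "k \<cdot> eps F \<in> homs C ?F1 U" using tF e cmp_hom by blast
  have "\<kappa> \<cdot> (k \<cdot> eps F) \<in> homs C ?F1 (sho C Y)" using ke t\<kappa> cmp_hom by blast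
  then have "\<kappa> \<cdot> (k \<cdot> eps F) = zerom C ?F1 (sho C Y)"
    using orthD cotorsion_pairD(7)[OF AB F1A Y] by blast
  then obtain y where "y \<in> homs C ?F1 J" "p \<cdot> y = k \<cdot> eps F" using factor_in2[OF \<kappa>(1) ke] by blast
  then have nke: "null (k \<cdot> eps F)" using nullI[OF \<kappa>(2) _ t\<kappa>(2)] by metis
  \<comment> \<open>Cancelling in turn the reflection of \<open>\<omega>F\<close>, the isomorphism \<open>\<mu>\<close> and the coreflection of \<open>\<sigma>F\<close> brings
    the vanishing back to \<open>q\<close>.\<close>
  have qn: "q \<cdot> n' \<in> homs C ?F2 Z" using tM n cmp_hom by blast
  have qny: "(q \<cdot> n') \<cdot> ?y \<in> homs C ?Z2 Z" using qn e cmp_hom by blast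
  have n1: "null (((q \<cdot> n') \<cdot> ?y) \<cdot> \<mu>)"
  proof -
    have "((((q \<cdot> n') \<cdot> ?y) \<cdot> \<mu>)) \<cdot> eta ?F1 = (q \<cdot> n') \<cdot> ((?y \<cdot> \<mu>) \<cdot> eta ?F1)"
      using tM n(2) e \<mu>h by (simp add: homs_def)
    also have "\<dots> \<simeq> (q \<cdot> n') \<cdot> (eta F \<cdot> eps F)"
      using \<mu>(1) eqv_cmp_left[OF _ cmp_hom[OF e(4) cmp_hom[OF \<mu>h e(3)]] qn]
      unfolding comparison_def by blast
    also have "(q \<cdot> n') \<cdot> (eta F \<cdot> eps F) = (q \<cdot> (n' \<cdot> eta F)) \<cdot> eps F"
      using tM n(2) e by (simp add: homs_def)
    also have "\<dots> = neg C (z \<cdot> (k \<cdot> eps F))"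
      unfolding n(4) t(2) using tz tF e by (simp add: homs_def)
    finally have "((((q \<cdot> n') \<cdot> ?y) \<cdot> \<mu>)) \<cdot> eta ?F1 \<simeq> neg C (z \<cdot> (k \<cdot> eps F))" .
    moreover have "null (neg C (z \<cdot> (k \<cdot> eps F)))"
      using null_neg[OF null_cmp_left[OF nke ke tz(1)] cmp_hom[OF ke tz(1)]] .
    ultimately have "null (((((q \<cdot> n') \<cdot> ?y) \<cdot> \<mu>)) \<cdot> eta ?F1)" using eqv_null by blast
    then show ?thesis
      using refl_null[OF reflection_refl[OF O(2)] cmp_hom[OF \<mu>h qny] S(3)] by blast
  qed
  have "null ((q \<cdot> n') \<cdot> ?y)"
  proof -
    have "null ((((q \<cdot> n') \<cdot> ?y) \<cdot> \<mu>) \<cdot> \<mu>')" using null_cmp_right[OF n1 \<mu>(2) cmp_hom[OF \<mu>h qny]] .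
    moreover have "(((q \<cdot> n') \<cdot> ?y) \<cdot> \<mu>) \<cdot> \<mu>' = ((q \<cdot> n') \<cdot> ?y) \<cdot> (\<mu> \<cdot> \<mu>')"
      using tM n(2) e \<mu>h \<mu>(2) by (simp add: homs_def)
    moreover have "((q \<cdot> n') \<cdot> ?y) \<cdot> ident C ?Z2 \<simeq> ((q \<cdot> n') \<cdot> ?y) \<cdot> (\<mu> \<cdot> \<mu>')"
      using eqv_cmp_left[OF eqv_sym[OF \<mu>(4)] ident_hom[OF O(5)] qny] .
    moreover have "((q \<cdot> n') \<cdot> ?y) \<cdot> ident C ?Z2 = (q \<cdot> n') \<cdot> ?y" using qny by (simp add: homs_def)
    ultimately show ?thesis using eqv_null by simp
  qed
  then have "null (((q \<cdot> n') \<cdot> ?y) \<cdot> n0)" using null_cmp_right[OF _ n0(1) qny] by blast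
  moreover have "((q \<cdot> n') \<cdot> ?y) \<cdot> n0 = q \<cdot> (n' \<cdot> (?y \<cdot> n0))"
    using tM n(2) e n0(1) by (simp add: homs_def)
  ultimately have "null (q \<cdot> (n' \<cdot> n))" unfolding n0(2) by simp
  moreover have "q \<cdot> ident C M \<simeq> q \<cdot> (n' \<cdot> n)"
    using eqv_cmp_left[OF eqv_sym[OF n(5)] ident_hom[OF O(6)] tM(2)] .
  moreover have "q \<cdot> ident C M = q" using tM by (simp add: homs_def)
  ultimately have "null q" using eqv_null by simp
  then show ?thesis using null_cmp_right[OF _ x(1) tM(2)] x(2) by blast
qed

section \<open>The two descriptions of mutable cotorsion pairs\<close>

text \<open>
  The right approximation of \<open>Y \<in> \<U>\<close> has middle term in \<open>\<U> \<inter> \<V> = \<I>\<close>, so the choice in \<open>shift1\<close> succeeds.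
\<close>

lemma shift1_triangle:
  assumes "Y \<in> \<U>"
  obtains J f g h where "J \<in> \<I>" "shift1 C \<I> \<U> Y \<in> \<U>" "triangle_on C Y J (shift1 C \<I> \<U> Y) f g h"
proof -
  have "Y \<in> Obj C" using assms U_obj by blast
  then obtain U J f g h where J: "U \<in> \<U>" "J \<in> \<V>" "triangle_on C Y J U f g h"
    using right_approximation[OF UV] by blast
  have "J \<in> \<U>" using left_extension[OF UV J(3) assms J(1)] .
  then have "\<exists>U. U \<in> \<U> \<and> (\<exists>I \<in> \<I>. \<exists>f g h. triangle_on C Y I U f g h)" using J core_UV by blast
  from someI_ex[OF this] show ?thesis using that unfolding shift1_def by blast
qed

lemma ext1_quot_trivial:
  assumes "X \<in> \<T> \<inter> \<U>" "Y \<in> \<U>"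
  shows "carrier (ext1_quot C \<S> \<T> \<U> X Y) = {\<one>\<^bsub>ext1_quot C \<S> \<T> \<U> X Y\<^esub>} \<longleftrightarrow>
    (\<forall>f \<in> homs C X (si_ob (shift1 C \<I> \<U> Y)). null f)"
proof -
  let ?W = "si_ob (shift1 C \<I> \<U> Y)"
  have s: "shift1 C \<I> \<U> Y \<in> \<U>" using shift1_triangle[OF assms(2)] by blast
  have so: "shift1 C \<I> \<U> Y \<in> Obj C" using s U_obj by blast
  have W: "?W \<in> \<T> \<inter> \<U>" using si_T[OF so] refl_in_U[OF reflection_refl[OF so] s] by blast
  have O: "X \<in> Obj C" "?W \<in> Obj C" using assms W U_obj by blast+
  have c: "carrier (ext1_quot C \<S> \<T> \<U> X Y) = cls ` homs C X ?W"
    unfolding ext1_quot_def Sigma_obj_def fob_si using quot_homs[OF assms(1) W] by (simp add: homgrp_def)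
  have o: "\<one>\<^bsub>ext1_quot C \<S> \<T> \<U> X Y\<^esub> = cls (zerom C X ?W)"
    unfolding ext1_quot_def Sigma_obj_def fob_si by (simp add: homgrp_def quot_def)
  have z: "zerom C X ?W \<in> homs C X ?W" using zero_hom O by blast
  have key: "cls f = cls (zerom C X ?W) \<longleftrightarrow> null f" if "f \<in> homs C X ?W" for f
  proof -
    have "f \<ominus> zerom C X ?W = f" using that O by (simp add: homs_def)
    then show ?thesis using cls_iff[OF that z] eqvI[OF that z] eqvD by metis
  qed
  have "cls ` homs C X ?W = {cls (zerom C X ?W)} \<longleftrightarrow> (\<forall>f \<in> homs C X ?W. cls f = cls (zerom C X ?W))"
    using z by auto
  then show ?thesis unfolding c o using key by simp
qed

lemma mutable_iff:
  assumes "(\<A>, \<B>) \<in> cotorsion_pairs C" "\<A> \<subseteq> \<U>" "\<B> \<subseteq> \<T>"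
  shows "(\<A>, \<B>) \<in> mutable_cotorsion_pairs C \<S> \<T> \<U> \<V> \<longleftrightarrow> \<S> \<subseteq> \<A> \<and> \<V> \<subseteq> \<B> \<and>
    (\<forall>A \<in> \<A>. \<forall>B \<in> \<B>. \<forall>f \<in> homs C (si_ob A) (si_ob (shift1 C \<I> \<U> (om_ob B))). null f)"
proof -
  have "carrier (ext1_quot C \<S> \<T> \<U> (si_ob A) (om_ob B)) = {\<one>\<^bsub>ext1_quot C \<S> \<T> \<U> (si_ob A) (om_ob B)\<^esub>} \<longleftrightarrow>
      (\<forall>f \<in> homs C (si_ob A) (si_ob (shift1 C \<I> \<U> (om_ob B))). null f)" if AB: "A \<in> \<A>" "B \<in> \<B>" for A B
  proof (rule ext1_quot_trivial)
    have O: "A \<in> Obj C" "B \<in> Obj C" using AB assms U_obj T_obj by blast+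
    show "si_ob A \<in> \<T> \<inter> \<U>" using si_T[OF O(1)] refl_in_U[OF reflection_refl[OF O(1)]] AB assms by blast
    show "om_ob B \<in> \<U>" using om_U O by blast
  qed
  then show ?thesis unfolding mutable_cotorsion_pairs_def using assms by (simp add: fob_om fob_si)
qed

text \<open>
  Each half of the pair is recovered from the other by orthogonality. The first equation applies
  \<open>orth_if_quotient_vanishes\<close> to \<open>X \<rightarrow> A \<rightarrow> \<sigma>A\<close>, whose first morphism has cone in \<open>\<S>\<close>; the second applies it to
  \<open>\<omega>B \<rightarrow> B \<rightarrow> Y\<close>, which is a coreflection by \<open>corefl_comp\<close>.
\<close>

lemma mutable_imp_fixed:
  assumes AB: "(\<A>, \<B>) \<in> cotorsion_pairs C" "\<S> \<subseteq> \<A>" "\<A> \<subseteq> \<U>" "\<V> \<subseteq> \<B>" "\<B> \<subseteq> \<T>"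
    and van: "\<And>A B f. A \<in> \<A> \<Longrightarrow> B \<in> \<B> \<Longrightarrow>
      f \<in> homs C (si_ob A) (si_ob (shift1 C \<I> \<U> (om_ob B))) \<Longrightarrow> null f"
  shows "\<A> = \<U> \<inter> star C (shift_down C \<S>) \<A>" "\<B> = \<T> \<inter> star C \<B> (shift_up C \<V>)"
proof -
  have AO: "\<A> \<subseteq> Obj C" "\<B> \<subseteq> Obj C" using cotorsion_pairD[OF AB(1)] by blast+
  have orth: "orth X Y"
    if "X \<in> \<U>" "A \<in> \<A>" "x0 \<in> homs C X (si_ob A)"
      "\<And>T f. T \<in> \<T> \<Longrightarrow> f \<in> homs C X T \<Longrightarrow> \<exists>g \<in> homs C (si_ob A) T. g \<cdot> x0 = f"
      "Y \<in> \<T>" "B \<in> \<B>" "is_corefl Y (om_ob B) e" for X A x0 Y B e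
  proof -
    have BO: "B \<in> Obj C" using that AO by blast
    obtain J f g h where J: "J \<in> \<I>" "shift1 C \<I> \<U> (om_ob B) \<in> \<U>"
        "triangle_on C (om_ob B) J (shift1 C \<I> \<U> (om_ob B)) f g h"
      using shift1_triangle[OF om_U[OF BO]] .
    have "shift1 C \<I> \<U> (om_ob B) \<in> Obj C" using J U_obj by blast
    from orth_if_quotient_vanishes[OF that(1,3,4,5,7) J(3,1,2) reflection_refl[OF this] van[OF that(2,6)]]
    show ?thesis .
  qed
  show "\<A> = \<U> \<inter> star C (shift_down C \<S>) \<A>"
  proof (intro equalityI subsetI)
    fix A assume A: "A \<in> \<A>"
    obtain T S t s h where S: "T \<in> \<T>" "S \<in> \<S>" "triangle_on C A T S t s h"
      using right_approximation[OF ST] A AO by (metis subsetD)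
    have "T \<in> \<A>" using left_extension[OF AB(1) S(3) A] S AB(2) by blast
    then show "A \<in> \<U> \<inter> star C (shift_down C \<S>) \<A>" using star_down_iff[OF S_obj] S A AB(3) by blast
  next
    fix X assume X: "X \<in> \<U> \<inter> star C (shift_down C \<S>) \<A>"
    then obtain A S a s h where A: "A \<in> \<A>" "S \<in> \<S>" "triangle_on C X A S a s h"
      using star_down_iff[OF S_obj] by blast
    note tA = triangleE[OF A(3)]
    have x0: "eta A \<cdot> a \<in> homs C X (si_ob A)" using tA eta_hom cmp_hom by blast
    have ext: "\<exists>g \<in> homs C (si_ob A) T. g \<cdot> (eta A \<cdot> a) = f" if f: "T \<in> \<T>" "f \<in> homs C X T" for T f
    proof -
      have "sha C f \<cdot> h \<in> homs C S (sho C T)" using tA f by (simp add: homs_def)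
      then have "sha C f \<cdot> h = zerom C S (sho C T)" using orthD S_T A(2) f(1) by blast
      then obtain f' where f': "f' \<in> homs C A T" "f' \<cdot> a = f" using factor_out0[OF A(3) f(2)] by blast
      obtain g where g: "g \<in> homs C (si_ob A) T" "g \<cdot> eta A = f'"
        using refl_factor[OF reflection_refl[OF tA(6)] f'(1) f(1)] .
      have "g \<cdot> (eta A \<cdot> a) = (g \<cdot> eta A) \<cdot> a" using g(1) tA eta_hom[OF tA(6)] by (simp add: homs_def)
      then have "g \<cdot> (eta A \<cdot> a) = f" unfolding g(2) f'(2) .
      then show ?thesis using g by blast
    qed
    have "orth X B" if B: "B \<in> \<B>" for B
    proof (rule orth[OF _ A(1) x0 ext _ B])
      show "is_corefl B (om_ob B) (eps B)" using coreflection_corefl B AO by blast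
    qed (use X B AB(5) in auto)
    then show "X \<in> \<A>" using left_mem_iff[OF AB(1)] tA by blast
  qed
  show "\<B> = \<T> \<inter> star C \<B> (shift_up C \<V>)"
  proof (intro equalityI subsetI)
    fix B assume B: "B \<in> \<B>"
    obtain U V v u h where V: "U \<in> \<U>" "V \<in> \<V>" "triangle_on C V U B v u h"
      using left_approximation[OF UV] B AO by (metis subsetD)
    have "U \<in> \<B>" using right_extension[OF AB(1) V(3) _ B] V AB(4) by blast
    then show "B \<in> \<T> \<inter> star C \<B> (shift_up C \<V>)" using star_up_iff[OF V_obj] V B AB(5) by blast
  next
    fix Y assume Y: "Y \<in> \<T> \<inter> star C \<B> (shift_up C \<V>)"
    then obtain B V v b h where B: "B \<in> \<B>" "V \<in> \<V>" "triangle_on C V B Y v b h"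
      using star_up_iff[OF V_obj] by blast
    note tB = triangleE[OF B(3)]
    have e: "is_corefl Y (om_ob B) (b \<cdot> eps B)"
      using corefl_comp[OF B(3,2) coreflection_corefl[OF tB(6)]] .
    have "orth A Y" if A: "A \<in> \<A>" for A
    proof -
      have AO': "A \<in> Obj C" using A AO by blast
      have "\<exists>g \<in> homs C (si_ob A) T. g \<cdot> eta A = f" if "T \<in> \<T>" "f \<in> homs C A T" for T f
        using refl_factor[OF reflection_refl[OF AO'] that(2,1)] by blast
      moreover have "A \<in> \<U>" "Y \<in> \<T>" using A AB(3) Y by blast+
      ultimately show ?thesis using orth[OF _ A eta_hom[OF AO'] _ _ B(1) e] by blast
    qed
    then show "Y \<in> \<B>" using right_mem_iff[OF AB(1)] tB by blast
  qed
qed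

lemma fixed_imp_mutable:
  assumes AB: "(\<A>, \<B>) \<in> cotorsion_pairs C"
    and A: "\<A> = \<U> \<inter> star C (shift_down C \<S>) \<A>" and B: "\<B> = \<T> \<inter> star C \<B> (shift_up C \<V>)"
  shows "(\<A>, \<B>) \<in> mutable_cotorsion_pairs C \<S> \<T> \<U> \<V>"
proof -
  have AU: "\<A> \<subseteq> \<U>" using A by blast
  have BT: "\<B> \<subseteq> \<T>" using B by blast
  have SA: "\<S> \<subseteq> \<A>" using left_mem_iff[OF AB] S_T BT S_obj by blast
  have VB: "\<V> \<subseteq> \<B>" using right_mem_iff[OF AB] U_V AU V_obj by blast
  have "null f" if *: "A \<in> \<A>" "B \<in> \<B>" "f \<in> homs C (si_ob A) (si_ob (shift1 C \<I> \<U> (om_ob B)))" for A B f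
  proof -
    have O: "A \<in> Obj C" "B \<in> Obj C" using * AU BT U_obj T_obj by blast+
    obtain J i p k where J: "J \<in> \<I>" "shift1 C \<I> \<U> (om_ob B) \<in> \<U>"
        "triangle_on C (om_ob B) J (shift1 C \<I> \<U> (om_ob B)) i p k"
      using shift1_triangle[OF om_U[OF O(2)]] .
    have sO: "shift1 C \<I> \<U> (om_ob B) \<in> Obj C" using J U_obj by blast
    have "si_ob A \<in> \<A>"
      using reflection_refl[OF O(1)] left_extension[OF AB] *(1) SA unfolding is_refl_def by blast
    moreover have "om_ob B \<in> \<B>"
      using coreflection_corefl[OF O(2)] right_extension[OF AB] *(2) VB unfolding is_corefl_def by blast
    moreover have "\<U> \<inter> star C (shift_down C \<S>) \<A> \<subseteq> \<A>" using A by blast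
    ultimately show ?thesis
      using quotient_vanishes[OF AB SA AU BT _ _ si_T[OF O(1)] _ J(3,1,2) reflection_refl[OF sO] *(3)] by blast
  qed
  then show ?thesis using mutable_iff[OF AB AU BT] SA VB by blast
qed

end

theorem corollary5p19:
  fixes C :: "('o, 'a) tcat" and \<S> \<T> \<U> \<V> :: "'o set"
  assumes "triangulated C"
    and "twin_cotorsion_pair C \<S> \<T> \<U> \<V>"
    and "concentric \<S> \<T> \<U> \<V>"
    and "condition_I C \<S> \<T> \<U> \<V>"
    and "condition_II C \<S> \<T> \<U> \<V>"
  shows "mutable_cotorsion_pairs C \<S> \<T> \<U> \<V> =
    {(\<A>, \<B>) \<in> cotorsion_pairs C.
       \<A> = \<U> \<inter> star C (shift_down C \<S>) \<A> \<and>
       \<B> = \<T> \<inter> star C \<B> (shift_up C \<V>)}"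
proof -
  interpret mutation_tcp C \<S> \<T> \<U> \<V>
    using assms by (simp add: mutation_tcp_def mutation_tcp_axioms_def concentric_tcp_def
        concentric_tcp_axioms_def)
  have fixed: "\<A> = \<U> \<inter> star C (shift_down C \<S>) \<A> \<and> \<B> = \<T> \<inter> star C \<B> (shift_up C \<V>)"
    if m: "(\<A>, \<B>) \<in> mutable_cotorsion_pairs C \<S> \<T> \<U> \<V>" for \<A> \<B>
  proof -
    have AB: "(\<A>, \<B>) \<in> cotorsion_pairs C" "\<A> \<subseteq> \<U>" "\<B> \<subseteq> \<T>"
      using m unfolding mutable_cotorsion_pairs_def by blast+
    then show ?thesis using mutable_imp_fixed[OF AB(1)] m mutable_iff[OF AB] by blast
  qed
  have pair: "(\<A>, \<B>) \<in> cotorsion_pairs C"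
    if "(\<A>, \<B>) \<in> mutable_cotorsion_pairs C \<S> \<T> \<U> \<V>" for \<A> \<B>
    using that unfolding mutable_cotorsion_pairs_def by blast
  have iff: "(\<A>, \<B>) \<in> mutable_cotorsion_pairs C \<S> \<T> \<U> \<V> \<longleftrightarrow> (\<A>, \<B>) \<in> cotorsion_pairs C \<and>
      \<A> = \<U> \<inter> star C (shift_down C \<S>) \<A> \<and> \<B> = \<T> \<inter> star C \<B> (shift_up C \<V>)" (is "?m \<longleftrightarrow> ?f")
    for \<A> \<B>
  proof
    assume m: ?m
    show ?f using pair[OF m] fixed[OF m] by (rule conjI)
  next
    assume f: ?f
    show ?m
      by (rule fixed_imp_mutable[OF conjunct1[OF f] conjunct1[OF conjunct2[OF f]] conjunct2[OF conjunct2[OF f]]])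
  qed
  show ?thesis
  proof (rule Set.set_eqI)
    fix p :: "'o set \<times> 'o set"
    obtain \<A> \<B> where p: "p = (\<A>, \<B>)" by (cases p)
    show "p \<in> mutable_cotorsion_pairs C \<S> \<T> \<U> \<V> \<longleftrightarrow> p \<in> {(\<A>, \<B>) \<in> cotorsion_pairs C.
       \<A> = \<U> \<inter> star C (shift_down C \<S>) \<A> \<and> \<B> = \<T> \<inter> star C \<B> (shift_up C \<V>)}"
      unfolding p mem_Collect_eq prod.case by (rule iff)
  qed
qed

end
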